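(* Let $u_0$ be an axisymmetric, swirl-free, divergence-free initial velocity on $\mathbb{R}^3$ with scalar vorticity $\omega_0$, such that $u_0\in L^2(\mathbb{R}^3)$ and $\omega_0,\ \omega_0/r\in L^1(\mathbb{R}^3)\cap L^\infty(\mathbb{R}^3)$. Assume that $\omega_0(r,-z)=-\omega_0(r,z)$ and $\omega_0(r,z)\ge0$ for $z\ge0$, and that $Z(0)<\infty$. Let $\omega(\cdot,t)$ be the corresponding global-in-time solution of the axisymmetric Euler equations without swirl. Then there exist constants $C(\omega_0,u_0)>0$ and $R_0(\omega_0,u_0)\ge1$ that only depend on the initial data such that the following holds: for any $R\ge R_0$, the quantity $$m_R(t):=\iint_{\Pi^+\cap\{r\le R\}}\omega(r,z,t)\,dr\,dz,\qquad \Pi^+=\{(r,z): r>0,\ z>0\},$$ satisfies $$\int_0^\infty m_R(t)^4\,dt\le C(\omega_0,u_0)\,R^4<\infty.$$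
   Context: Use cylindrical coordinates $(r,\theta,z)$ in $\mathbb{R}^3$ and the half plane $\Pi=\{(r,z): r\ge 0,\ z\in\mathbb{R}\}$. An axisymmetric velocity without swirl has the form $u=u_r(r,z,t)e_r+u_z(r,z,t)e_z$. Its scalar vorticity is $\omega=-\partial_z u_r+\partial_r u_z$ (this sign convention is used throughout; $\omega_0$ is the scalar vorticity of $u_0$). Functions of $(r,z)$ are identified with axisymmetric functions on $\mathbb{R}^3$. The axisymmetric Euler equations without swirl are $$(\partial_t+u_r\partial_r+u_z\partial_z)\frac{\omega}{r}=0,$$ where $u$ is recovered from $\omega$ by the axisymmetric Biot–Savart law $u_r=\frac1r\partial_z\psi$, $u_z=-\frac1r\partial_r\psi$, $$\psi(r,z,t)=\frac1{2\pi}\iint_\Pi\sqrt{r\bar r}\,F\Big(\frac{(r-\bar r)^2+(z-\bar z)^2}{r\bar r}\Big)\omega(\bar r,\bar z,t)\,d\bar r\,d\bar z,\qquad F(s)=\int_0^\pi\frac{\cos\theta}{(2(1-\cos\theta)+s)^{1/2}}\,d\theta .$$ For initial data with $u_0\in L^2(\mathbb{R}^3)$ and $\omega_0,\omega_0/r\in L^1\cap L^\infty(\mathbb{R}^3)$ a global-in-time solution is known to exist (Danchin); $\omega/r$ is transported along particle trajectories, so $\|\omega/r\|_{L^p(\mathbb{R}^3)}$ is conserved for $1\le p\le\infty$, and the kinetic energy is conserved. Oddness in $z$ and nonnegativity on $\{z\ge0\}$ of the vorticity are preserved in time. The vertical moment is $Z(t)=\iint_\Pi z\,\omega(r,z,t)\,dr\,dz$.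 *)

theory Defs
  imports "HOL-Analysis.Analysis"
begin

text \<open>
  Points of the half plane are pairs \<open>(r, z)\<close>. A function of \<open>(r, z)\<close> is identified with the
  axisymmetric function \<open>f \<circ> cyl\<close> on \<open>\<real>\<^sup>3\<close>; its values at \<open>r < 0\<close> never matter.
\<close>

definition halfplane :: "(real \<times> real) set" where
  "halfplane = {(r, z). 0 \<le> r}"

definition open_halfplane :: "(real \<times> real) set" where
  "open_halfplane = {(r, z). 0 < r}"

definition cyl :: "real ^ 3 \<Rightarrow> real \<times> real" where
  "cyl x = (sqrt ((x $ 1)\<^sup>2 + (x $ 2)\<^sup>2), x $ 3)"

definition e_r :: "real ^ 3 \<Rightarrow> real ^ 3" where
  "e_r x = vector [x $ 1 / fst (cyl x), x $ 2 / fst (cyl x), 0]"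

definition e_z :: "real ^ 3" where
  "e_z = vector [0, 0, 1]"

definition L1_Linf_le :: "real \<Rightarrow> (real \<times> real \<Rightarrow> real) \<Rightarrow> bool" where
  "L1_Linf_le B f \<longleftrightarrow>
     integrable lborel (\<lambda>x. f (cyl x)) \<and>
     (LINT x|lborel. \<bar>f (cyl x)\<bar>) \<le> B \<and>
     (AE x in lborel. \<bar>f (cyl x)\<bar> \<le> B)"

definition L1_Linf :: "(real \<times> real \<Rightarrow> real) \<Rightarrow> bool" where
  "L1_Linf f \<longleftrightarrow> (\<exists>B. L1_Linf_le B f)"

text \<open>Lebesgue measure of \<open>\<real>\<^sup>3\<close> in cylindrical coordinates.\<close>

definition axi_volume :: "(real \<times> real) measure" where
  "axi_volume = density lborel (\<lambda>(r, z). ennreal (2 * pi * r) * indicator open_halfplane (r, z))"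

text \<open>
  Velocities and vorticities of this regularity need not be differentiable, so divergence and
  vorticity of the initial velocity are distributional. All fields involved are locally integrable
  functions, for which \<open>C\<^sup>1\<close> and \<open>C\<^sup>\<infinity>\<close> compactly supported test functions give the same notion.
\<close>

definition test_function :: "'a::euclidean_space set \<Rightarrow> ('a \<Rightarrow> real) \<Rightarrow> ('a \<Rightarrow> 'a) \<Rightarrow> bool" where
  "test_function S \<phi> g \<longleftrightarrow>
     (\<forall>x. (\<phi> has_derivative (\<lambda>h. g x \<bullet> h)) (at x)) \<and> continuous_on UNIV g \<and>
     compact (closure {x. \<phi> x \<noteq> 0}) \<and> closure {x. \<phi> x \<noteq> 0} \<subseteq> S"

definition square_integrable :: "(real ^ 3 \<Rightarrow> real ^ 3) \<Rightarrow> bool" where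
  "square_integrable u \<longleftrightarrow>
     u \<in> borel_measurable lborel \<and> integrable lborel (\<lambda>x. (norm (u x))\<^sup>2)"

definition axisymmetric_no_swirl ::
    "(real ^ 3 \<Rightarrow> real ^ 3) \<Rightarrow> (real \<times> real \<Rightarrow> real) \<Rightarrow> (real \<times> real \<Rightarrow> real) \<Rightarrow> bool" where
  "axisymmetric_no_swirl u ur uz \<longleftrightarrow>
     ur \<in> borel_measurable borel \<and> uz \<in> borel_measurable borel \<and>
     (AE x in lborel. u x = ur (cyl x) *\<^sub>R e_r x + uz (cyl x) *\<^sub>R e_z)"

definition divergence_free :: "(real ^ 3 \<Rightarrow> real ^ 3) \<Rightarrow> bool" where
  "divergence_free u \<longleftrightarrow>
     (\<forall>\<phi> g. test_function UNIV \<phi> g \<longrightarrow> (LINT x|lborel. u x \<bullet> g x) = 0)"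

text \<open>
  Weak form of \<open>\<omega> = - \<partial>\<^sub>z u\<^sub>r + \<partial>\<^sub>r u\<^sub>z\<close> on the open half plane; the components of \<open>g p\<close> are
  \<open>(\<partial>\<^sub>r \<phi>, \<partial>\<^sub>z \<phi>)\<close>.
\<close>

definition scalar_vorticity ::
    "(real \<times> real \<Rightarrow> real) \<Rightarrow> (real \<times> real \<Rightarrow> real) \<Rightarrow> (real \<times> real \<Rightarrow> real) \<Rightarrow> bool" where
  "scalar_vorticity ur uz \<omega> \<longleftrightarrow>
     (\<forall>\<phi> g. test_function open_halfplane \<phi> g \<longrightarrow>
        (LINT p|lborel. \<omega> p * \<phi> p) = (LINT p|lborel. ur p * snd (g p) - uz p * fst (g p)))"

definition kernel_F :: "real \<Rightarrow> real" where
  "kernel_F s = integral {0..pi} (\<lambda>\<theta>. cos \<theta> / sqrt (2 * (1 - cos \<theta>) + s))"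

definition stream :: "(real \<times> real \<Rightarrow> real) \<Rightarrow> real \<Rightarrow> real \<Rightarrow> real" where
  "stream \<omega> r z = 1 / (2 * pi) *
     (LINT (r', z'):halfplane|lborel.
        sqrt (r * r') * kernel_F (((r - r')\<^sup>2 + (z - z')\<^sup>2) / (r * r')) * \<omega> (r', z'))"

text \<open>The Biot--Savart velocity \<open>(u\<^sub>r, u\<^sub>z)\<close>; only its values at \<open>r > 0\<close> are meaningful.\<close>

definition velocity :: "(real \<times> real \<Rightarrow> real) \<Rightarrow> real \<times> real \<Rightarrow> real \<times> real" where
  "velocity \<omega> = (\<lambda>(r, z). (deriv (\<lambda>z. stream \<omega> r z) z / r, - deriv (\<lambda>r. stream \<omega> r z) r / r))"

text \<open>
  Global solutions with vorticity locally bounded in time with values in \<open>L\<^sup>1 \<inter> L\<^sup>\<infinity>\<close>. As \<open>\<omega>\<close> is not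
  assumed differentiable, \<open>(\<partial>\<^sub>t + u\<^sub>r \<partial>\<^sub>r + u\<^sub>z \<partial>\<^sub>z) (\<omega> / r) = 0\<close> means that \<open>\<omega> / r\<close> is constant
  along the particle trajectories \<open>t \<mapsto> X t p\<close> of the velocity recovered from \<open>\<omega>\<close>. As usual for
  flows of divergence-free fields that are not Lipschitz, the flow \<open>X t\<close> is
  required to preserve the volume of \<open>\<real>\<^sup>3\<close>. The axis \<open>r = 0\<close> is a null set and is left out.
\<close>

definition particle_flow ::
    "(real \<Rightarrow> real \<times> real \<Rightarrow> real) \<Rightarrow> (real \<Rightarrow> real \<times> real \<Rightarrow> real \<times> real) \<Rightarrow> bool" where
  "particle_flow \<omega> X \<longleftrightarrow>
     (\<forall>p\<in>open_halfplane. X 0 p = p) \<and>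
     (\<forall>p\<in>open_halfplane. \<forall>t\<ge>0.
        ((\<lambda>s. X s p) has_vector_derivative velocity (\<omega> t) (X t p)) (at t within {0..})) \<and>
     (\<forall>t\<ge>0. bij_betw (X t) open_halfplane open_halfplane \<and>
        X t \<in> borel_measurable borel \<and> distr axi_volume borel (X t) = axi_volume)"

definition euler_solution ::
    "(real \<times> real \<Rightarrow> real) \<Rightarrow> (real \<Rightarrow> real \<times> real \<Rightarrow> real) \<Rightarrow> bool" where
  "euler_solution \<omega>\<^sub>0 \<omega> \<longleftrightarrow>
     (\<forall>T. \<exists>B. \<forall>t\<in>{0..T}. L1_Linf_le B (\<omega> t)) \<and>
     (\<exists>X. particle_flow \<omega> X \<and>
        (\<forall>t\<ge>0. AE p in lborel. p \<in> open_halfplane \<longrightarrow>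
           \<omega> t (X t p) / fst (X t p) = \<omega>\<^sub>0 p / fst p))"

text \<open>
  Used only for vorticities with \<open>z \<omega>(r, z) \<ge> 0\<close>, for which \<open>Z\<close> is well defined in \<open>[0, \<infinity>]\<close>.
\<close>

definition vertical_moment :: "(real \<times> real \<Rightarrow> real) \<Rightarrow> ennreal" where
  "vertical_moment \<omega> = (\<integral>\<^sup>+ p\<in>halfplane. ennreal (snd p * \<omega> p) \<partial>lborel)"

definition partial_mass :: "real \<Rightarrow> (real \<times> real \<Rightarrow> real) \<Rightarrow> real" where
  "partial_mass R \<omega> = (LINT p:{(r, z). 0 < r \<and> r \<le> R \<and> 0 < z}|lborel. \<omega> p)"

end

theory Submission
  imports Defs
begin

text \<open>
  Write \<open>k\<close> for the axisymmetric Biot--Savart kernel. Since \<open>\<omega> dr dz\<close> is transported by the flow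
  \<open>X\<close>, everything can be expressed by \<open>X\<close> and the measure \<open>W = |\<omega>\<^sub>0| dr dz\<close>. The flow reflected in
  the plane \<open>z = 0\<close> solves the same equation, so by Yudovich's uniqueness argument \<open>X\<close> commutes with the
  reflection; as \<open>X t\<close> is injective, particles never cross the plane.

  The moment \<open>Z\<close> restricted to \<open>z > 0\<close> is therefore nonnegative, and symmetrising \<open>k\<close> gives
  \<open>4 \<pi> Z' = - \<integral>\<integral> (S(r, r', z - z') - S(r, r', z + z')) d\<mu> d\<mu>\<close> for \<open>\<mu> = \<omega> dr dz\<close> on \<open>z > 0\<close>, where
  \<open>S(r, r', \<zeta>) = \<integral> a\<^sup>2 / (a\<^sup>2 + \<zeta>\<^sup>2)\<^bsup>3/2\<^esup> d\<theta>\<close> over \<open>[0, \<pi>]\<close> and \<open>a\<^sup>2 = r\<^sup>2 + r'\<^sup>2 - 2 r r' cos \<theta>\<close>.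
  This decreases in \<open>|\<zeta>|\<close>. The bounds on \<open>\<omega>/r\<close> and \<open>Z\<close> prevent \<open>\<mu>\<close> from concentrating at the
  plane, at the axis or at infinity, and force \<open>- Z' \<ge> c m\<^sub>R\<^sup>4 / R\<^sup>4\<close>; integrate in time.
\<close>

subsection \<open>Cylindrical coordinates\<close>

text \<open>A solution is only given through its flow: that oddness, the sign and the moment survive
  in time has to be derived from \<open>particle_flow\<close>, and no regularity of \<omega> in t is
  available beyond differentiable trajectories. Integrals over particle labels avoid this: their
  time derivatives follow from bounded difference quotients. Two kinds of bounds are kept apart. The
  sup bound \<open>B\<close> of \<omega> depends on the time interval and enters only uniqueness and
  integrability. The final constant is built from what holds for all times: \<Lambda> for
  |\<omega>/r|, M for the mass in dr dz, and Z for the moment. The exponent 4 arises as follows. A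
  square at distance \<rho> from the axis contributes (its mass)^2 / \<rho>. To keep half of the
  mass m in r \<le> R one may cut at distance \<eta> of order m / R^2 from axis and plane and at
  height H = 4 Z / m. The distances \<rho> of all covering squares then add up to at most the order
  of R^4 / m^2, and Cauchy-Schwarz yields m^2 divided by that sum.\<close>

lemma distr_norm_plane:
  "distr lborel borel (norm :: real \<times> real \<Rightarrow> real)
     = density lborel (\<lambda>r. ennreal (2 * pi * r) * indicator {0<..} r)" (is "?M = ?N")
proof (rule measure_eqI_generator_eq[where E = "range (\<lambda>a::real. {..a})" and \<Omega> = UNIV
      and A = "\<lambda>n. {..real n}"])
  show "Int_stable (range (\<lambda>a::real. {..a}))"
    by (auto simp: Int_stable_def)
  have M: "emeasure ?M {..a} = ennreal (if a < 0 then 0 else pi * a\<^sup>2)" for a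
  proof -
    have *: "norm -` {..a} = cball (0 :: real \<times> real) a" by auto
    have "emeasure ?M {..a} = emeasure lborel (cball (0 :: real \<times> real) a)"
      by (subst emeasure_distr) (auto simp: *)
    also have "\<dots> = ennreal (if a < 0 then 0 else pi * a\<^sup>2)"
      by (auto simp: emeasure_cball eval_unit_ball_vol power2_eq_square)
    finally show ?thesis .
  qed
  have N: "emeasure ?N {..a} = ennreal (if a < 0 then 0 else pi * a\<^sup>2)" for a
  proof -
    have "emeasure ?N {..a} = (\<integral>\<^sup>+ r. ennreal (2 * pi * r) * indicator {0<..} r * indicator {..a} r \<partial>lborel)"
      by (subst emeasure_density) auto
    also have "\<dots> = (\<integral>\<^sup>+ r. ennreal (2 * pi * r) * indicator {0..a} r \<partial>lborel)"
      by (intro nn_integral_cong) (auto simp: indicator_def)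
    also have "\<dots> = ennreal (if a < 0 then 0 else pi * a\<^sup>2)"
    proof (cases "a < 0")
      case False
      then have "(\<integral>\<^sup>+ r. ennreal (2 * pi * r) * indicator {0..a} r \<partial>lborel) = pi * a\<^sup>2 - pi * 0\<^sup>2"
        by (intro nn_integral_FTC_Icc) (auto intro!: derivative_eq_intros)
      with False show ?thesis by simp
    qed auto
    finally show ?thesis .
  qed
  show "emeasure ?M X = emeasure ?N X" if "X \<in> range (\<lambda>a::real. {..a})" for X
    using that M N by auto
  show "emeasure ?M {..real n} \<noteq> \<infinity>" for n
    by (subst M) auto
  have "x \<in> (\<Union>n. {..real n})" for x :: real
    using real_nat_ceiling_ge[of x] by auto
  then show "(\<Union>n. {..real n}) = UNIV" by auto
qed (auto simp: borel_eq_atMost)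

lemma nn_integral_radial:
  fixes c :: "real \<times> real"
  assumes [measurable]: "f \<in> borel_measurable borel"
  shows "(\<integral>\<^sup>+ q. f (dist c q) \<partial>lborel) = (\<integral>\<^sup>+ r. ennreal (2 * pi * r) * indicator {0<..} r * f r \<partial>lborel)"
proof -
  have "(\<integral>\<^sup>+ q. f (dist c q) \<partial>lborel) = (\<integral>\<^sup>+ q. f (dist c q) \<partial>distr lborel borel ((+) c))"
    by (simp add: lborel_distr_plus)
  also have "\<dots> = (\<integral>\<^sup>+ q. f (norm (q :: real \<times> real)) \<partial>lborel)"
    by (subst nn_integral_distr) (auto simp: dist_norm)
  also have "\<dots> = (\<integral>\<^sup>+ r. f r \<partial>distr lborel borel (norm :: real \<times> real \<Rightarrow> real))"
    by (subst nn_integral_distr) auto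
  also have "\<dots> = (\<integral>\<^sup>+ r. ennreal (2 * pi * r) * indicator {0<..} r * f r \<partial>lborel)"
    unfolding distr_norm_plane by (subst nn_integral_density) auto
  finally show ?thesis .
qed

lemma vector3_eq: "(vector [x, y, z] :: real ^ 3) = x *\<^sub>R axis 1 1 + y *\<^sub>R axis 2 1 + z *\<^sub>R axis 3 1"
  by (auto simp: vec_eq_iff forall_3 axis_def vector_3)

lemma prod_Basis_R3: "(\<Prod>b\<in>Basis. (v :: real ^ 3) \<bullet> b) = v $ 1 * v $ 2 * v $ 3"
proof -
  have *: "(Basis :: (real ^ 3) set) = (\<lambda>i. axis i 1) ` UNIV"
    by (auto simp: Basis_vec_def)
  have "(\<Prod>b\<in>Basis. v \<bullet> b) = (\<Prod>i\<in>UNIV. v \<bullet> axis i 1)"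
    unfolding * by (rule prod.reindex_cong[where l = "\<lambda>i. axis i 1"]) (simp_all add: inj_on_def axis_eq_axis)
  also have "\<dots> = (\<Prod>i\<in>UNIV. v $ i)"
    by (simp add: inner_axis)
  also have "\<dots> = v $ 1 * v $ 2 * v $ 3"
    unfolding UNIV_3 by simp
  finally show ?thesis .
qed

lemma lborel_R3:
  "(lborel :: (real ^ 3) measure)
     = distr lborel borel (\<lambda>((x, y), z). vector [x, y, z])"
  (is "_ = distr _ _ ?f")
proof (rule lborel_eqI)
  have f: "continuous_on UNIV ?f"
    unfolding vector3_eq split_beta by (intro continuous_intros)
  then have [measurable]: "?f \<in> borel_measurable borel"
    by (rule borel_measurable_continuous_onI)
  show "sets (distr lborel borel ?f) = sets borel" by simp
  fix l u :: "real ^ 3"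
  assume lu: "\<And>b. b \<in> Basis \<Longrightarrow> l \<bullet> b \<le> u \<bullet> b"
  have lu': "l $ i \<le> u $ i" for i
    using lu[of "axis i 1"] by (simp add: cart_eq_inner_axis)
  have "?f -` box l u = (box (l$1) (u$1) \<times> box (l$2) (u$2)) \<times> box (l$3) (u$3)"
    by (auto simp: mem_box_cart forall_3 vector_3 box_real)
  then have "emeasure (distr lborel borel ?f) (box l u)
      = emeasure (lborel :: ((real \<times> real) \<times> real) measure) ((box (l$1) (u$1) \<times> box (l$2) (u$2)) \<times> box (l$3) (u$3))"
    by (subst emeasure_distr) auto
  also have "\<dots> = ennreal (u$1 - l$1) * ennreal (u$2 - l$2) * ennreal (u$3 - l$3)"
    using lu'
    by (simp add: lborel_prod[symmetric] lborel.emeasure_pair_measure_Times box_real)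
  also have "\<dots> = (\<Prod>b\<in>Basis. (u - l) \<bullet> b)"
    using lu' by (simp add: prod_Basis_R3 ennreal_mult)
  finally show "emeasure (distr lborel borel ?f) (box l u) = (\<Prod>b\<in>Basis. (u - l) \<bullet> b)" .
qed

lemma borel_measurable_fst_snd [measurable]:
  "fst \<in> borel_measurable (borel :: (real \<times> real) measure)"
  "snd \<in> borel_measurable (borel :: (real \<times> real) measure)"
  by (auto intro!: borel_measurable_continuous_onI continuous_intros)

lemma measurable_cyl [measurable]: "cyl \<in> borel_measurable borel"
  unfolding cyl_def by (intro borel_measurable_continuous_onI continuous_intros)

lemma sets_axi_volume [measurable_cong, simp]: "sets axi_volume = sets borel"
  by (simp add: axi_volume_def)

lemma open_halfplane_sets [measurable]: "open_halfplane \<in> sets borel"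
proof -
  have "open_halfplane = {0<..} \<times> UNIV" by (auto simp: open_halfplane_def)
  moreover have "open ({0<..} \<times> UNIV :: (real \<times> real) set)" by (intro open_Times) auto
  ultimately show ?thesis by simp
qed

text \<open>Split off the third coordinate: \<open>cyl\<close> acts on the other two as the planar
  norm, whose law is known from disc areas. All bounds stated on the three-dimensional space reach
  the half plane through this identity.\<close>

lemma distr_cyl: "distr lborel borel cyl = axi_volume"
proof -
  have f: "continuous_on UNIV (\<lambda>((x, y), z). vector [x, y, z] :: real ^ 3)"
    unfolding vector3_eq split_beta by (intro continuous_intros)
  then have [measurable]: "(\<lambda>((x, y), z). vector [x, y, z] :: real ^ 3) \<in> borel_measurable borel"
    by (rule borel_measurable_continuous_onI)
  have c: "cyl \<circ> (\<lambda>((x, y), z). vector [x, y, z] :: real ^ 3) = (\<lambda>(v, z). (norm v, z))"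
    by (auto simp: fun_eq_iff cyl_def vector_3 norm_Pair)
  have "distr lborel borel cyl = distr (lborel \<Otimes>\<^sub>M lborel) (borel \<Otimes>\<^sub>M borel) (\<lambda>(v :: real \<times> real, z :: real). (norm v, z))"
    by (subst lborel_R3, subst distr_distr) (simp_all add: c lborel_prod borel_prod)
  also have "\<dots> = distr lborel borel (norm :: real \<times> real \<Rightarrow> real) \<Otimes>\<^sub>M distr lborel borel (\<lambda>z :: real. z)"
    by (subst pair_measure_distr) (auto simp: distr_id2 lborel.sigma_finite_measure_axioms)
  also have "\<dots> = density lborel (\<lambda>r. ennreal (2 * pi * r) * indicator {0<..} r) \<Otimes>\<^sub>M density lborel (\<lambda>_::real. 1)"
    by (simp add: distr_norm_plane distr_id2 density_1)
  also have "\<dots> = density (lborel \<Otimes>\<^sub>M lborel) (\<lambda>(r, z). ennreal (2 * pi * r) * indicator {0<..} r * 1)"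
    by (subst pair_measure_density) (auto simp: density_1 lborel.sigma_finite_measure_axioms)
  also have "\<dots> = axi_volume"
    unfolding axi_volume_def lborel_prod
    by (intro arg_cong[where f = "density lborel"]) (auto simp: fun_eq_iff indicator_def open_halfplane_def)
  finally show ?thesis .
qed

lemma axi_volume_alt:
  "axi_volume = density lborel (\<lambda>p. ennreal (2 * pi * fst p) * indicator open_halfplane p)"
  unfolding axi_volume_def by (intro arg_cong[where f = "density lborel"]) (auto simp: fun_eq_iff)

lemma nn_integral_axi_volume:
  assumes [measurable]: "f \<in> borel_measurable borel"
  shows "(\<integral>\<^sup>+ p. f p \<partial>axi_volume) = (\<integral>\<^sup>+ p. ennreal (2 * pi * fst p) * indicator open_halfplane p * f p \<partial>lborel)"
  unfolding axi_volume_alt by (subst nn_integral_density) auto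

lemma AE_axi_volume:
  "(AE p in axi_volume. P p) \<longleftrightarrow> (AE p in lborel. p \<in> open_halfplane \<longrightarrow> P p)"
  unfolding axi_volume_alt
  by (subst AE_density) (auto simp: open_halfplane_def split_beta indicator_def intro!: AE_cong)

subsection \<open>The axisymmetric Biot--Savart kernel\<close>

lemma sin_ge_cubic:
  fixes y :: real assumes "0 \<le> y" shows "y - y ^ 3 / 6 \<le> sin y"
proof -
  have *: "1 - x\<^sup>2 / 2 \<le> cos x" if "0 \<le> x" for x :: real
  proof -
    have "cos 0 - (1 - 0\<^sup>2 / 2) \<le> cos x - (1 - x\<^sup>2 / 2)"
    proof (rule DERIV_nonneg_imp_nondecreasing[OF that])
      fix u :: real assume "0 \<le> u" "u \<le> x"
      then show "\<exists>y. ((\<lambda>x. cos x - (1 - x\<^sup>2 / 2)) has_real_derivative y) (at u) \<and> 0 \<le> y"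
        by (intro exI[of _ "u - sin u"]) (auto intro!: derivative_eq_intros simp: sin_x_le_x)
    qed
    then show ?thesis by simp
  qed
  have "sin 0 - (0 - 0 ^ 3 / 6) \<le> sin y - (y - y ^ 3 / 6)"
  proof (rule DERIV_nonneg_imp_nondecreasing[OF assms])
    fix u :: real assume "0 \<le> u" "u \<le> y"
    then show "\<exists>y. ((\<lambda>x. sin x - (x - x ^ 3 / 6)) has_real_derivative y) (at u) \<and> 0 \<le> y"
      using *[of u] by (intro exI[of _ "cos u - (1 - u\<^sup>2 / 2)"]) (auto intro!: derivative_eq_intros)
  qed
  then show ?thesis by simp
qed

text \<open>Makes the squared distance grow quadratically in the angle, which turns angular
  integrals into arctangents. From 1 - cos \<theta> = 2 sin^2 (\<theta>/2) and sin y \<ge> y/3 on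
  [0, 2] one gets 1/18; 1/25 is taken because it is a perfect square.\<close>

lemma one_minus_cos_ge:
  fixes \<theta> :: real assumes "0 \<le> \<theta>" "\<theta> \<le> pi" shows "\<theta>\<^sup>2 / 25 \<le> 1 - cos \<theta>"
proof -
  define y where "y = \<theta> / 2"
  have y: "0 \<le> y" "y \<le> 2" using assms pi_half_less_two by (auto simp: y_def)
  have "y\<^sup>2 \<le> 4" using power_mono[of y 2 2] y by simp
  have "y / 3 \<le> y - y ^ 3 / 6"
  proof -
    have "y * y\<^sup>2 \<le> y * 4" using y \<open>y\<^sup>2 \<le> 4\<close> by (intro mult_left_mono) auto
    then show ?thesis by (simp add: power3_eq_cube power2_eq_square)
  qed
  then have "y / 3 \<le> sin y" using sin_ge_cubic[OF y(1)] by simp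
  then have "(y / 3)\<^sup>2 \<le> (sin y)\<^sup>2" using y by (intro power_mono) auto
  then have "2 * (y / 3)\<^sup>2 \<le> 1 - cos (2 * y)" by (simp add: cos_double_sin)
  moreover have "\<theta>\<^sup>2 / 25 \<le> 2 * (y / 3)\<^sup>2" by (simp add: y_def power2_eq_square)
  ultimately show ?thesis by (simp add: y_def)
qed

text \<open>A discrete mean value estimate for n / x^3. The bounds on the numerators cancel one
  power of the denominator, so a change by \<open>d\<close> costs d / x^3 and not d / x^4. The claim
  is symmetric, hence x \<le> y may be assumed and the worse cube is 1 / x^3.\<close>

lemma cube_quotient_diff:
  fixes x y n m d :: real
  assumes "0 < x" "0 < y" "\<bar>n\<bar> \<le> x" "\<bar>m\<bar> \<le> y" "\<bar>n - m\<bar> \<le> d" "\<bar>x - y\<bar> \<le> d"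
  shows "\<bar>n / x ^ 3 - m / y ^ 3\<bar> \<le> 4 * d * (1 / x ^ 3 + 1 / y ^ 3)"
  using assms
proof (induction x y arbitrary: n m rule: linorder_wlog)
  case (sym a b)
  then show ?case by (metis (no_types, lifting) abs_minus_commute add.commute)
next
  case (le x y)
  have d: "0 \<le> d" using le by linarith
  have "n / x ^ 3 - m / y ^ 3 = n * (1 / x ^ 3 - 1 / y ^ 3) + (n - m) / y ^ 3"
    by (simp add: diff_divide_distrib right_diff_distrib)
  moreover have "\<bar>(n - m) / y ^ 3\<bar> \<le> d / y ^ 3"
    using le by (simp add: divide_right_mono)
  moreover have "\<bar>n * (1 / x ^ 3 - 1 / y ^ 3)\<bar> \<le> 3 * (d / x ^ 3)"
  proof -
    have "1 / x ^ 3 - 1 / y ^ 3 = (y - x) * (y\<^sup>2 + x * y + x\<^sup>2) / (x ^ 3 * y ^ 3)"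
      using le by (simp add: field_simps power3_eq_cube power2_eq_square)
    also have "\<dots> \<le> d * (3 * y\<^sup>2) / (x ^ 3 * y ^ 3)"
    proof -
      have "x * y \<le> y * y" "x * x \<le> y * y" using le by (auto intro!: mult_mono)
      then have "y\<^sup>2 + x * y + x\<^sup>2 \<le> 3 * y\<^sup>2" by (simp add: power2_eq_square)
      then have "(y - x) * (y\<^sup>2 + x * y + x\<^sup>2) \<le> d * (3 * y\<^sup>2)"
        using le d by (intro mult_mono) auto
      then show ?thesis using le by (intro divide_right_mono) auto
    qed
    also have "\<dots> = 3 * d / (x ^ 3 * y)"
      using le by (simp add: field_simps power3_eq_cube power2_eq_square)
    finally have 1: "1 / x ^ 3 - 1 / y ^ 3 \<le> 3 * d / (x ^ 3 * y)" .
    have 0: "0 \<le> 1 / x ^ 3 - 1 / y ^ 3"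
      using le by (simp add: frac_le power_mono)
    have "\<bar>n * (1 / x ^ 3 - 1 / y ^ 3)\<bar> = \<bar>n\<bar> * (1 / x ^ 3 - 1 / y ^ 3)"
      using 0 by (simp add: abs_mult)
    also have "\<dots> \<le> y * (3 * d / (x ^ 3 * y))"
      using 0 1 le by (intro mult_mono) auto
    also have "\<dots> = 3 * (d / x ^ 3)" using le by simp
    finally show ?thesis .
  qed
  moreover have "0 \<le> d / x ^ 3" "0 \<le> d / y ^ 3" using d le by auto
  moreover have "4 * d * (1 / x ^ 3 + 1 / y ^ 3) = 4 * (d / x ^ 3) + 4 * (d / y ^ 3)"
    by (simp add: distrib_left)
  ultimately show ?case by linarith
qed

text \<open>Expansion of \<open>1 / |x|\<close> in \<open>\<real>\<^sup>3\<close>, with \<open>a = |x|\<close>, \<open>b = |x + y|\<close>, \<open>s = x \<bullet> y\<close>, \<open>v = |y|\<close>.\<close>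

lemma inverse_remainder:
  fixes a b s v :: real
  assumes "0 < a" "0 < b" "b\<^sup>2 = a\<^sup>2 + 2 * s + v\<^sup>2" "\<bar>s\<bar> \<le> a * v" "\<bar>b - a\<bar> \<le> v"
  shows "\<bar>1 / b - 1 / a + s / a ^ 3\<bar> \<le> 4 * v\<^sup>2 * (1 / a ^ 3 + 1 / b ^ 3)"
    and "\<bar>1 / b - 1 / a + s / a ^ 3\<bar> \<le> 2 * v * (1 / a\<^sup>2 + 1 / b\<^sup>2)"
proof -
  have v: "0 \<le> v" using assms by linarith
  have s2: "2 * s = b\<^sup>2 - a\<^sup>2 - v\<^sup>2" using assms by simp
  \<comment> \<open>Eliminating \<open>s\<close> by the cosine rule leaves only terms quadratic in
    \<open>b - a\<close> and \<open>v\<close>.\<close>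
  have e: "1 / b - 1 / a + s / a ^ 3 = (b - a)\<^sup>2 * (b + 2 * a) / (2 * a ^ 3 * b) - v\<^sup>2 / (2 * a ^ 3)"
    using assms(1,2) s2 by (simp add: field_simps power3_eq_cube power2_eq_square) algebra
  have d2: "(b - a)\<^sup>2 \<le> v\<^sup>2" using assms(5) v by (metis abs_le_square_iff abs_of_nonneg)
  have m: "1 / (a\<^sup>2 * b) \<le> 1 / a ^ 3 + 1 / b ^ 3"
  proof (cases "a \<le> b")
    case True
    then have "a ^ 3 \<le> a\<^sup>2 * b" using assms(1) by (simp add: power3_eq_cube power2_eq_square)
    then have "1 / (a\<^sup>2 * b) \<le> 1 / a ^ 3" using assms(1) by (intro frac_le) auto
    then show ?thesis using assms by (simp add: add_increasing2)
  next
    case False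
    then have "b * b\<^sup>2 \<le> b * a\<^sup>2" using assms(1,2) by (intro mult_left_mono power_mono) auto
    then have "b ^ 3 \<le> a\<^sup>2 * b" by (simp add: power3_eq_cube power2_eq_square ac_simps)
    then have "1 / (a\<^sup>2 * b) \<le> 1 / b ^ 3" using assms(2) by (intro frac_le) auto
    then show ?thesis using assms by (simp add: add_increasing)
  qed
  have "(b - a)\<^sup>2 * (b + 2 * a) / (2 * a ^ 3 * b) = (b - a)\<^sup>2 * (1 / (2 * a ^ 3) + 1 / (a\<^sup>2 * b))"
    using assms(1,2) by (simp add: field_simps power3_eq_cube power2_eq_square)
  also have "\<dots> \<le> v\<^sup>2 * (1 / a ^ 3 + (1 / a ^ 3 + 1 / b ^ 3))"
    using d2 m assms(1,2) by (intro mult_mono add_mono) (auto simp: field_simps)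
  finally have 1: "(b - a)\<^sup>2 * (b + 2 * a) / (2 * a ^ 3 * b) \<le> v\<^sup>2 * (2 / a ^ 3 + 1 / b ^ 3)"
    by simp
  have 2: "0 \<le> (b - a)\<^sup>2 * (b + 2 * a) / (2 * a ^ 3 * b)"
    using assms(1,2) by auto
  have 3: "0 \<le> v\<^sup>2 / a ^ 3" "0 \<le> v\<^sup>2 / b ^ 3" "v\<^sup>2 / (2 * a ^ 3) = v\<^sup>2 / a ^ 3 / 2"
    using assms(1,2) by auto
  show "\<bar>1 / b - 1 / a + s / a ^ 3\<bar> \<le> 4 * v\<^sup>2 * (1 / a ^ 3 + 1 / b ^ 3)"
    unfolding e using 1 2 3 by (simp add: algebra_simps abs_le_iff)
  \<comment> \<open>For the second bound no cancellation is used: the increment and the linear term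
    are each of order \<open>v\<close>. It is the better one when \<open>v\<close> exceeds
    \<open>a\<close> or \<open>b\<close>.\<close>
  have "\<bar>1 / b - 1 / a\<bar> = \<bar>b - a\<bar> * (1 / a * (1 / b))"
  proof -
    have "1 / b - 1 / a = (a - b) * (1 / a * (1 / b))" using assms(1,2) by (simp add: field_simps)
    then show ?thesis using assms(1,2) by (simp add: abs_mult abs_minus_commute)
  qed
  also have "\<dots> \<le> v * ((1 / a)\<^sup>2 + (1 / b)\<^sup>2)"
  proof (intro mult_mono)
    have "0 \<le> (1 / a - 1 / b)\<^sup>2" "0 \<le> 1 / a * (1 / b)" using assms(1,2) by auto
    then show "1 / a * (1 / b) \<le> (1 / a)\<^sup>2 + (1 / b)\<^sup>2"
      unfolding power2_diff by linarith
  qed (use assms v in auto)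
  finally have 4: "\<bar>1 / b - 1 / a\<bar> \<le> v * (1 / a\<^sup>2 + 1 / b\<^sup>2)"
    by (simp add: power_divide)
  have "\<bar>s / a ^ 3\<bar> \<le> a * v / a ^ 3"
    using assms(1,4) by (simp add: divide_right_mono)
  also have "\<dots> = v * (1 / a\<^sup>2)" using assms(1) by (simp add: field_simps power3_eq_cube power2_eq_square)
  also have "\<dots> \<le> v * (1 / a\<^sup>2 + 1 / b\<^sup>2)"
    using v by (intro mult_left_mono) auto
  finally show "\<bar>1 / b - 1 / a + s / a ^ 3\<bar> \<le> 2 * v * (1 / a\<^sup>2 + 1 / b\<^sup>2)"
    using 4 by (simp only: abs_le_iff) linarith
qed

text \<open>\<open>den p q \<theta>\<close> is the distance in \<open>\<real>\<^sup>3\<close> of the points with half-plane coordinates \<open>p\<close>, \<open>q\<close> at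
  angle \<open>\<theta>\<close>. The Biot--Savart velocity at \<open>p\<close> turns out to be
  \<open>1 / (2 \<pi>) \<integral> (kern num_r p q, kern num_z p q) \<omega> q dq\<close>; for the second component the
  term \<open>\<psi> / r\<^sup>2\<close> of \<open>\<partial>\<^sub>r \<psi> / r\<close> is integrated by parts in \<open>\<theta>\<close>.\<close>

definition den :: "real \<times> real \<Rightarrow> real \<times> real \<Rightarrow> real \<Rightarrow> real" where
  "den p q \<theta> = norm ((fst p - fst q * cos \<theta>, fst q * sin \<theta>), snd p - snd q)"

lemma den_eq: "den p q \<theta> = sqrt ((dist p q)\<^sup>2 + 2 * fst p * fst q * (1 - cos \<theta>))"
proof -
  have "(fst p - fst q * cos \<theta>)\<^sup>2 + (fst q * sin \<theta>)\<^sup>2 = (fst p - fst q)\<^sup>2 + 2 * fst p * fst q * (1 - cos \<theta>)"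
    by (simp add: power2_diff power_mult_distrib sin_squared_eq algebra_simps)
  moreover have "den p q \<theta> = sqrt ((fst p - fst q * cos \<theta>)\<^sup>2 + (fst q * sin \<theta>)\<^sup>2 + (snd p - snd q)\<^sup>2)"
    by (simp add: den_def norm_Pair)
  ultimately show ?thesis
    by (simp add: dist_prod_def dist_real_def)
qed

lemma den_nonneg [simp]: "0 \<le> den p q \<theta>"
  by (simp add: den_def)

lemma den_commute: "den p q \<theta> = den q p \<theta>"
  by (simp add: den_eq dist_commute ac_simps)

lemma den_sq:
  assumes "0 \<le> fst p" "0 \<le> fst q"
  shows "(den p q \<theta>)\<^sup>2 = (dist p q)\<^sup>2 + 2 * fst p * fst q * (1 - cos \<theta>)"
  using assms by (simp add: den_eq)

lemma dist_le_den:
  assumes "0 \<le> fst p" "0 \<le> fst q" shows "dist p q \<le> den p q \<theta>"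
  unfolding den_eq using assms by (intro real_le_rsqrt) simp

text \<open>The reason to define \<open>den\<close> as a norm: moving the first point translates the
  vector, so the reverse triangle inequality applies, without any condition on signs.\<close>

lemma den_lipschitz: "\<bar>den a q \<theta> - den b q \<theta>\<bar> \<le> dist a b"
proof -
  have "\<bar>den a q \<theta> - den b q \<theta>\<bar> \<le> norm (((fst a - fst q * cos \<theta>, fst q * sin \<theta>), snd a - snd q) - ((fst b - fst q * cos \<theta>, fst q * sin \<theta>), snd b - snd q))"
    unfolding den_def by (rule norm_triangle_ineq3)
  also have "\<dots> = dist a b"
    by (cases a; cases b) (simp add: norm_Pair dist_Pair_Pair dist_real_def)
  finally show ?thesis .
qed

lemma continuous_on_cos_real: "continuous_on UNIV (cos :: real \<Rightarrow> real)"
  and continuous_on_sin_real: "continuous_on UNIV (sin :: real \<Rightarrow> real)"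
  by (intro continuous_intros)+

lemma continuous_den [continuous_intros]:
  assumes "continuous_on S f" "continuous_on S g" "continuous_on S h"
  shows "continuous_on S (\<lambda>x. den (f x) (g x) (h x))"
  unfolding den_def
  by (intro continuous_intros assms continuous_on_compose2[OF continuous_on_cos_real assms(3)]
      continuous_on_compose2[OF continuous_on_sin_real assms(3)]) auto

section \<open>Integrals over the azimuthal angle\<close>

abbreviation angle_integral :: "(real \<Rightarrow> real) \<Rightarrow> real" where
  "angle_integral f \<equiv> (LINT \<theta>:{0..pi}|lborel. f \<theta>)"

lemma angle_integral_abs_le:
  assumes "continuous_on {0..pi} f" "continuous_on {0..pi} g" "\<And>\<theta>. \<theta> \<in> {0..pi} \<Longrightarrow> \<bar>f \<theta>\<bar> \<le> g \<theta>"
  shows "\<bar>angle_integral f\<bar> \<le> angle_integral g"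
proof -
  have i: "set_integrable lborel {0..pi} f" "set_integrable lborel {0..pi} g"
    using assms borel_integrable_atLeastAtMost' by auto
  have "\<bar>angle_integral f\<bar> \<le> angle_integral (\<lambda>\<theta>. \<bar>f \<theta>\<bar>)"
    using set_integral_norm_bound[OF i(1)] by simp
  also have "\<dots> \<le> angle_integral g"
    using i assms(3) by (intro set_integral_mono set_integrable_abs) auto
  finally show ?thesis .
qed

lemma angle_integral_mono:
  assumes "continuous_on {0..pi} f" "continuous_on {0..pi} g" "\<And>\<theta>. \<theta> \<in> {0..pi} \<Longrightarrow> f \<theta> \<le> g \<theta>"
  shows "angle_integral f \<le> angle_integral g"
  using assms borel_integrable_atLeastAtMost' by (intro set_integral_mono) auto

lemma angle_integral_add:
  assumes "continuous_on {0..pi} f" "continuous_on {0..pi} g"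
  shows "angle_integral (\<lambda>\<theta>. f \<theta> + g \<theta>) = angle_integral f + angle_integral g"
  using assms by (intro set_integral_add(2) borel_integrable_atLeastAtMost')

lemma angle_integral_diff:
  assumes "continuous_on {0..pi} f" "continuous_on {0..pi} g"
  shows "angle_integral (\<lambda>\<theta>. f \<theta> - g \<theta>) = angle_integral f - angle_integral g"
  using assms by (intro set_integral_diff(2) borel_integrable_atLeastAtMost')

lemma angle_integral_const [simp]: "angle_integral (\<lambda>_. c) = pi * c"
  by (simp add: set_integral_const)

text \<open>Averaging over the circle through \<open>q\<close> removes one power of the singularity.
  If the circle is small compared with the distance, the trivial bound \<open>dist_le_den\<close>
  suffices. Otherwise the two radii are comparable and the integrand is dominated by the derivative
  of an arctangent, whose total variation does not depend on the radius.\<close>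

lemma angle_integral_inverse_square:
  assumes p: "0 \<le> fst p" and q: "0 \<le> fst q" and pq: "p \<noteq> q"
  shows "angle_integral (\<lambda>\<theta>. fst q / (den p q \<theta>)\<^sup>2) \<le> 10 / dist p q"
proof -
  let ?a = "dist p q"
  have a: "0 < ?a" using pq by simp
  have dp: "0 < den p q \<theta>" for \<theta> using dist_le_den[OF p q, of \<theta>] a by linarith
  have c: "continuous_on {0..pi} (\<lambda>\<theta>. fst q / (den p q \<theta>)\<^sup>2)"
    using dp by (intro continuous_intros) (auto simp: less_imp_neq[symmetric])
  show ?thesis
  proof (cases "fst q \<le> 2 * ?a")
    case True
    have "angle_integral (\<lambda>\<theta>. fst q / (den p q \<theta>)\<^sup>2) \<le> angle_integral (\<lambda>\<theta>. 2 * ?a / ?a\<^sup>2)"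
      using a True q dist_le_den[OF p q] dp
      by (intro angle_integral_mono c frac_le) (auto intro!: power_mono)
    also have "\<dots> = 2 * pi / ?a" using a by (simp add: power2_eq_square)
    also have "\<dots> \<le> 10 / ?a" using a pi_less_4 by (intro divide_right_mono) auto
    finally show ?thesis .
  next
    case False
    have "\<bar>fst p - fst q\<bar> \<le> ?a" using dist_fst_le[of p q] by (simp add: dist_real_def)
    then have r: "fst q \<le> 2 * fst p" using False by linarith
    \<comment> \<open>Chosen so that a^2 (1 + (k \<theta>)^2) = a^2 + (r' \<theta>)^2 / 25 for a the
      distance and r' = \<open>fst q\<close>; by \<open>one_minus_cos_ge\<close> and r' \<le> 2 r
      this is below the squared denominator.\<close>
    define k where "k = fst q / (5 * ?a)"
    have "0 < fst q" using False a by linarith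
    then have k: "0 < k" using a by (simp add: k_def)
    have "angle_integral (\<lambda>\<theta>. fst q / (den p q \<theta>)\<^sup>2) \<le> angle_integral (\<lambda>\<theta>. 5 / ?a * (k / (1 + (k * \<theta>)\<^sup>2)))"
    proof (intro angle_integral_mono c)
      show "continuous_on {0..pi} (\<lambda>\<theta>. 5 / ?a * (k / (1 + (k * \<theta>)\<^sup>2)))"
        by (intro continuous_intros) (auto simp: add_nonneg_eq_0_iff)
      fix \<theta> assume t: "\<theta> \<in> {0..pi}"
      have "(fst q)\<^sup>2 * (\<theta>\<^sup>2 / 25) \<le> 2 * fst p * fst q * (1 - cos \<theta>)"
        using one_minus_cos_ge[of \<theta>] t mult_right_mono[OF r q] q r
        by (intro mult_mono) (auto simp: power2_eq_square)
      moreover have "?a\<^sup>2 * (1 + (k * \<theta>)\<^sup>2) = ?a\<^sup>2 + (fst q)\<^sup>2 * (\<theta>\<^sup>2 / 25)"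
        using a by (simp add: k_def distrib_left power_mult_distrib power_divide)
      ultimately have "?a\<^sup>2 * (1 + (k * \<theta>)\<^sup>2) \<le> (den p q \<theta>)\<^sup>2"
        unfolding den_sq[OF p q] by linarith
      then have "fst q / (den p q \<theta>)\<^sup>2 \<le> fst q / (?a\<^sup>2 * (1 + (k * \<theta>)\<^sup>2))"
        using a q dp[of \<theta>] by (intro divide_left_mono mult_pos_pos zero_less_power add_pos_nonneg) auto
      also have "\<dots> = 5 / ?a * (k / (1 + (k * \<theta>)\<^sup>2))"
        using a by (simp add: k_def power2_eq_square)
      finally show "fst q / (den p q \<theta>)\<^sup>2 \<le> 5 / ?a * (k / (1 + (k * \<theta>)\<^sup>2))" .
    qed
    also have "\<dots> = 5 / ?a * arctan (k * pi) - 5 / ?a * arctan (k * 0)"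
      unfolding set_lebesgue_integral_def real_scaleR_def mult.commute[of "indicator _ _"]
    proof (rule integral_FTC_Icc_real)
      show "((\<lambda>\<theta>. 5 / ?a * arctan (k * \<theta>)) has_real_derivative 5 / ?a * (k / (1 + (k * x)\<^sup>2))) (at x)" for x
        using pq by (auto intro!: derivative_eq_intros simp: divide_simps)
      show "isCont (\<lambda>\<theta>. 5 / ?a * (k / (1 + (k * \<theta>)\<^sup>2))) x" for x
        by (intro continuous_intros) (auto simp: add_nonneg_eq_0_iff)
    qed simp
    also have "\<dots> \<le> 5 / ?a * 2"
      using arctan_ubound[of "k * pi"] pi_half_less_two a by (simp add: divide_right_mono)
    also have "\<dots> = 10 / ?a" by simp
    finally show ?thesis .
  qed
qed


text \<open>The effect of a displacement d on a kernel with a singularity 1/x: the mean value bound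
  d / x^2 away from the pole, the kernel itself close to it.\<close>

definition kernel_bound :: "real \<Rightarrow> real \<Rightarrow> real" where
  "kernel_bound d x = min (1 / x) (d / x\<^sup>2)"

text \<open>The factor \<open>fst q\<close> is the length element of the circle through
  \<open>q\<close>. With a numerator bounded by \<open>den\<close> this is a kernel of size 1 /
  |x|^2 in space, summed over a vortex ring.\<close>

definition kern :: "(real \<times> real \<Rightarrow> real \<times> real \<Rightarrow> real \<Rightarrow> real) \<Rightarrow> real \<times> real \<Rightarrow> real \<times> real \<Rightarrow> real" where
  "kern N p q = angle_integral (\<lambda>\<theta>. fst q * N p q \<theta> / den p q \<theta> ^ 3)"

definition num_r :: "real \<times> real \<Rightarrow> real \<times> real \<Rightarrow> real \<Rightarrow> real" where
  "num_r p q \<theta> = cos \<theta> * (snd q - snd p)"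

definition num_z :: "real \<times> real \<Rightarrow> real \<times> real \<Rightarrow> real \<Rightarrow> real" where
  "num_z p q \<theta> = fst p * cos \<theta> - fst q"

text \<open>What the numerators \<open>num_r\<close>, \<open>num_z\<close> and \<open>num_a\<close>
  have in common, and all that the kernel estimates use: size at most \<open>den\<close> on the half
  plane, Lipschitz constant 1 in each point, and continuity.\<close>

definition admissible :: "(real \<times> real \<Rightarrow> real \<times> real \<Rightarrow> real \<Rightarrow> real) \<Rightarrow> bool" where
  "admissible N \<longleftrightarrow>
     (\<forall>p q \<theta>. 0 \<le> fst p \<longrightarrow> 0 \<le> fst q \<longrightarrow> \<bar>N p q \<theta>\<bar> \<le> den p q \<theta>) \<and>
     (\<forall>a b q \<theta>. \<bar>N a q \<theta> - N b q \<theta>\<bar> \<le> dist a b) \<and>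
     (\<forall>p a b \<theta>. \<bar>N p a \<theta> - N p b \<theta>\<bar> \<le> dist a b) \<and>
     continuous_on UNIV (\<lambda>x. N (fst (fst x)) (snd (fst x)) (snd x))"

lemma cos_mult_abs_le: "\<bar>cos \<theta> * x\<bar> \<le> \<bar>x :: real\<bar>"
  using mult_mono[of "\<bar>cos \<theta>\<bar>" 1 "\<bar>x\<bar>" "\<bar>x\<bar>"] by (simp add: abs_mult)

lemma dist_comp_le:
  fixes a b :: "real \<times> real"
  shows "\<bar>fst a - fst b\<bar> \<le> dist a b" "\<bar>snd a - snd b\<bar> \<le> dist a b"
  using dist_fst_le[of a b] dist_snd_le[of a b] by (simp_all add: dist_real_def)

lemma admissible_num_r: "admissible num_r"
  unfolding admissible_def
proof (intro conjI allI impI)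
  fix p q a b :: "real \<times> real" and \<theta> :: real
  { assume "0 \<le> fst p" "0 \<le> fst q"
    then show "\<bar>num_r p q \<theta>\<bar> \<le> den p q \<theta>"
      using cos_mult_abs_le[of \<theta> "snd q - snd p"] dist_comp_le(2)[of q p] dist_le_den[of p q \<theta>]
      by (simp add: num_r_def dist_commute) }
  show "\<bar>num_r a q \<theta> - num_r b q \<theta>\<bar> \<le> dist a b"
    using cos_mult_abs_le[of \<theta> "snd b - snd a"] dist_comp_le(2)[of b a]
    by (simp add: num_r_def dist_commute right_diff_distrib[symmetric])
  show "\<bar>num_r p a \<theta> - num_r p b \<theta>\<bar> \<le> dist a b"
    using cos_mult_abs_le[of \<theta> "snd a - snd b"] dist_comp_le(2)[of a b]
    by (simp add: num_r_def right_diff_distrib[symmetric])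
  show "continuous_on UNIV (\<lambda>x. num_r (fst (fst x)) (snd (fst x)) (snd x))"
    unfolding num_r_def by (intro continuous_intros)
qed

text \<open>Up to sign, \<open>num_z p q\<close> is a component of the vector whose norm is
  \<open>den q p\<close>; this gives the size bound.\<close>

lemma admissible_num_z: "admissible num_z"
  unfolding admissible_def
proof (intro conjI allI impI)
  fix p q a b :: "real \<times> real" and \<theta> :: real
  { assume "0 \<le> fst p" "0 \<le> fst q"
    have "(den p q \<theta>)\<^sup>2 = (fst q - fst p * cos \<theta>)\<^sup>2 + ((fst p * sin \<theta>)\<^sup>2 + (snd q - snd p)\<^sup>2)"
      by (subst den_commute) (simp add: den_def norm_Pair)
    then have "(num_z p q \<theta>)\<^sup>2 \<le> (den p q \<theta>)\<^sup>2"
      by (simp add: num_z_def power2_commute[of "fst p * cos \<theta>"])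
    then show "\<bar>num_z p q \<theta>\<bar> \<le> den p q \<theta>"
      by (rule abs_le_square_iff[THEN iffD2, THEN order_trans]) simp }
  have "num_z a q \<theta> - num_z b q \<theta> = cos \<theta> * (fst a - fst b)"
    by (simp add: num_z_def algebra_simps)
  then show "\<bar>num_z a q \<theta> - num_z b q \<theta>\<bar> \<le> dist a b"
    using cos_mult_abs_le[of \<theta> "fst a - fst b"] dist_comp_le(1)[of a b] by simp
  show "\<bar>num_z p a \<theta> - num_z p b \<theta>\<bar> \<le> dist a b"
    using dist_comp_le(1)[of b a] by (simp add: num_z_def dist_commute)
  show "continuous_on UNIV (\<lambda>x. num_z (fst (fst x)) (snd (fst x)) (snd x))"
    unfolding num_z_def by (intro continuous_intros)
qed

lemma borel_measurable_kern [measurable]: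
  assumes "admissible N"
  shows "(\<lambda>x. kern N (fst x) (snd x)) \<in> borel_measurable borel"
proof -
  have [measurable]: "(\<lambda>x. N (fst (fst x)) (snd (fst x)) (snd x)) \<in> borel_measurable borel"
    using assms by (intro borel_measurable_continuous_onI) (auto simp: admissible_def)
  have [measurable]: "(\<lambda>x. den (fst (fst x)) (snd (fst x)) (snd x)) \<in> borel_measurable borel"
    by (intro borel_measurable_continuous_onI continuous_intros)
  have [measurable]: "(\<lambda>x. fst (snd (fst x))) \<in> borel_measurable (borel :: (((real \<times> real) \<times> (real \<times> real)) \<times> real) measure)"
    "snd \<in> borel_measurable (borel :: (((real \<times> real) \<times> (real \<times> real)) \<times> real) measure)"
    by (intro borel_measurable_continuous_onI continuous_intros)+
  have "(\<lambda>(x :: (real \<times> real) \<times> (real \<times> real), \<theta>). indicat_real {0..pi} \<theta> *\<^sub>R (fst (snd x) * N (fst x) (snd x) \<theta> / den (fst x) (snd x) \<theta> ^ 3))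
          \<in> borel_measurable borel"
    unfolding split_beta by measurable
  also have "borel_measurable borel = borel_measurable ((borel :: ((real \<times> real) \<times> (real \<times> real)) measure) \<Otimes>\<^sub>M (lborel :: real measure))"
    by (rule measurable_cong_sets) (simp_all add: borel_prod[symmetric] cong: sets_pair_measure_cong)
  finally have "(\<lambda>(x :: (real \<times> real) \<times> (real \<times> real), \<theta>). indicat_real {0..pi} \<theta> *\<^sub>R (fst (snd x) * N (fst x) (snd x) \<theta> / den (fst x) (snd x) \<theta> ^ 3))
          \<in> borel_measurable (borel \<Otimes>\<^sub>M lborel)" .
  then show ?thesis
    unfolding kern_def set_lebesgue_integral_def by (rule lborel.borel_measurable_lebesgue_integral)
qed

lemma admissibleD:
  assumes "admissible N"
  shows "0 \<le> fst p \<Longrightarrow> 0 \<le> fst q \<Longrightarrow> \<bar>N p q \<theta>\<bar> \<le> den p q \<theta>"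
    and "\<bar>N a q \<theta> - N b q \<theta>\<bar> \<le> dist a b"
    and "\<bar>N p a \<theta> - N p b \<theta>\<bar> \<le> dist a b"
    and "continuous_on UNIV (\<lambda>x. N (fst (fst x)) (snd (fst x)) (snd x))"
  using assms unfolding admissible_def by blast+

lemma continuous_kern_integrand:
  assumes N: "admissible N" and "0 \<le> fst p" "0 \<le> fst q" "p \<noteq> q"
  shows "continuous_on {0..pi} (\<lambda>\<theta>. fst q * N p q \<theta> / den p q \<theta> ^ 3)"
proof -
  have "continuous_on {0..pi} (\<lambda>\<theta>. ((p, q), \<theta>))" by (intro continuous_intros)
  then have "continuous_on {0..pi} (\<lambda>\<theta>. N p q \<theta>)"
    using continuous_on_compose2[of UNIV "\<lambda>x. N (fst (fst x)) (snd (fst x)) (snd x)" "{0..pi}" "\<lambda>\<theta>. ((p, q), \<theta>)"] N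
    by (auto dest: admissibleD(4))
  moreover have "den p q \<theta> \<noteq> 0" for \<theta>
    using less_le_trans[OF _ dist_le_den[OF assms(2,3), of \<theta>], of 0] assms(4) by simp
  ultimately show ?thesis by (intro continuous_intros) auto
qed

lemma den_pos:
  assumes "0 \<le> fst p" "0 \<le> fst q" "p \<noteq> q"
  shows "0 < den p q \<theta>"
  using less_le_trans[OF _ dist_le_den[OF assms(1,2), of \<theta>], of 0] assms(3) by simp

lemma continuous_inverse_den:
  assumes "0 \<le> fst p" "0 \<le> fst q" "p \<noteq> q"
  shows "continuous_on S (\<lambda>\<theta>. c / den p q \<theta> ^ n)"
  using den_pos[OF assms] by (intro continuous_intros) (auto simp: less_imp_neq[symmetric])

lemma angle_integral_inverse_cube:
  assumes p: "0 \<le> fst p" and q: "0 \<le> fst q" and pq: "p \<noteq> q"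
  shows "angle_integral (\<lambda>\<theta>. fst q / den p q \<theta> ^ 3) \<le> 10 / (dist p q)\<^sup>2"
proof -
  have a: "0 < dist p q" using pq by simp
  have "angle_integral (\<lambda>\<theta>. fst q / den p q \<theta> ^ 3) \<le> angle_integral (\<lambda>\<theta>. 1 / dist p q * (fst q / (den p q \<theta>)\<^sup>2))"
  proof (intro angle_integral_mono continuous_inverse_den assms continuous_on_mult_left)
    fix \<theta>
    have "dist p q * (den p q \<theta>)\<^sup>2 \<le> den p q \<theta> ^ 3"
      using mult_right_mono[OF dist_le_den[OF p q, of \<theta>], of "(den p q \<theta>)\<^sup>2"]
      by (simp add: power3_eq_cube power2_eq_square)
    then have "fst q / den p q \<theta> ^ 3 \<le> fst q / (dist p q * (den p q \<theta>)\<^sup>2)"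
      using a q den_pos[OF assms, of \<theta>] by (intro frac_le) (auto intro!: mult_pos_pos)
    then show "fst q / den p q \<theta> ^ 3 \<le> 1 / dist p q * (fst q / (den p q \<theta>)\<^sup>2)" by simp
  qed
  also have "\<dots> \<le> 1 / dist p q * (10 / dist p q)"
    unfolding set_integral_mult_right
    using angle_integral_inverse_square[OF assms] by (intro mult_left_mono) auto
  finally show ?thesis by (simp add: power2_eq_square)
qed


lemma kern_abs_le:
  assumes N: "admissible N" and p: "0 \<le> fst p" and q: "0 \<le> fst q" and pq: "p \<noteq> q"
  shows "\<bar>kern N p q\<bar> \<le> 10 / dist p q"
proof -
  have "\<bar>kern N p q\<bar> \<le> angle_integral (\<lambda>\<theta>. fst q / (den p q \<theta>)\<^sup>2)"
    unfolding kern_def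
  proof (intro angle_integral_abs_le continuous_kern_integrand continuous_inverse_den assms)
    fix \<theta>
    have d: "0 < den p q \<theta>" by (rule den_pos) fact+
    have "\<bar>fst q * N p q \<theta> / den p q \<theta> ^ 3\<bar> = fst q * \<bar>N p q \<theta>\<bar> / den p q \<theta> ^ 3"
      using q d by (simp add: abs_mult)
    also have "\<dots> \<le> fst q * den p q \<theta> / den p q \<theta> ^ 3"
      using p q d admissibleD(1)[OF N p q] by (intro divide_right_mono mult_left_mono) auto
    also have "\<dots> = fst q / (den p q \<theta>)\<^sup>2"
      using d by (simp add: power3_eq_cube power2_eq_square)
    finally show "\<bar>fst q * N p q \<theta> / den p q \<theta> ^ 3\<bar> \<le> fst q / (den p q \<theta>)\<^sup>2" .
  qed
  then show ?thesis using angle_integral_inverse_square[OF p q pq] by linarith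
qed

lemma kernel_bound_nonneg: "0 \<le> x \<Longrightarrow> 0 \<le> d \<Longrightarrow> 0 \<le> kernel_bound d x"
  by (simp add: kernel_bound_def)

text \<open>Close to one of the poles the differences below are dominated by the kernels themselves.\<close>

lemma kernel_bound_combine:
  assumes "0 < x" "0 < y" "0 \<le> c"
    and 1: "u \<le> c * (1 / x + 1 / y)"
    and 2: "d \<le> x \<Longrightarrow> d \<le> y \<Longrightarrow> u \<le> c * (d / x\<^sup>2 + d / y\<^sup>2)"
    and d: "0 \<le> d"
  shows "u \<le> 2 * c * (kernel_bound d x + kernel_bound d y)"
proof -
  have *: "1 / a \<le> kernel_bound d a" if "0 < a" "a \<le> d" for a
    using that mult_right_mono[OF that(2), of a] by (simp add: kernel_bound_def field_simps power2_eq_square)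
  have **: "d / a\<^sup>2 \<le> kernel_bound d a" if "0 < a" "d \<le> a" for a
    using that mult_right_mono[OF that(2), of a] by (simp add: kernel_bound_def field_simps power2_eq_square)
  have n: "0 \<le> kernel_bound d x" "0 \<le> kernel_bound d y"
    using assms d by (auto intro!: kernel_bound_nonneg)
  show ?thesis
  proof (cases "d \<le> x \<and> d \<le> y")
    case True
    then have "u \<le> c * (d / x\<^sup>2 + d / y\<^sup>2)" using 2 by blast
    also have "\<dots> \<le> c * (kernel_bound d x + kernel_bound d y)"
      using True assms(1-3) by (intro mult_left_mono add_mono **) auto
    finally have "u \<le> c * (kernel_bound d x + kernel_bound d y)" .
    moreover have "0 \<le> c * (kernel_bound d x + kernel_bound d y)" using n assms(3) by (intro mult_nonneg_nonneg add_nonneg_nonneg)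
    ultimately show ?thesis by linarith
  next
    case False
    \<comment> \<open>Here \<open>d\<close> exceeds one of the distances, hence the smaller one,
      where \<open>kernel_bound\<close> is the kernel itself and also controls the kernel at the
      other distance. This accounts for the factor 2 in the claim.\<close>
    have "1 / x + 1 / y \<le> 2 * (kernel_bound d x + kernel_bound d y)"
    proof (cases "x \<le> y")
      case True
      then have "x < d" "1 / y \<le> 1 / x" using False assms by (auto simp: frac_le)
      moreover have "1 / x \<le> kernel_bound d x" using \<open>x < d\<close> assms(1) by (intro *) auto
      ultimately have "1 / x + 1 / y \<le> kernel_bound d x + kernel_bound d x" by (simp only: add_mono)
      also have "\<dots> \<le> 2 * (kernel_bound d x + kernel_bound d y)" using n by simp
      finally show ?thesis .
    next
      case f: False
      then have "y < d" "1 / x \<le> 1 / y" using False assms by (auto simp: frac_le)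
      moreover have "1 / y \<le> kernel_bound d y" using \<open>y < d\<close> assms(2) by (intro *) auto
      ultimately have "1 / x + 1 / y \<le> kernel_bound d y + kernel_bound d y" by (simp only: add_mono)
      also have "\<dots> \<le> 2 * (kernel_bound d x + kernel_bound d y)" using n by simp
      finally show ?thesis .
    qed
    then have "c * (1 / x + 1 / y) \<le> c * (2 * (kernel_bound d x + kernel_bound d y))"
      using assms(3) by (rule mult_left_mono)
    with 1 have "u \<le> c * (2 * (kernel_bound d x + kernel_bound d y))" by linarith
    also have "\<dots> = 2 * c * (kernel_bound d x + kernel_bound d y)" by (simp only: ac_simps)
    finally show ?thesis .
  qed
qed

lemma kern_diff_le_aux:
  assumes N: "admissible N" and a: "0 \<le> fst a" and b: "0 \<le> fst b" and q: "0 \<le> fst q"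
    and aq: "a \<noteq> q" and bq: "b \<noteq> q"
  shows "\<bar>kern N a q - kern N b q\<bar> \<le> 40 * (dist a b / (dist a q)\<^sup>2 + dist a b / (dist b q)\<^sup>2)"
proof -
  note ia = angle_integral_inverse_cube[OF a q aq] and ib = angle_integral_inverse_cube[OF b q bq]
  note c = continuous_kern_integrand[OF N a q aq] continuous_kern_integrand[OF N b q bq]
    continuous_inverse_den[OF a q aq, of "{0..pi}" _ 3] continuous_inverse_den[OF b q bq, of "{0..pi}" _ 3]
  have E: "kern N a q - kern N b q = angle_integral (\<lambda>\<theta>. fst q * N a q \<theta> / den a q \<theta> ^ 3 - fst q * N b q \<theta> / den b q \<theta> ^ 3)"
    unfolding kern_def by (rule angle_integral_diff[symmetric]) (rule c)+
  have "\<bar>kern N a q - kern N b q\<bar> \<le> angle_integral (\<lambda>\<theta>. 4 * dist a b * (fst q / den a q \<theta> ^ 3 + fst q / den b q \<theta> ^ 3))"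
  unfolding E
    proof (intro angle_integral_abs_le continuous_on_diff continuous_on_add continuous_on_mult_left continuous_on_const c)
    fix \<theta>
    have "\<bar>N a q \<theta> / den a q \<theta> ^ 3 - N b q \<theta> / den b q \<theta> ^ 3\<bar> \<le> 4 * dist a b * (1 / den a q \<theta> ^ 3 + 1 / den b q \<theta> ^ 3)"
      using N a b q by (intro cube_quotient_diff den_pos aq bq den_lipschitz) (auto intro: admissibleD)
    from mult_left_mono[OF this q]
    show "\<bar>fst q * N a q \<theta> / den a q \<theta> ^ 3 - fst q * N b q \<theta> / den b q \<theta> ^ 3\<bar> \<le> 4 * dist a b * (fst q / den a q \<theta> ^ 3 + fst q / den b q \<theta> ^ 3)"
      using q by (simp add: abs_mult_pos' right_diff_distrib algebra_simps)
  qed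
  also have "\<dots> = 4 * dist a b * (angle_integral (\<lambda>\<theta>. fst q / den a q \<theta> ^ 3) + angle_integral (\<lambda>\<theta>. fst q / den b q \<theta> ^ 3))"
    by (simp only: set_integral_mult_right angle_integral_add[OF c(3,4)])
  also have "\<dots> \<le> 4 * dist a b * (10 / (dist a q)\<^sup>2 + 10 / (dist b q)\<^sup>2)"
    using ia ib by (intro mult_left_mono add_mono) auto
  finally show ?thesis by (simp add: algebra_simps)
qed

lemma kern_diff_fst_le:
  assumes "admissible N" and "0 \<le> fst a" and "0 \<le> fst b" and "0 \<le> fst q" and "a \<noteq> q" and "b \<noteq> q"
  shows "\<bar>kern N a q - kern N b q\<bar> \<le> 80 * (kernel_bound (dist a b) (dist a q) + kernel_bound (dist a b) (dist b q))"
proof -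
  have "0 \<le> 30 / dist a q" "0 \<le> 30 / dist b q" by auto
  then have 1: "\<bar>kern N a q - kern N b q\<bar> \<le> 40 * (1 / dist a q + 1 / dist b q)"
    using kern_abs_le[of N a q] kern_abs_le[of N b q] assms by simp
  have "\<bar>kern N a q - kern N b q\<bar> \<le> 2 * 40 * (kernel_bound (dist a b) (dist a q) + kernel_bound (dist a b) (dist b q))"
    by (rule kernel_bound_combine[OF _ _ _ 1 kern_diff_le_aux[OF assms] zero_le_dist]) (simp_all add: assms)
  then show ?thesis by simp
qed

lemma angle_integral_affine:
  assumes f: "continuous_on {0..pi} f" and g: "continuous_on {0..pi} g"
  shows "angle_integral (\<lambda>\<theta>. k + c * (f \<theta> + g \<theta>)) = pi * k + c * (angle_integral f + angle_integral g)"
proof -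
  have "angle_integral (\<lambda>\<theta>. k + c * (f \<theta> + g \<theta>)) = angle_integral (\<lambda>_. k) + angle_integral (\<lambda>\<theta>. c * (f \<theta> + g \<theta>))"
    by (intro angle_integral_add continuous_intros f g)
  also have "angle_integral (\<lambda>\<theta>. c * (f \<theta> + g \<theta>)) = c * angle_integral (\<lambda>\<theta>. f \<theta> + g \<theta>)"
    by (rule set_integral_mult_right)
  finally show ?thesis unfolding angle_integral_add[OF f g] angle_integral_const .
qed

text \<open>Unlike for the first argument, the weight \<open>fst q\<close> changes too. This adds a
  term with the increment of the weight, and pairs the weight of one point with the denominator of
  the other.\<close>

lemma kern_diff_snd_le:
  assumes N: "admissible N" and p: "0 \<le> fst p" and a: "0 \<le> fst a" and b: "0 \<le> fst b"
    and pa: "p \<noteq> a" and pb: "p \<noteq> b"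
  shows "\<bar>kern N p a - kern N p b\<bar> \<le> 160 * (kernel_bound (dist a b) (dist p a) + kernel_bound (dist a b) (dist p b))"
proof -
  have "0 \<le> 70 / dist p a" "0 \<le> 70 / dist p b" by auto
  then have 1: "\<bar>kern N p a - kern N p b\<bar> \<le> 80 * (1 / dist p a + 1 / dist p b)"
    using kern_abs_le[of N p a] kern_abs_le[of N p b] assms by simp
  have 2: "\<bar>kern N p a - kern N p b\<bar> \<le> 80 * (dist a b / (dist p a)\<^sup>2 + dist a b / (dist p b)\<^sup>2)"
    if da: "dist a b \<le> dist p a"
  proof -
    note c = continuous_kern_integrand[OF N p a pa] continuous_kern_integrand[OF N p b pb]
      continuous_inverse_den[OF p a pa, of "{0..pi}" _ 3] continuous_inverse_den[OF p b pb, of "{0..pi}" _ 3]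
    have E: "kern N p a - kern N p b = angle_integral (\<lambda>\<theta>. fst a * N p a \<theta> / den p a \<theta> ^ 3 - fst b * N p b \<theta> / den p b \<theta> ^ 3)"
      unfolding kern_def by (rule angle_integral_diff[symmetric]) (rule c)+
    have "\<bar>kern N p a - kern N p b\<bar> \<le> angle_integral (\<lambda>\<theta>. 5 * (dist a b / (dist p a)\<^sup>2) + 4 * dist a b * (fst a / den p a \<theta> ^ 3 + fst b / den p b \<theta> ^ 3))"
    unfolding E
    proof (intro angle_integral_abs_le continuous_on_diff continuous_on_add continuous_on_mult_left continuous_on_const c)
      fix \<theta>
      let ?x = "den p a \<theta>" and ?y = "den p b \<theta>" and ?d = "dist a b"
      have xy: "0 < ?x" "0 < ?y" by (intro den_pos assms)+
      have lip: "\<bar>?x - ?y\<bar> \<le> ?d" by (metis den_commute den_lipschitz)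
      have ax: "0 < dist p a" "dist p a \<le> ?x" using pa dist_le_den[OF p a] by auto
      have "\<bar>N p a \<theta> / ?x ^ 3 - N p b \<theta> / ?y ^ 3\<bar> \<le> 4 * ?d * (1 / ?x ^ 3 + 1 / ?y ^ 3)"
        by (intro cube_quotient_diff xy admissibleD[OF N] p a b lip)
      from mult_left_mono[OF this b]
      have A: "\<bar>fst b * (N p a \<theta> / ?x ^ 3 - N p b \<theta> / ?y ^ 3)\<bar> \<le> fst b * (4 * ?d * (1 / ?x ^ 3 + 1 / ?y ^ 3))"
        using b by (simp add: abs_mult)
      have "\<bar>(fst a - fst b) * (N p a \<theta> / ?x ^ 3)\<bar> \<le> ?d * (?x / ?x ^ 3)"
        unfolding abs_mult abs_divide
        using xy dist_comp_le(1)[of a b] admissibleD(1)[OF N p a] by (intro mult_mono frac_le) auto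
      also have "\<dots> = ?d / ?x\<^sup>2" using xy by (simp add: power3_eq_cube power2_eq_square)
      also have "\<dots> \<le> ?d / (dist p a)\<^sup>2"
        using ax by (intro divide_left_mono power_mono mult_pos_pos) auto
      finally have B: "\<bar>(fst a - fst b) * (N p a \<theta> / ?x ^ 3)\<bar> \<le> ?d / (dist p a)\<^sup>2" .
      \<comment> \<open>The angular integral of 1 / \<open>?x\<close>^3 is controlled only with the
        matching weight \<open>fst a\<close>. The excess of \<open>fst b\<close> over it is at most
        \<open>?d\<close>, which by \<open>da\<close> is absorbed by one factor of the
        distance.\<close>
      have "fst b * (?d / ?x ^ 3) \<le> (fst a + ?d) * (?d / ?x ^ 3)"
        using dist_comp_le(1)[of a b] xy by (intro mult_right_mono) auto
      moreover have "?d * (?d / ?x ^ 3) \<le> dist p a * (?d / (dist p a) ^ 3)"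
        using da ax xy by (intro mult_mono divide_left_mono power_mono mult_pos_pos zero_less_power) auto
      moreover have "dist p a * (?d / (dist p a) ^ 3) = ?d / (dist p a)\<^sup>2"
        using ax by (simp add: power3_eq_cube power2_eq_square)
      ultimately have C: "fst b * (?d / ?x ^ 3) \<le> fst a * (?d / ?x ^ 3) + ?d / (dist p a)\<^sup>2"
        by (simp only: distrib_right)
      have "fst a * N p a \<theta> / ?x ^ 3 - fst b * N p b \<theta> / ?y ^ 3
          = (fst a - fst b) * (N p a \<theta> / ?x ^ 3) + fst b * (N p a \<theta> / ?x ^ 3 - N p b \<theta> / ?y ^ 3)"
        by (simp add: diff_divide_distrib left_diff_distrib right_diff_distrib)
      moreover have "fst b * (4 * ?d * (1 / ?x ^ 3 + 1 / ?y ^ 3)) = 4 * (fst b * (?d / ?x ^ 3)) + 4 * ?d * (fst b / ?y ^ 3)"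
        by (simp add: algebra_simps)
      moreover have "4 * ?d * (fst a / ?x ^ 3 + fst b / ?y ^ 3) = 4 * (fst a * (?d / ?x ^ 3)) + 4 * ?d * (fst b / ?y ^ 3)"
        by (simp add: algebra_simps)
      ultimately show "\<bar>fst a * N p a \<theta> / ?x ^ 3 - fst b * N p b \<theta> / ?y ^ 3\<bar>
          \<le> 5 * (?d / (dist p a)\<^sup>2) + 4 * ?d * (fst a / ?x ^ 3 + fst b / ?y ^ 3)"
        using A B C by linarith
    qed
    also have "\<dots> = pi * (5 * (dist a b / (dist p a)\<^sup>2)) + 4 * dist a b * (angle_integral (\<lambda>\<theta>. fst a / den p a \<theta> ^ 3) + angle_integral (\<lambda>\<theta>. fst b / den p b \<theta> ^ 3))"
      by (rule angle_integral_affine[OF c(3,4)])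
    also have "\<dots> \<le> 4 * (5 * (dist a b / (dist p a)\<^sup>2)) + 4 * dist a b * (10 / (dist p a)\<^sup>2 + 10 / (dist p b)\<^sup>2)"
      using angle_integral_inverse_cube[OF p a pa] angle_integral_inverse_cube[OF p b pb] pi_less_4
      by (intro mult_left_mono mult_right_mono add_mono) auto
    also have "\<dots> = 60 * (dist a b / (dist p a)\<^sup>2) + 40 * (dist a b / (dist p b)\<^sup>2)"
      by (simp add: algebra_simps)
    also have "\<dots> \<le> 80 * (dist a b / (dist p a)\<^sup>2) + 80 * (dist a b / (dist p b)\<^sup>2)"
      by (intro add_mono mult_right_mono) auto
    finally show ?thesis by (simp add: distrib_left)
  qed
  have "\<bar>kern N p a - kern N p b\<bar> \<le> 2 * 80 * (kernel_bound (dist a b) (dist p a) + kernel_bound (dist a b) (dist p b))"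
    by (rule kernel_bound_combine[OF _ _ _ 1 2 zero_le_dist]) (simp_all add: pa pb)
  then show ?thesis by simp
qed

section \<open>The potential of a vortex ring and its first-order expansion\<close>

definition num_a :: "real \<times> real \<Rightarrow> real \<times> real \<Rightarrow> real \<Rightarrow> real" where
  "num_a p q \<theta> = cos \<theta> * (fst q * cos \<theta> - fst p)"

lemma admissible_num_a: "admissible num_a"
  unfolding admissible_def
proof (intro conjI allI impI)
  fix p q a b :: "real \<times> real" and \<theta> :: real
  { assume "0 \<le> fst p" "0 \<le> fst q"
    have "(den p q \<theta>)\<^sup>2 = (fst q * cos \<theta> - fst p)\<^sup>2 + ((fst q * sin \<theta>)\<^sup>2 + (snd p - snd q)\<^sup>2)"
      by (simp add: den_def norm_Pair power2_commute[of "fst p"])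
    then have "(fst q * cos \<theta> - fst p)\<^sup>2 \<le> (den p q \<theta>)\<^sup>2" by simp
    then have "\<bar>fst q * cos \<theta> - fst p\<bar> \<le> den p q \<theta>"
      by (rule abs_le_square_iff[THEN iffD2, THEN order_trans]) simp
    then show "\<bar>num_a p q \<theta>\<bar> \<le> den p q \<theta>"
      using cos_mult_abs_le[of \<theta> "fst q * cos \<theta> - fst p"] by (simp add: num_a_def) }
  have "num_a a q \<theta> - num_a b q \<theta> = cos \<theta> * (fst b - fst a)"
    by (simp add: num_a_def algebra_simps)
  then show "\<bar>num_a a q \<theta> - num_a b q \<theta>\<bar> \<le> dist a b"
    using cos_mult_abs_le[of \<theta> "fst b - fst a"] dist_comp_le(1)[of b a] by (simp add: dist_commute)
  have "num_a p a \<theta> - num_a p b \<theta> = cos \<theta> * (cos \<theta> * (fst a - fst b))"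
    by (simp add: num_a_def algebra_simps)
  then show "\<bar>num_a p a \<theta> - num_a p b \<theta>\<bar> \<le> dist a b"
    using cos_mult_abs_le[of \<theta> "cos \<theta> * (fst a - fst b)"] cos_mult_abs_le[of \<theta> "fst a - fst b"] dist_comp_le(1)[of a b]
    by linarith
  show "continuous_on UNIV (\<lambda>x. num_a (fst (fst x)) (snd (fst x)) (snd x))"
    unfolding num_a_def by (intro continuous_intros)
qed

text \<open>The kernel of the stream function divided by \<open>fst p\<close>, see
  \<open>stream_kernel_eq\<close>. Differentiating the integrand in the radius of \<open>p\<close>
  produces the numerator \<open>num_a\<close>, differentiating it in the height produces
  \<open>num_r\<close>.\<close>

definition pot :: "real \<times> real \<Rightarrow> real \<times> real \<Rightarrow> real" where
  "pot p q = angle_integral (\<lambda>\<theta>. fst q * cos \<theta> / den p q \<theta>)"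

lemma continuous_pot_integrand:
  assumes "0 \<le> fst p" "0 \<le> fst q" "p \<noteq> q"
  shows "continuous_on S (\<lambda>\<theta>. f * cos \<theta> / den p q \<theta>)"
proof -
  have "den p q \<theta> \<noteq> 0" for \<theta> using den_pos[OF assms, of \<theta>] by simp
  then show ?thesis by (intro continuous_intros) auto
qed

lemma borel_measurable_pot [measurable]:
  "(\<lambda>x. pot (fst x) (snd x)) \<in> borel_measurable borel"
proof -
  have [measurable]: "(\<lambda>x. den (fst (fst x)) (snd (fst x)) (snd x)) \<in> borel_measurable borel"
    by (intro borel_measurable_continuous_onI continuous_intros)
  have [measurable]: "(\<lambda>x. fst (snd (fst x))) \<in> borel_measurable (borel :: (((real \<times> real) \<times> (real \<times> real)) \<times> real) measure)"
    "snd \<in> borel_measurable (borel :: (((real \<times> real) \<times> (real \<times> real)) \<times> real) measure)"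
    by (intro borel_measurable_continuous_onI continuous_intros)+
  have "(\<lambda>(x :: (real \<times> real) \<times> (real \<times> real), \<theta>). indicat_real {0..pi} \<theta> *\<^sub>R (fst (snd x) * cos \<theta> / den (fst x) (snd x) \<theta>))
          \<in> borel_measurable borel"
    unfolding split_beta by measurable
  also have "borel_measurable borel = borel_measurable ((borel :: ((real \<times> real) \<times> (real \<times> real)) measure) \<Otimes>\<^sub>M (lborel :: real measure))"
    by (rule measurable_cong_sets) (simp_all add: borel_prod[symmetric] cong: sets_pair_measure_cong)
  finally have "(\<lambda>(x :: (real \<times> real) \<times> (real \<times> real), \<theta>). indicat_real {0..pi} \<theta> *\<^sub>R (fst (snd x) * cos \<theta> / den (fst x) (snd x) \<theta>))
          \<in> borel_measurable (borel \<Otimes>\<^sub>M lborel)" .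
  then show ?thesis
    unfolding pot_def set_lebesgue_integral_def by (rule lborel.borel_measurable_lebesgue_integral)
qed

text \<open>Since \<open>fst q\<close> is at most \<open>fst p + den p q \<theta>\<close>, the
  weight causes no growth for distant \<open>q\<close>, so finite mass is enough for
  integrability.\<close>

lemma pot_abs_le:
  assumes p: "0 \<le> fst p" and q: "0 \<le> fst q" and pq: "p \<noteq> q"
  shows "\<bar>pot p q\<bar> \<le> pi * (1 + fst p / dist p q)"
proof -
  have "\<bar>pot p q\<bar> \<le> angle_integral (\<lambda>_. 1 + fst p / dist p q)"
    unfolding pot_def
  proof (intro angle_integral_abs_le continuous_pot_integrand assms continuous_on_const)
    fix \<theta>
    have d: "0 < dist p q" "dist p q \<le> den p q \<theta>" "0 < den p q \<theta>"
      using pq dist_le_den[OF p q] den_pos[OF assms] by auto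
    have "\<bar>fst q * cos \<theta> / den p q \<theta>\<bar> \<le> fst q / den p q \<theta>"
      using cos_mult_abs_le[of \<theta> "fst q"] q d by (simp add: divide_right_mono mult.commute)
    also have "\<dots> \<le> (fst p + den p q \<theta>) / den p q \<theta>"
      using dist_comp_le(1)[of p q] d by (intro divide_right_mono) auto
    also have "\<dots> = 1 + fst p / den p q \<theta>" using d by (simp add: add_divide_distrib)
    also have "\<dots> \<le> 1 + fst p / dist p q" using d p by (auto intro!: divide_left_mono)
    finally show "\<bar>fst q * cos \<theta> / den p q \<theta>\<bar> \<le> 1 + fst p / dist p q" .
  qed
  then show ?thesis by simp
qed

text \<open>A Taylor expansion with an explicit remainder that can be integrated against a bounded
  density. It gives the derivatives of the potential without differentiating under a singular
  integral. The two bounds of \<open>inverse_remainder\<close> serve far from the poles and close to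
  them.\<close>

lemma pot_remainder:
  assumes a: "0 \<le> fst a" and b: "0 \<le> fst b" and q: "0 \<le> fst q" and aq: "a \<noteq> q" and bq: "b \<noteq> q"
  shows "\<bar>pot b q - pot a q - ((fst b - fst a) * kern num_a a q + (snd b - snd a) * kern num_r a q)\<bar>
    \<le> 80 * dist a b * (kernel_bound (dist a b) (dist a q) + kernel_bound (dist a b) (dist b q))" (is "?U \<le> _")
proof -
  let ?v = "dist a b"
  note c = continuous_kern_integrand[OF admissible_num_a a q aq] continuous_kern_integrand[OF admissible_num_r a q aq]
    continuous_pot_integrand[OF a q aq, of "{0..pi}"] continuous_pot_integrand[OF b q bq, of "{0..pi}"]
    continuous_inverse_den[OF a q aq, of "{0..pi}"] continuous_inverse_den[OF b q bq, of "{0..pi}"]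
  define f where "f \<theta> = fst q * cos \<theta> / den b q \<theta> - fst q * cos \<theta> / den a q \<theta>
      - ((fst b - fst a) * (fst q * num_a a q \<theta> / den a q \<theta> ^ 3) + (snd b - snd a) * (fst q * num_r a q \<theta> / den a q \<theta> ^ 3))" for \<theta>
  have cf: "continuous_on {0..pi} f"
    unfolding f_def by (intro continuous_on_diff continuous_on_add continuous_on_mult_left c)
  have U: "?U = \<bar>angle_integral f\<bar>"
    unfolding f_def pot_def kern_def
    by (subst angle_integral_diff, (intro continuous_on_diff continuous_on_add continuous_on_mult_left c)+,
        subst angle_integral_diff, (intro c)+, subst angle_integral_add, (intro continuous_on_mult_left c)+)
      (simp only: set_integral_mult_right)
  \<comment> \<open>The inner product of the vector defining \<open>den a q \<theta>\<close> with
    the displacement from \<open>a\<close> to \<open>b\<close>, as needed for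
    \<open>inverse_remainder\<close>.\<close>
  define s where "s \<theta> = (fst b - fst a) * (fst a - fst q * cos \<theta>) + (snd b - snd a) * (snd a - snd q)" for \<theta>
  have f: "f \<theta> = fst q * cos \<theta> * (1 / den b q \<theta> - 1 / den a q \<theta> + s \<theta> / den a q \<theta> ^ 3)" for \<theta>
    unfolding f_def s_def num_a_def num_r_def by (simp add: diff_divide_distrib add_divide_distrib algebra_simps)
  have fabs: "\<bar>f \<theta>\<bar> \<le> fst q * \<bar>1 / den b q \<theta> - 1 / den a q \<theta> + s \<theta> / den a q \<theta> ^ 3\<bar>" for \<theta>
    using mult_left_mono[OF cos_mult_abs_le[of \<theta> "1 / den b q \<theta> - 1 / den a q \<theta> + s \<theta> / den a q \<theta> ^ 3"] q] q
    unfolding f by (simp add: abs_mult mult.assoc)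
  have ab: "den b q \<theta> = norm (((fst a - fst q * cos \<theta>, fst q * sin \<theta>), snd a - snd q) + ((fst b - fst a, 0), snd b - snd a))" for \<theta>
    by (simp add: den_def)
  have nv: "norm ((fst b - fst a, 0 :: real), snd b - snd a) = ?v"
    by (simp add: norm_Pair dist_prod_def dist_real_def power2_commute[of "fst b"] power2_commute[of "snd b"])
  have sq: "(den b q \<theta>)\<^sup>2 = (den a q \<theta>)\<^sup>2 + 2 * s \<theta> + ?v\<^sup>2" for \<theta>
    unfolding ab nv[symmetric] den_def[of a] power2_norm_eq_inner inner_add_left inner_add_right s_def
    by (simp add: inner_commute algebra_simps)
  have sb: "\<bar>s \<theta>\<bar> \<le> den a q \<theta> * ?v" for \<theta>
  proof -
    have "s \<theta> = inner ((fst a - fst q * cos \<theta>, fst q * sin \<theta>), snd a - snd q) ((fst b - fst a, 0), snd b - snd a)"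
      by (simp add: s_def algebra_simps)
    then show ?thesis unfolding den_def nv[symmetric] by (simp only: Cauchy_Schwarz_ineq2)
  qed
  have lip: "\<bar>den b q \<theta> - den a q \<theta>\<bar> \<le> ?v" for \<theta>
    using den_lipschitz[of b q \<theta> a] by (simp add: dist_commute)
  note r = inverse_remainder[OF den_pos[OF a q aq] den_pos[OF b q bq] sq sb lip]
  have "\<bar>angle_integral f\<bar> \<le> angle_integral (\<lambda>\<theta>. 4 * ?v\<^sup>2 * (fst q / den a q \<theta> ^ 3 + fst q / den b q \<theta> ^ 3))"
  proof (intro angle_integral_abs_le cf continuous_on_mult_left continuous_on_add c)
    show "\<bar>f \<theta>\<bar> \<le> 4 * ?v\<^sup>2 * (fst q / den a q \<theta> ^ 3 + fst q / den b q \<theta> ^ 3)" for \<theta>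
      using order_trans[OF fabs mult_left_mono[OF r(1) q]] by (simp add: algebra_simps)
  qed
  also have "\<dots> = 4 * ?v\<^sup>2 * (angle_integral (\<lambda>\<theta>. fst q / den a q \<theta> ^ 3) + angle_integral (\<lambda>\<theta>. fst q / den b q \<theta> ^ 3))"
    by (simp only: set_integral_mult_right angle_integral_add[OF c(5,6)])
  also have "\<dots> \<le> 4 * ?v\<^sup>2 * (10 / (dist a q)\<^sup>2 + 10 / (dist b q)\<^sup>2)"
    using angle_integral_inverse_cube[OF a q aq] angle_integral_inverse_cube[OF b q bq]
    by (intro mult_left_mono add_mono) auto
  also have "\<dots> = 40 * ?v * (?v / (dist a q)\<^sup>2 + ?v / (dist b q)\<^sup>2)"
    by (simp add: algebra_simps power2_eq_square)
  finally have 2: "?U \<le> 40 * ?v * (?v / (dist a q)\<^sup>2 + ?v / (dist b q)\<^sup>2)" unfolding U .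
  have "\<bar>angle_integral f\<bar> \<le> angle_integral (\<lambda>\<theta>. 2 * ?v * (fst q / (den a q \<theta>)\<^sup>2 + fst q / (den b q \<theta>)\<^sup>2))"
  proof (intro angle_integral_abs_le cf continuous_on_mult_left continuous_on_add c)
    show "\<bar>f \<theta>\<bar> \<le> 2 * ?v * (fst q / (den a q \<theta>)\<^sup>2 + fst q / (den b q \<theta>)\<^sup>2)" for \<theta>
      using order_trans[OF fabs mult_left_mono[OF r(2) q]] by (simp add: algebra_simps)
  qed
  also have "\<dots> = 2 * ?v * (angle_integral (\<lambda>\<theta>. fst q / (den a q \<theta>)\<^sup>2) + angle_integral (\<lambda>\<theta>. fst q / (den b q \<theta>)\<^sup>2))"
    by (simp only: set_integral_mult_right angle_integral_add[OF c(5,6)])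
  also have "\<dots> \<le> 2 * ?v * (20 / dist a q + 20 / dist b q)"
  proof -
    have "10 / dist a q \<le> 20 / dist a q" "10 / dist b q \<le> 20 / dist b q"
      by (auto intro!: divide_right_mono)
    then show ?thesis
      using angle_integral_inverse_square[OF a q aq] angle_integral_inverse_square[OF b q bq]
      by (intro mult_left_mono add_mono) (auto elim: order_trans)
  qed
  also have "\<dots> = 40 * ?v * (1 / dist a q + 1 / dist b q)"
    by (simp add: algebra_simps)
  finally have 1: "?U \<le> 40 * ?v * (1 / dist a q + 1 / dist b q)" unfolding U .
  have "?U \<le> 2 * (40 * ?v) * (kernel_bound ?v (dist a q) + kernel_bound ?v (dist b q))"
    by (rule kernel_bound_combine[OF _ _ _ 1 2 zero_le_dist]) (simp_all add: aq bq)
  then show ?thesis by simp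
qed

text \<open>The function sin \<theta> / \<open>den p q \<theta>\<close> vanishes at 0 and \<pi>, and
  its derivative is the difference of the two integrands.\<close>

lemma angle_integral_cos_by_parts:
  assumes p: "0 \<le> fst p" and q: "0 \<le> fst q" and pq: "p \<noteq> q"
  shows "angle_integral (\<lambda>\<theta>. cos \<theta> / den p q \<theta>) = fst p * fst q * angle_integral (\<lambda>\<theta>. (sin \<theta>)\<^sup>2 / den p q \<theta> ^ 3)"
proof -
  have d0: "den p q \<theta> \<noteq> 0" for \<theta> using den_pos[OF assms, of \<theta>] by simp
  have c1: "continuous_on UNIV (\<lambda>\<theta>. cos \<theta> / den p q \<theta>)"
    using continuous_pot_integrand[OF assms, of UNIV 1] by simp
  have c2: "continuous_on UNIV (\<lambda>\<theta>. (sin \<theta>)\<^sup>2 / den p q \<theta> ^ 3)"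
    using d0 by (intro continuous_intros) auto
  have c3: "continuous_on UNIV (\<lambda>\<theta>. cos \<theta> / den p q \<theta> - fst p * fst q * ((sin \<theta>)\<^sup>2 / den p q \<theta> ^ 3))"
    by (intro continuous_on_diff continuous_on_mult_left c1 c2)
  have "angle_integral (\<lambda>\<theta>. cos \<theta> / den p q \<theta> - fst p * fst q * ((sin \<theta>)\<^sup>2 / den p q \<theta> ^ 3))
     = sin pi / den p q pi - sin 0 / den p q 0"
    unfolding set_lebesgue_integral_def real_scaleR_def mult.commute[of "indicator _ _"]
  proof (rule integral_FTC_Icc_real)
    fix x :: real
    let ?g = "\<lambda>\<theta>. (dist p q)\<^sup>2 + 2 * fst p * fst q * (1 - cos \<theta>)"
    have g: "0 < ?g x"
      using den_pos[OF assms, of x] unfolding den_eq by simp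
    have "((\<lambda>\<theta>. sin \<theta> / sqrt (?g \<theta>)) has_real_derivative
        (cos x * sqrt (?g x) - sin x * (2 * fst p * fst q * sin x * (inverse (sqrt (?g x)) / 2))) / (sqrt (?g x) * sqrt (?g x))) (at x)"
      using g by (auto intro!: derivative_eq_intros)
    moreover have "(cos x * sqrt (?g x) - sin x * (2 * fst p * fst q * sin x * (inverse (sqrt (?g x)) / 2))) / (sqrt (?g x) * sqrt (?g x))
        = cos x / sqrt (?g x) - fst p * fst q * ((sin x)\<^sup>2 / sqrt (?g x) ^ 3)"
      using g by (simp add: divide_simps power3_eq_cube power2_eq_square)
    ultimately show "((\<lambda>\<theta>. sin \<theta> / den p q \<theta>) has_real_derivative cos x / den p q x - fst p * fst q * ((sin x)\<^sup>2 / den p q x ^ 3)) (at x)"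
      unfolding den_eq by (simp only:)
    show "isCont (\<lambda>\<theta>. cos \<theta> / den p q \<theta> - fst p * fst q * ((sin \<theta>)\<^sup>2 / den p q \<theta> ^ 3)) x"
      using c3 by (simp add: continuous_on_eq_continuous_at)
  qed simp
  moreover have "angle_integral (\<lambda>\<theta>. cos \<theta> / den p q \<theta> - fst p * fst q * ((sin \<theta>)\<^sup>2 / den p q \<theta> ^ 3))
     = angle_integral (\<lambda>\<theta>. cos \<theta> / den p q \<theta>) - fst p * fst q * angle_integral (\<lambda>\<theta>. (sin \<theta>)\<^sup>2 / den p q \<theta> ^ 3)"
    by (simp only: set_integral_mult_right
        angle_integral_diff[OF continuous_on_subset[OF c1 subset_UNIV] continuous_on_mult_left[OF continuous_on_subset[OF c2 subset_UNIV]]])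
  ultimately show ?thesis by simp
qed

text \<open>With \<psi> = r times the potential, - \<partial>_r \<psi> / r contains both the
  derivative of the potential and the potential over r. Integration by parts gives the second term
  the same denominator as the first, and sin^2 + cos^2 = 1 collapses the sum to the single numerator
  \<open>num_z\<close>.\<close>

lemma kern_num_a_pot:
  assumes p: "0 < fst p" and q: "0 \<le> fst q" and pq: "p \<noteq> q"
  shows "kern num_a p q + pot p q / fst p = - kern num_z p q"
proof -
  have p': "0 \<le> fst p" using p by simp
  have d0: "den p q \<theta> \<noteq> 0" for \<theta> using den_pos[OF p' q pq, of \<theta>] by simp
  note ca = continuous_kern_integrand[OF admissible_num_a p' q pq] and cz = continuous_kern_integrand[OF admissible_num_z p' q pq]
  have cs: "continuous_on {0..pi} (\<lambda>\<theta>. (sin \<theta>)\<^sup>2 / den p q \<theta> ^ 3)"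
    using d0 by (intro continuous_intros) auto
  have "pot p q = fst q * angle_integral (\<lambda>\<theta>. cos \<theta> / den p q \<theta>)"
    unfolding pot_def by (simp only: set_integral_mult_right times_divide_eq_right[symmetric])
  then have "pot p q / fst p = (fst q)\<^sup>2 * angle_integral (\<lambda>\<theta>. (sin \<theta>)\<^sup>2 / den p q \<theta> ^ 3)"
    using p by (simp add: angle_integral_cos_by_parts[OF p' q pq] power2_eq_square)
  then have "kern num_a p q + pot p q / fst p
      = angle_integral (\<lambda>\<theta>. fst q * num_a p q \<theta> / den p q \<theta> ^ 3 + (fst q)\<^sup>2 * ((sin \<theta>)\<^sup>2 / den p q \<theta> ^ 3))"
    unfolding kern_def by (simp only: angle_integral_add[OF ca continuous_on_mult_left[OF cs]] set_integral_mult_right)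
  also have "(\<lambda>\<theta>. fst q * num_a p q \<theta> / den p q \<theta> ^ 3 + (fst q)\<^sup>2 * ((sin \<theta>)\<^sup>2 / den p q \<theta> ^ 3))
      = (\<lambda>\<theta>. (-1) * (fst q * num_z p q \<theta> / den p q \<theta> ^ 3))"
  proof
    fix \<theta>
    have "fst q * num_a p q \<theta> + (fst q)\<^sup>2 * (sin \<theta>)\<^sup>2 = (-1) * (fst q * num_z p q \<theta>)"
      unfolding num_a_def num_z_def sin_squared_eq by (simp add: algebra_simps power2_eq_square)
    then show "fst q * num_a p q \<theta> / den p q \<theta> ^ 3 + (fst q)\<^sup>2 * ((sin \<theta>)\<^sup>2 / den p q \<theta> ^ 3) = (-1) * (fst q * num_z p q \<theta> / den p q \<theta> ^ 3)"
      by (simp only: times_divide_eq_right add_divide_distrib[symmetric])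
  qed
  finally show ?thesis unfolding kern_def by (simp only: set_integral_mult_right)
qed

lemma stream_kernel_eq:
  assumes p: "0 < fst p" and q: "0 < fst q" and pq: "p \<noteq> q"
  shows "sqrt (fst p * fst q) * kernel_F (((fst p - fst q)\<^sup>2 + (snd p - snd q)\<^sup>2) / (fst p * fst q)) = fst p * pot p q"
proof -
  let ?s = "((fst p - fst q)\<^sup>2 + (snd p - snd q)\<^sup>2) / (fst p * fst q)"
  have rr: "0 < fst p * fst q" using p q by simp
  have d: "sqrt (2 * (1 - cos \<theta>) + ?s) = den p q \<theta> / sqrt (fst p * fst q)" for \<theta>
  proof -
    have "2 * (1 - cos \<theta>) + ?s = ((dist p q)\<^sup>2 + 2 * fst p * fst q * (1 - cos \<theta>)) / (fst p * fst q)"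
      using p q by (simp add: dist_prod_def dist_real_def add_divide_distrib)
    then show ?thesis by (simp add: den_eq real_sqrt_divide)
  qed
  have c: "continuous_on {0..pi} (\<lambda>\<theta>. cos \<theta> / den p q \<theta>)"
    using continuous_pot_integrand[of p q "{0..pi}" 1] assms by simp
  have "kernel_F ?s = integral {0..pi} (\<lambda>\<theta>. sqrt (fst p * fst q) * (cos \<theta> / den p q \<theta>))"
    unfolding kernel_F_def d by (simp add: mult.commute)
  also have "\<dots> = sqrt (fst p * fst q) * angle_integral (\<lambda>\<theta>. cos \<theta> / den p q \<theta>)"
    by (simp only: set_borel_integral_eq_integral(2)[OF borel_integrable_atLeastAtMost'[OF c]] integral_mult_right)
  finally have "sqrt (fst p * fst q) * kernel_F ?s = fst p * (fst q * angle_integral (\<lambda>\<theta>. cos \<theta> / den p q \<theta>))"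
    using rr by simp
  also have "fst q * angle_integral (\<lambda>\<theta>. cos \<theta> / den p q \<theta>) = pot p q"
    unfolding pot_def by (simp only: set_integral_mult_right times_divide_eq_right[symmetric])
  finally show ?thesis .
qed

subsection \<open>The velocity field\<close>

text \<open>Models |\<omega>| dr dz for \<omega> bounded by \<open>B\<close> with mass at most
  \<open>M\<close>. Comparing integrals instead of naming a density makes the property pass directly
  to restrictions and reflections, and to images under the flow.\<close>

definition tame :: "(real \<times> real) measure \<Rightarrow> real \<Rightarrow> real \<Rightarrow> bool" where
  "tame V B M \<longleftrightarrow> sets V = sets borel \<and> 0 \<le> B \<and> 0 \<le> M \<and> emeasure V UNIV \<le> ennreal M \<and>
     (\<forall>f\<in>borel_measurable borel. (\<integral>\<^sup>+ q. f q \<partial>V) \<le> ennreal B * (\<integral>\<^sup>+ q. f q \<partial>lborel))"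

lemma tame_sets: "tame V B M \<Longrightarrow> sets V = sets borel"
  by (simp add: tame_def)

lemma tame_nonneg: "tame V B M \<Longrightarrow> 0 \<le> B" "tame V B M \<Longrightarrow> 0 \<le> M"
  by (simp_all add: tame_def)

lemma tame_finite: "tame V B M \<Longrightarrow> finite_measure V"
  using sets_eq_imp_space_eq[of V borel]
  by (intro finite_measureI) (auto simp: tame_def top.extremum_strict less_top[symmetric] dest!: le_less_trans[OF _ ennreal_less_top])

lemma tame_radial_le:
  assumes V: "tame V B M" and f: "f \<in> borel_measurable borel"
    and "(\<integral>\<^sup>+ r. ennreal (2 * pi * r) * indicator {0<..} r * f r \<partial>lborel) \<le> ennreal I" and "0 \<le> I"
  shows "(\<integral>\<^sup>+ q. f (dist c q) \<partial>V) \<le> ennreal (B * I)"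
proof -
  have [measurable]: "(\<lambda>q. f (dist c q)) \<in> borel_measurable borel"
    using f by measurable
  have "(\<integral>\<^sup>+ q. f (dist c q) \<partial>V) \<le> ennreal B * (\<integral>\<^sup>+ q. f (dist c q) \<partial>lborel)"
    using V unfolding tame_def by auto
  also have "\<dots> \<le> ennreal B * ennreal I"
    unfolding nn_integral_radial[OF f] using assms(3) by (intro mult_left_mono) auto
  finally show ?thesis using V assms(4) by (simp add: tame_def ennreal_mult)
qed

lemma tame_singular_le:
  assumes V: "tame V B M" and l: "0 \<le> l"
  shows "(\<integral>\<^sup>+ q. ennreal (if dist c q < l then 1 / dist c q else 0) \<partial>V) \<le> ennreal (B * (2 * pi * l))"
proof (rule tame_radial_le[OF V, of "\<lambda>x. ennreal (if x < l then 1 / x else 0)"])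
  have "(\<integral>\<^sup>+ r. ennreal (2 * pi * r) * indicator {0<..} r * ennreal (if r < l then 1 / r else 0) \<partial>lborel)
     \<le> (\<integral>\<^sup>+ r. ennreal (2 * pi) * indicator {0..l} r \<partial>lborel)"
    by (intro nn_integral_mono) (auto simp: indicator_def ennreal_mult[symmetric])
  also have "\<dots> = ennreal (2 * pi * l)"
    using l by (simp add: nn_integral_cmult_indicator ennreal_mult)
  finally show "(\<integral>\<^sup>+ r. ennreal (2 * pi * r) * indicator {0<..} r * ennreal (if r < l then 1 / r else 0) \<partial>lborel) \<le> ennreal (2 * pi * l)" .
qed (use l in auto)

lemma tame_dist_le_inverse:
  assumes V: "tame V B M"
  shows "(\<integral>\<^sup>+ q. ennreal (1 / dist c q) \<partial>V) \<le> ennreal (2 * pi * B + M)"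
proof -
  have [measurable_cong]: "sets V = sets borel" by (rule tame_sets[OF V])
  have "(\<integral>\<^sup>+ q. ennreal (1 / dist c q) \<partial>V) \<le> (\<integral>\<^sup>+ q. ennreal (if dist c q < 1 then 1 / dist c q else 0) + 1 \<partial>V)"
    by (intro nn_integral_mono) (auto simp: divide_le_eq_1 simp flip: ennreal_1)
  also have "\<dots> = (\<integral>\<^sup>+ q. ennreal (if dist c q < 1 then 1 / dist c q else 0) \<partial>V) + emeasure V UNIV"
    by (subst nn_integral_add) (auto simp: sets_eq_imp_space_eq[OF tame_sets[OF V]])
  also have "\<dots> \<le> ennreal (B * (2 * pi * 1)) + ennreal M"
    using V by (intro add_mono tame_singular_le[OF V]) (auto simp: tame_def)
  also have "\<dots> = ennreal (2 * pi * B + M)"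
    using V by (subst ennreal_plus[symmetric]) (auto simp: tame_def ac_simps)
  finally show ?thesis .
qed

text \<open>1 / |x|^2 just fails to be integrable in the plane. Removing a disc of radius
  \<open>l\<close> costs ln (1/l), which is the source of the log-Lipschitz modulus of the
  velocity.\<close>

lemma tame_inverse_square_le:
  assumes V: "tame V B M" and l: "0 < l" "l \<le> 1"
  shows "(\<integral>\<^sup>+ q. ennreal (if l \<le> dist c q then 1 / (dist c q)\<^sup>2 else 0) \<partial>V) \<le> ennreal (2 * pi * B * ln (1 / l) + M)"
proof -
  have [measurable_cong]: "sets V = sets borel" by (rule tame_sets[OF V])
  have ln: "0 \<le> ln (1 / l)" using l by simp
  have "(\<integral>\<^sup>+ q. ennreal (if l \<le> dist c q then 1 / (dist c q)\<^sup>2 else 0) \<partial>V)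
      \<le> (\<integral>\<^sup>+ q. ennreal (if l \<le> dist c q \<and> dist c q \<le> 1 then 1 / (dist c q)\<^sup>2 else 0) + 1 \<partial>V)"
    by (intro nn_integral_mono) (auto simp: divide_le_eq_1 one_le_power not_le less_imp_le simp flip: ennreal_1)
  also have "\<dots> = (\<integral>\<^sup>+ q. ennreal (if l \<le> dist c q \<and> dist c q \<le> 1 then 1 / (dist c q)\<^sup>2 else 0) \<partial>V) + emeasure V UNIV"
    by (subst nn_integral_add) (auto simp: sets_eq_imp_space_eq[OF tame_sets[OF V]])
  also have "\<dots> \<le> ennreal (B * (2 * pi * ln (1 / l))) + ennreal M"
  proof (intro add_mono)
    show "(\<integral>\<^sup>+ q. ennreal (if l \<le> dist c q \<and> dist c q \<le> 1 then 1 / (dist c q)\<^sup>2 else 0) \<partial>V) \<le> ennreal (B * (2 * pi * ln (1 / l)))"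
    proof (rule tame_radial_le[OF V, of "\<lambda>x. ennreal (if l \<le> x \<and> x \<le> 1 then 1 / x\<^sup>2 else 0)"])
      have "(\<integral>\<^sup>+ r. ennreal (2 * pi * r) * indicator {0<..} r * ennreal (if l \<le> r \<and> r \<le> 1 then 1 / r\<^sup>2 else 0) \<partial>lborel)
         = (\<integral>\<^sup>+ r. ennreal (2 * pi / r) * indicator {l..1} r \<partial>lborel)"
        using l by (intro nn_integral_cong) (auto simp: indicator_def ennreal_mult[symmetric] power2_eq_square)
      also have "\<dots> = ennreal (2 * pi * ln 1 - 2 * pi * ln l)"
        using l by (intro nn_integral_FTC_Icc) (auto intro!: derivative_eq_intros)
      finally show "(\<integral>\<^sup>+ r. ennreal (2 * pi * r) * indicator {0<..} r * ennreal (if l \<le> r \<and> r \<le> 1 then 1 / r\<^sup>2 else 0) \<partial>lborel)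
         \<le> ennreal (2 * pi * ln (1 / l))"
        using l by (simp add: ln_div)
    qed (use ln in auto)
  qed (use V in \<open>auto simp: tame_def\<close>)
  also have "\<dots> = ennreal (2 * pi * B * ln (1 / l) + M)"
    using V ln by (subst ennreal_plus[symmetric]) (auto simp: tame_def ac_simps)
  finally show ?thesis .
qed

lemma tame_kernel_bound_le:
  assumes V: "tame V B M" and l: "0 < l" "l \<le> 1" and d: "0 \<le> d"
  shows "(\<integral>\<^sup>+ q. ennreal (kernel_bound d (dist c q)) \<partial>V) \<le> ennreal (2 * pi * B * l + d * (2 * pi * B * ln (1 / l) + M))"
proof -
  have [measurable_cong]: "sets V = sets borel" by (rule tame_sets[OF V])
  have ln: "0 \<le> ln (1 / l)" using l by simp
  have "(\<integral>\<^sup>+ q. ennreal (kernel_bound d (dist c q)) \<partial>V)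
     \<le> (\<integral>\<^sup>+ q. ennreal (if dist c q < l then 1 / dist c q else 0) + ennreal d * ennreal (if l \<le> dist c q then 1 / (dist c q)\<^sup>2 else 0) \<partial>V)"
    using d by (intro nn_integral_mono) (auto simp: kernel_bound_def ennreal_mult[symmetric])
  also have "\<dots> = (\<integral>\<^sup>+ q. ennreal (if dist c q < l then 1 / dist c q else 0) \<partial>V)
      + ennreal d * (\<integral>\<^sup>+ q. ennreal (if l \<le> dist c q then 1 / (dist c q)\<^sup>2 else 0) \<partial>V)"
    by (subst nn_integral_add, simp, simp, subst nn_integral_cmult) auto
  also have "\<dots> \<le> ennreal (B * (2 * pi * l)) + ennreal d * ennreal (2 * pi * B * ln (1 / l) + M)"
    using l by (intro add_mono mult_left_mono tame_singular_le[OF V] tame_inverse_square_le[OF V]) auto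
  also have "\<dots> = ennreal (2 * pi * B * l + d * (2 * pi * B * ln (1 / l) + M))"
    using tame_nonneg[OF V] l d ln by (simp add: ennreal_mult[symmetric] ennreal_plus[symmetric] ac_simps del: ennreal_plus)
  finally show ?thesis .
qed

lemma tame_AE_neq:
  assumes V: "tame V B M" shows "AE q in V. q \<noteq> c"
proof -
  have [measurable_cong]: "sets V = sets borel" by (rule tame_sets[OF V])
  have "(\<integral>\<^sup>+ q. indicator {c} q \<partial>V) \<le> ennreal B * (\<integral>\<^sup>+ q. indicator {c} q \<partial>lborel)"
  proof -
    have "(indicator {c} :: real \<times> real \<Rightarrow> ennreal) \<in> borel_measurable borel" by measurable
    with V show ?thesis unfolding tame_def by blast
  qed
  moreover have "{c} \<in> sets V" by simp
  ultimately have "emeasure V {c} = 0" by simp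
  then show ?thesis by (intro AE_I[of _ _ "{c}"]) auto
qed

text \<open>The constant \<open>K\<close> may blow up as \<open>l\<close> tends to 0, as ln (1/l)
  does below. So \<open>l\<close> is fixed first, to make C l small, and only then the increment is
  taken small compared with 1 / K.\<close>

lemma has_real_derivativeI_remainder:
  fixes g :: "real \<Rightarrow> real"
  assumes e: "0 < e" and C: "0 \<le> C"
    and rem: "\<And>l. 0 < l \<Longrightarrow> l \<le> 1 \<Longrightarrow> \<exists>K. \<forall>h. \<bar>h\<bar> < e \<longrightarrow> \<bar>g (x + h) - g x - h * A\<bar> \<le> \<bar>h\<bar> * (C * l + \<bar>h\<bar> * K)"
  shows "(g has_real_derivative A) (at x)"
  unfolding DERIV_def LIM_def
proof (intro allI impI)
  fix r :: real assume r: "0 < r"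
  define l where "l = min 1 (r / (2 * (C + 1)))"
  have l: "0 < l" "l \<le> 1" "C * l \<le> r / 2"
  proof -
    show "0 < l" "l \<le> 1" using r C by (auto simp: l_def)
    have "C * l \<le> (C + 1) * (r / (2 * (C + 1)))" using C r by (intro mult_mono) (auto simp: l_def)
    moreover have "D * (r / (2 * D)) = r / 2" if "0 < D" for D using that by simp
    from this[of "C + 1"] have "(C + 1) * (r / (2 * (C + 1))) = r / 2" using C by simp
    ultimately show "C * l \<le> r / 2" by linarith
  qed
  obtain K where K: "\<And>h. \<bar>h\<bar> < e \<Longrightarrow> \<bar>g (x + h) - g x - h * A\<bar> \<le> \<bar>h\<bar> * (C * l + \<bar>h\<bar> * K)"
    using rem[OF l(1,2)] by blast
  define s where "s = min e (r / (2 * (\<bar>K\<bar> + 1)))"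
  have s: "0 < s" using e r by (auto simp: s_def)
  show "\<exists>s>0. \<forall>h. h \<noteq> 0 \<and> dist h 0 < s \<longrightarrow> dist ((g (x + h) - g x) / h) A < r"
  proof (intro exI[of _ s] conjI s allI impI)
    fix h :: real assume h: "h \<noteq> 0 \<and> dist h 0 < s"
    then have h': "h \<noteq> 0" "\<bar>h\<bar> < e" "\<bar>h\<bar> < r / (2 * (\<bar>K\<bar> + 1))" by (auto simp: s_def dist_real_def)
    have "\<bar>h\<bar> * K \<le> \<bar>h\<bar> * (\<bar>K\<bar> + 1)" by (intro mult_left_mono) auto
    also have "\<dots> < r / (2 * (\<bar>K\<bar> + 1)) * (\<bar>K\<bar> + 1)" using h' by (intro mult_strict_right_mono) auto
    also have "\<dots> = r / 2" by (simp add: field_simps)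
    finally have 1: "C * l + \<bar>h\<bar> * K < r" using l by linarith
    have "dist ((g (x + h) - g x) / h) A = \<bar>g (x + h) - g x - h * A\<bar> / \<bar>h\<bar>"
      using h' by (simp add: dist_real_def abs_divide[symmetric] diff_divide_distrib)
    also have "\<dots> \<le> C * l + \<bar>h\<bar> * K"
      using K[OF h'(2)] h' by (simp add: pos_divide_le_eq mult.commute)
    finally show "dist ((g (x + h) - g x) / h) A < r" using 1 by simp
  qed
qed

lemma AE_lborel_fst_neq: "AE q in (lborel :: (real \<times> real) measure). fst q \<noteq> c"
proof (rule AE_I[of _ _ "{c} \<times> UNIV"])
  show "emeasure lborel ({c} \<times> (UNIV :: real set)) = 0"
    by (simp add: lborel_prod[symmetric] lborel.emeasure_pair_measure_Times)
  show "{c} \<times> (UNIV :: real set) \<in> sets lborel" by (simp add: lborel_prod[symmetric])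
qed auto


section \<open>The Biot-Savart law for bounded vorticity of finite mass\<close>

locale tame_density =
  fixes h :: "real \<times> real \<Rightarrow> real" and B M :: real
  assumes h_measurable [measurable]: "h \<in> borel_measurable borel"
    and h_support: "\<And>q. q \<notin> open_halfplane \<Longrightarrow> h q = 0"
    and h_tame: "tame (density lborel (\<lambda>q. ennreal \<bar>h q\<bar>)) B M"
begin

abbreviation "V \<equiv> density lborel (\<lambda>q. ennreal \<bar>h q\<bar>)"

lemma AE_V: "AE q in V. q \<in> open_halfplane"
  using h_support by (subst AE_density) (simp, intro AE_I2, force)

lemma weight_integrable:
  assumes [measurable]: "g \<in> borel_measurable borel"
    and g: "\<And>q. 0 < fst q \<Longrightarrow> q \<noteq> p \<Longrightarrow> \<bar>g q\<bar> \<le> c + d / dist p q" and "0 \<le> c" "0 \<le> d"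
  shows "integrable lborel (\<lambda>q. g q * h q)"
proof (rule integrableI_bounded)
  have "(\<integral>\<^sup>+ q. ennreal (norm (g q * h q)) \<partial>lborel) = (\<integral>\<^sup>+ q. ennreal \<bar>g q\<bar> \<partial>V)"
    by (subst nn_integral_density) (auto simp: abs_mult ennreal_mult mult.commute)
  also have "\<dots> \<le> (\<integral>\<^sup>+ q. ennreal c + ennreal d * ennreal (1 / dist p q) \<partial>V)"
  proof (rule nn_integral_mono_AE)
    show "AE q in V. ennreal \<bar>g q\<bar> \<le> ennreal c + ennreal d * ennreal (1 / dist p q)"
      using AE_V tame_AE_neq[OF h_tame, of p]
    proof eventually_elim
      case (elim q)
      have "ennreal \<bar>g q\<bar> \<le> ennreal (c + d * (1 / dist p q))"
        using g[of q] elim by (intro ennreal_leI) (auto simp: open_halfplane_def)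
      then show ?case using assms(3,4) by (simp add: ennreal_mult[symmetric])
    qed
  qed
  also have "\<dots> = ennreal c * emeasure V UNIV + ennreal d * (\<integral>\<^sup>+ q. ennreal (1 / dist p q) \<partial>V)"
    by (subst nn_integral_add, simp, simp, subst nn_integral_cmult) (auto simp: nn_integral_const)
  also have "\<dots> \<le> ennreal c * ennreal M + ennreal d * ennreal (2 * pi * B + M)"
    using h_tame by (intro add_mono mult_left_mono tame_dist_le_inverse) (auto simp: tame_def)
  also have "\<dots> < \<infinity>" by (simp add: ennreal_mult_less_top)
  finally show "(\<integral>\<^sup>+ q. ennreal (norm (g q * h q)) \<partial>lborel) < \<infinity>" .
qed simp

lemma measurable_kern_snd [measurable]:
  assumes "admissible N" shows "(\<lambda>q. kern N p q) \<in> borel_measurable borel"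
proof -
  have "(\<lambda>q. (p, q)) \<in> borel \<rightarrow>\<^sub>M borel" by (intro borel_measurable_continuous_onI continuous_intros)
  from measurable_compose[OF this borel_measurable_kern[OF assms]] show ?thesis by simp
qed

lemma measurable_pot_snd [measurable]: "(\<lambda>q. pot p q) \<in> borel_measurable borel"
proof -
  have "(\<lambda>q. (p, q)) \<in> borel \<rightarrow>\<^sub>M borel" by (intro borel_measurable_continuous_onI continuous_intros)
  from measurable_compose[OF this borel_measurable_pot] show ?thesis by simp
qed

lemma kern_integrable:
  assumes "admissible N" "0 \<le> fst p"
  shows "integrable lborel (\<lambda>q. kern N p q * h q)"
  using assms kern_abs_le[OF assms] by (intro weight_integrable[of _ p 0 10]) auto

lemma pot_integrable:
  assumes "0 \<le> fst p"
  shows "integrable lborel (\<lambda>q. pot p q * h q)"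
  using assms pot_abs_le[OF assms]
  by (intro weight_integrable[of _ p pi "pi * fst p"]) (auto simp: distrib_left)

definition potential :: "real \<times> real \<Rightarrow> real" where
  "potential p = (\<integral>q. pot p q * h q \<partial>lborel)"

lemma potential_remainder:
  assumes a: "0 \<le> fst a" and b: "0 \<le> fst b" and l: "0 < l" "l \<le> 1"
  shows "\<bar>potential b - potential a - ((fst b - fst a) * (\<integral>q. kern num_a a q * h q \<partial>lborel) + (snd b - snd a) * (\<integral>q. kern num_r a q * h q \<partial>lborel))\<bar>
    \<le> 160 * dist a b * (2 * pi * B * l + dist a b * (2 * pi * B * ln (1 / l) + M))"
proof -
  let ?d = "dist a b"
  let ?f = "\<lambda>q. pot b q - pot a q - ((fst b - fst a) * kern num_a a q + (snd b - snd a) * kern num_r a q)"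
  let ?I = "2 * pi * B * l + ?d * (2 * pi * B * ln (1 / l) + M)"
  have I: "0 \<le> ?I" using tame_nonneg[OF h_tame] l by (simp add: add_nonneg_nonneg)
  note i = kern_integrable[OF admissible_num_a a] kern_integrable[OF admissible_num_r a]
    pot_integrable[OF a] pot_integrable[OF b]
  note [measurable] = measurable_kern_snd[OF admissible_num_a] measurable_kern_snd[OF admissible_num_r]
  have fe: "?f q * h q = pot b q * h q - pot a q * h q - ((fst b - fst a) * (kern num_a a q * h q) + (snd b - snd a) * (kern num_r a q * h q))" for q
    by (simp add: algebra_simps)
  have fi: "integrable lborel (\<lambda>q. ?f q * h q)"
    unfolding fe by (intro Bochner_Integration.integrable_diff Bochner_Integration.integrable_add integrable_mult_right i)
  have "(\<integral>q. ?f q * h q \<partial>lborel) = potential b - potential a - ((fst b - fst a) * (\<integral>q. kern num_a a q * h q \<partial>lborel) + (snd b - snd a) * (\<integral>q. kern num_r a q * h q \<partial>lborel))"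
    unfolding fe potential_def using i by simp
  moreover have "ennreal (norm (\<integral>q. ?f q * h q \<partial>lborel)) \<le> ennreal (160 * ?d * ?I)"
  proof -
    have "ennreal (norm (\<integral>q. ?f q * h q \<partial>lborel)) \<le> (\<integral>\<^sup>+ q. ennreal (norm (?f q * h q)) \<partial>lborel)"
      by (rule integral_norm_bound_ennreal[OF fi])
    also have "\<dots> = (\<integral>\<^sup>+ q. ennreal \<bar>?f q\<bar> \<partial>V)"
      by (subst nn_integral_density) (auto simp: abs_mult ennreal_mult mult.commute)
    also have "\<dots> \<le> (\<integral>\<^sup>+ q. ennreal (80 * ?d) * (ennreal (kernel_bound ?d (dist a q)) + ennreal (kernel_bound ?d (dist b q))) \<partial>V)"
    proof (rule nn_integral_mono_AE)
      show "AE q in V. ennreal \<bar>?f q\<bar> \<le> ennreal (80 * ?d) * (ennreal (kernel_bound ?d (dist a q)) + ennreal (kernel_bound ?d (dist b q)))"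
        using AE_V tame_AE_neq[OF h_tame, of a] tame_AE_neq[OF h_tame, of b]
      proof eventually_elim
        case (elim q)
        then have "\<bar>?f q\<bar> \<le> 80 * ?d * (kernel_bound ?d (dist a q) + kernel_bound ?d (dist b q))"
          by (intro pot_remainder a b) (auto simp: open_halfplane_def)
        then have "ennreal \<bar>?f q\<bar> \<le> ennreal (80 * ?d * (kernel_bound ?d (dist a q) + kernel_bound ?d (dist b q)))"
          by (rule ennreal_leI)
        then show ?case
          by (simp only: ennreal_mult ennreal_plus kernel_bound_nonneg zero_le_dist mult_nonneg_nonneg add_nonneg_nonneg zero_le_numeral)
      qed
    qed
    also have "\<dots> = ennreal (80 * ?d) * ((\<integral>\<^sup>+ q. ennreal (kernel_bound ?d (dist a q)) \<partial>V) + (\<integral>\<^sup>+ q. ennreal (kernel_bound ?d (dist b q)) \<partial>V))"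
      unfolding kernel_bound_def by (subst nn_integral_cmult, simp, subst nn_integral_add) auto
    also have "\<dots> \<le> ennreal (80 * ?d) * (ennreal ?I + ennreal ?I)"
      by (intro mult_left_mono add_mono tame_kernel_bound_le[OF h_tame] l) auto
    also have "\<dots> = ennreal (160 * ?d * ?I)"
    proof -
      have "ennreal (80 * ?d) * (ennreal x + ennreal x) = ennreal (160 * ?d * x)" if "0 \<le> x" for x
        using that by (simp add: ennreal_plus[symmetric] ennreal_mult[symmetric] del: ennreal_plus)
      from this[OF I] show ?thesis .
    qed
    finally show ?thesis .
  qed
  ultimately show ?thesis
    using I by (simp add: ennreal_le_iff)
qed

lemma potential_has_derivative:
  assumes r: "0 < r"
  shows "((\<lambda>r. potential (r, z)) has_real_derivative (\<integral>q. kern num_a (r, z) q * h q \<partial>lborel)) (at r)"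
    and "((\<lambda>z. potential (r, z)) has_real_derivative (\<integral>q. kern num_r (r, z) q * h q \<partial>lborel)) (at z)"
proof -
  have C: "0 \<le> 320 * pi * B" using tame_nonneg[OF h_tame] by simp
  show "((\<lambda>r. potential (r, z)) has_real_derivative (\<integral>q. kern num_a (r, z) q * h q \<partial>lborel)) (at r)"
  \<comment> \<open>Increments below \<open>r\<close> keep the displaced point in the half plane, as
    \<open>potential_remainder\<close> requires.\<close>
  proof (rule has_real_derivativeI_remainder[OF r C], intro exI allI impI)
    fix l h' :: real assume "0 < l" "l \<le> 1" "\<bar>h'\<bar> < r"
    then show "\<bar>potential (r + h', z) - potential (r, z) - h' * (\<integral>q. kern num_a (r, z) q * h q \<partial>lborel)\<bar>
        \<le> \<bar>h'\<bar> * (320 * pi * B * l + \<bar>h'\<bar> * (160 * (2 * pi * B * ln (1 / l) + M)))"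
      using potential_remainder[of "(r, z)" "(r + h', z)" l] r
      by (simp add: dist_Pair_Pair dist_real_def algebra_simps)
  qed
  show "((\<lambda>z. potential (r, z)) has_real_derivative (\<integral>q. kern num_r (r, z) q * h q \<partial>lborel)) (at z)"
  proof (rule has_real_derivativeI_remainder[OF r C], intro exI allI impI)
    fix l h' :: real assume "0 < l" "l \<le> 1" "\<bar>h'\<bar> < r"
    then show "\<bar>potential (r, z + h') - potential (r, z) - h' * (\<integral>q. kern num_r (r, z) q * h q \<partial>lborel)\<bar>
        \<le> \<bar>h'\<bar> * (320 * pi * B * l + \<bar>h'\<bar> * (160 * (2 * pi * B * ln (1 / l) + M)))"
      using potential_remainder[of "(r, z)" "(r, z + h')" l] r
      by (simp add: dist_Pair_Pair dist_real_def algebra_simps)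
  qed
qed

lemma stream_eq_potential:
  assumes f: "\<And>q. q \<in> open_halfplane \<Longrightarrow> f q = h q" and r: "0 < r"
  shows "stream f r z = r / (2 * pi) * potential (r, z)"
proof -
  have "(LINT (r', z'):halfplane|lborel. sqrt (r * r') * kernel_F (((r - r')\<^sup>2 + (z - z')\<^sup>2) / (r * r')) * f (r', z'))
      = (\<integral>q. r * (pot (r, z) q * h q) \<partial>lborel)"
    unfolding set_lebesgue_integral_def
  proof (rule integral_cong_AE)
    let ?g = "\<lambda>q. indicat_real halfplane q *\<^sub>R (case q of (r', z') \<Rightarrow> sqrt (r * r') * kernel_F (((r - r')\<^sup>2 + (z - z')\<^sup>2) / (r * r')) * f (r', z'))"
    have eq: "?g q = r * (pot (r, z) q * h q)" if "q \<noteq> (r, z)" for q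
    proof (cases "0 < fst q")
      case True
      then show ?thesis
        using stream_kernel_eq[of "(r, z)" q] f[of q] r that
        by (cases q) (auto simp: halfplane_def open_halfplane_def)
    next
      case False
      then show ?thesis using h_support[of q] by (cases q) (auto simp: halfplane_def open_halfplane_def not_less le_less)
    qed
    show "AE q in lborel. ?g q = r * (pot (r, z) q * h q)"
      using AE_lborel_fst_neq[of r] by eventually_elim (rule eq, auto)
    \<comment> \<open>Nothing is known about \<open>kernel_F\<close> as a measurable function, so
      measurability is read off from the identity with \<open>pot\<close>, which can fail only at
      the point (r, z).\<close>
    have "?g = (\<lambda>q. if q = (r, z) then ?g (r, z) else r * (pot (r, z) q * h q))"
      using eq by (intro ext) auto
    moreover have "(\<lambda>q. if q = (r, z) then ?g (r, z) else r * (pot (r, z) q * h q)) \<in> borel_measurable lborel"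
      by measurable
    ultimately show "?g \<in> borel_measurable lborel" by (simp only:)
  qed simp
  then show ?thesis unfolding stream_def potential_def by simp
qed

lemma velocity_eq:
  assumes f: "\<And>q. q \<in> open_halfplane \<Longrightarrow> f q = h q" and p: "p \<in> open_halfplane"
  shows "velocity f p = (1 / (2 * pi) * (\<integral>q. kern num_r p q * h q \<partial>lborel), 1 / (2 * pi) * (\<integral>q. kern num_z p q * h q \<partial>lborel))"
proof -
  obtain r z where pz: "p = (r, z)" and r: "0 < r" using p by (cases p) (auto simp: open_halfplane_def)
  have "((\<lambda>z. stream f r z) has_real_derivative r / (2 * pi) * (\<integral>q. kern num_r (r, z) q * h q \<partial>lborel)) (at z)"
  proof -
    have s: "(\<lambda>z. stream f r z) = (\<lambda>z. r / (2 * pi) * potential (r, z))"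
      using stream_eq_potential[OF f r] by (intro ext)
    show ?thesis unfolding s by (intro DERIV_cmult potential_has_derivative r)
  qed
  then have 1: "deriv (\<lambda>z. stream f r z) z = r / (2 * pi) * (\<integral>q. kern num_r (r, z) q * h q \<partial>lborel)"
    by (rule DERIV_imp_deriv)
  have "((\<lambda>r. r / (2 * pi) * potential (r, z)) has_real_derivative
      r / (2 * pi) * (\<integral>q. kern num_a (r, z) q * h q \<partial>lborel) + 1 / (2 * pi) * potential (r, z)) (at r)"
    using DERIV_mult[OF DERIV_cdivide[OF DERIV_ident, of "2 * pi"] potential_has_derivative(1)[OF r, of z]]
    by (simp add: ac_simps)
  then have "((\<lambda>r. stream f r z) has_real_derivative
      r / (2 * pi) * (\<integral>q. kern num_a (r, z) q * h q \<partial>lborel) + 1 / (2 * pi) * potential (r, z)) (at r)"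
    by (rule has_field_derivative_transform_within_open[of _ _ _ "{0<..}"]) (auto simp: r stream_eq_potential[OF f])
  then have "deriv (\<lambda>r. stream f r z) r = r / (2 * pi) * (\<integral>q. kern num_a (r, z) q * h q \<partial>lborel) + 1 / (2 * pi) * potential (r, z)"
    by (rule DERIV_imp_deriv)
  then have 2: "- deriv (\<lambda>r. stream f r z) r / r = 1 / (2 * pi) * (- (\<integral>q. kern num_a (r, z) q * h q \<partial>lborel) - potential (r, z) / r)"
    using r by (simp add: field_simps)
  have "(\<integral>q. kern num_a (r, z) q * h q \<partial>lborel) + potential (r, z) / r
      = (\<integral>q. kern num_a (r, z) q * h q + (pot (r, z) q * h q) / r \<partial>lborel)"
    unfolding potential_def
    using kern_integrable[OF admissible_num_a, of "(r, z)"] pot_integrable[of "(r, z)"] r by simp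
  also have "\<dots> = (\<integral>q. - (kern num_z (r, z) q * h q) \<partial>lborel)"
  proof (rule integral_cong_AE)
    show "AE q in lborel. kern num_a (r, z) q * h q + (pot (r, z) q * h q) / r = - (kern num_z (r, z) q * h q)"
      using AE_lborel_fst_neq[of r]
    proof eventually_elim
      case (elim q)
      show ?case
      proof (cases "q \<in> open_halfplane")
        case True
        then have "kern num_a (r, z) q + pot (r, z) q / r = - kern num_z (r, z) q"
          using kern_num_a_pot[of "(r, z)" q] r elim by (auto simp: open_halfplane_def)
        then have "(kern num_a (r, z) q + pot (r, z) q / r) * h q = - kern num_z (r, z) q * h q"
          by (simp only:)
        then show ?thesis by (simp add: distrib_right)
      qed (simp add: h_support)
    qed
  qed (use measurable_kern_snd[OF admissible_num_a] measurable_kern_snd[OF admissible_num_z] in measurable)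
  finally have "- (\<integral>q. kern num_a (r, z) q * h q \<partial>lborel) - potential (r, z) / r = (\<integral>q. kern num_z (r, z) q * h q \<partial>lborel)"
    by simp
  then show ?thesis
    using 1 2 r by (simp add: velocity_def pz)
qed

end

subsection \<open>Uniqueness of Lagrangian flows\<close>

text \<open>The derivative bound makes almost every trajectory K-Lipschitz, so difference quotients
  are dominated by a constant on a finite measure; no continuity of f' in time is needed. The same
  Lipschitz bound carries integrability from time 0 to time t.\<close>

lemma has_derivative_integral_bounded:
  fixes f f' :: "real \<Rightarrow> 'a \<Rightarrow> real"
  assumes W: "finite_measure W" and T: "0 \<le> T" and t: "t \<in> {0..T}"
    and fm [measurable]: "\<And>s. s \<in> {0..T} \<Longrightarrow> f s \<in> borel_measurable W"
    and f'm [measurable]: "f' t \<in> borel_measurable W"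
    and der: "AE p in W. \<forall>s\<in>{0..T}. ((\<lambda>s. f s p) has_real_derivative f' s p) (at s within {0..T}) \<and> \<bar>f' s p\<bar> \<le> K"
    and f0: "integrable W (f 0)"
  shows "((\<lambda>s. \<integral>p. f s p \<partial>W) has_real_derivative (\<integral>p. f' t p \<partial>W)) (at t within {0..T})"
    and "integrable W (f t)"
proof -
  interpret finite_measure W by fact
  have lip: "AE p in W. \<forall>s\<in>{0..T}. \<forall>u\<in>{0..T}. \<bar>f s p - f u p\<bar> \<le> K * \<bar>s - u\<bar>"
    using der
  proof eventually_elim
    case (elim p)
    then show ?case
      using field_differentiable_bound[of "{0..T}" "\<lambda>s. f s p" "\<lambda>s. f' s p" K] by auto
  qed
  have int: "integrable W (f s)" if s: "s \<in> {0..T}" for s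
  proof -
    have "integrable W (\<lambda>p. f s p - f 0 p)"
    proof (rule integrable_const_bound)
      show "AE p in W. norm (f s p - f 0 p) \<le> K * \<bar>s\<bar>"
        using lip by eventually_elim (use s T in force)
      have "0 \<in> {0..T}" using T by simp
      then show "(\<lambda>p. f s p - f 0 p) \<in> borel_measurable W" using s by measurable
    qed
    from Bochner_Integration.integrable_add[OF this f0] show ?thesis by simp
  qed
  then show "integrable W (f t)" using t .
  show "((\<lambda>s. \<integral>p. f s p \<partial>W) has_real_derivative (\<integral>p. f' t p \<partial>W)) (at t within {0..T})"
    unfolding has_field_derivative_iff tendsto_at_iff_sequentially
  proof (intro allI impI)
    fix X :: "nat \<Rightarrow> real" assume X: "\<forall>i. X i \<in> {0..T} - {t}" "X \<longlonglongrightarrow> t"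
    have "(\<lambda>i. \<integral>p. (f (X i) p - f t p) / (X i - t) \<partial>W) \<longlonglongrightarrow> (\<integral>p. f' t p \<partial>W)"
    proof (rule integral_dominated_convergence)
      show "AE p in W. (\<lambda>i. (f (X i) p - f t p) / (X i - t)) \<longlonglongrightarrow> f' t p"
        using der
      proof eventually_elim
        case (elim p)
        then have "((\<lambda>y. (f y p - f t p) / (y - t)) \<longlongrightarrow> f' t p) (at t within {0..T})"
          using t by (auto simp: has_field_derivative_iff)
        then show ?case
          using X unfolding tendsto_at_iff_sequentially comp_def by blast
      qed
      show "AE p in W. norm ((f (X i) p - f t p) / (X i - t)) \<le> K" for i
        using lip
      proof eventually_elim
        case (elim p)
        have "X i \<noteq> t" "X i \<in> {0..T}" using X by auto
        then show ?case using elim t by (simp add: pos_divide_le_eq)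
      qed
      show "(\<lambda>p. (f (X i) p - f t p) / (X i - t)) \<in> borel_measurable W" for i
        using X by (intro borel_measurable_divide borel_measurable_diff borel_measurable_const fm t) auto
    qed (use f'm in auto)
    moreover have "(\<lambda>i. \<integral>p. (f (X i) p - f t p) / (X i - t) \<partial>W) = (\<lambda>i. ((\<integral>p. f (X i) p \<partial>W) - (\<integral>p. f t p \<partial>W)) / (X i - t))"
      using X int[OF t] by (intro ext) (simp add: int)
    ultimately show "((\<lambda>y. ((\<integral>p. f y p \<partial>W) - (\<integral>p. f t p \<partial>W)) / (y - t)) \<circ> X) \<longlonglongrightarrow> (\<integral>p. f' t p \<partial>W)"
      by (simp only: comp_def)
  qed
qed

lemma measurable_kern_pair [measurable (raw)]:
  assumes N: "admissible N" and [measurable]: "f \<in> S \<rightarrow>\<^sub>M borel" "g \<in> S \<rightarrow>\<^sub>M borel"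
  shows "(\<lambda>x. kern N (f x) (g x)) \<in> borel_measurable S"
proof -
  have "(\<lambda>x. (f x, g x)) \<in> S \<rightarrow>\<^sub>M borel \<Otimes>\<^sub>M borel" by measurable
  then have "(\<lambda>x. (f x, g x)) \<in> S \<rightarrow>\<^sub>M borel" unfolding borel_prod .
  from measurable_compose[OF this borel_measurable_kern[OF N]] show ?thesis by simp
qed

text \<open>The Biot-Savart velocity at \<open>p\<close>, up to the choice of component
  \<open>N\<close>, of the vorticity that \<open>Y\<close> transports: the label \<open>q\<close>
  carries the signed mass s W and now sits at \<open>Y q\<close>.\<close>

definition lagrangian_velocity ::
    "(real \<times> real) measure \<Rightarrow> (real \<times> real \<Rightarrow> real) \<Rightarrow> (real \<times> real \<Rightarrow> real \<times> real \<Rightarrow> real \<Rightarrow> real) \<Rightarrow>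
      (real \<times> real \<Rightarrow> real \<times> real) \<Rightarrow> real \<times> real \<Rightarrow> real" where
  "lagrangian_velocity W s N Y p = 1 / (2 * pi) * (\<integral>q. s q * kern N p (Y q) \<partial>W)"

text \<open>The vorticity is eliminated, leaving a closed equation for the flow alone. Uniqueness
  thus compares two maps with the same \<open>W\<close> and \<open>s\<close>.\<close>

definition lagrangian_flow ::
    "(real \<times> real) measure \<Rightarrow> (real \<times> real \<Rightarrow> real) \<Rightarrow> real \<Rightarrow> real \<Rightarrow> real \<Rightarrow> (real \<Rightarrow> real \<times> real \<Rightarrow> real \<times> real) \<Rightarrow> bool" where
  "lagrangian_flow W s B M T X \<longleftrightarrow>
     (\<forall>t\<in>{0..T}. X t \<in> borel_measurable borel \<and> tame (distr W borel (X t)) B M \<and>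
        (\<forall>p\<in>open_halfplane. X t p \<in> open_halfplane \<and>
          ((\<lambda>u. fst (X u p)) has_real_derivative lagrangian_velocity W s num_r (X t) (X t p)) (at t within {0..T}) \<and>
          ((\<lambda>u. snd (X u p)) has_real_derivative lagrangian_velocity W s num_z (X t) (X t p)) (at t within {0..T})))"

locale signed_measure =
  fixes W :: "(real \<times> real) measure" and s :: "real \<times> real \<Rightarrow> real"
  assumes sets_W [measurable_cong]: "sets W = sets borel"
    and s_measurable [measurable]: "s \<in> borel_measurable borel"
    and s_abs: "\<And>q. \<bar>s q\<bar> \<le> 1"
    and AE_W: "AE q in W. q \<in> open_halfplane"
    and finite_W: "finite_measure W"
begin

lemma space_W [simp]: "space W = UNIV"
  using sets_eq_imp_space_eq[OF sets_W] by simp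

lemma mass_le:
  assumes "tame (distr W borel Y) B M" "Y \<in> borel_measurable borel"
  shows "emeasure W UNIV \<le> ennreal M"
  using assms by (auto simp: tame_def emeasure_distr)

lemma AE_neq:
  assumes V: "tame (distr W borel Y) B M" and [measurable]: "Y \<in> borel_measurable borel"
  shows "AE q in W. Y q \<noteq> c"
  using tame_AE_neq[OF V, of c] by (subst (asm) AE_distr_iff) auto

lemma kern_integral_le:
  assumes V: "tame (distr W borel Y) B M" and Y [measurable]: "Y \<in> borel_measurable borel"
    and Yh: "\<And>q. q \<in> open_halfplane \<Longrightarrow> Y q \<in> open_halfplane"
    and N: "admissible N" and p: "p \<in> open_halfplane"
  shows "(\<integral>\<^sup>+ q. ennreal \<bar>kern N p (Y q)\<bar> \<partial>W) \<le> ennreal (10 * (2 * pi * B + M))"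
proof -
  have "(\<integral>\<^sup>+ q. ennreal \<bar>kern N p (Y q)\<bar> \<partial>W) \<le> (\<integral>\<^sup>+ q. ennreal 10 * ennreal (1 / dist p (Y q)) \<partial>W)"
  proof (rule nn_integral_mono_AE)
    show "AE q in W. ennreal \<bar>kern N p (Y q)\<bar> \<le> ennreal 10 * ennreal (1 / dist p (Y q))"
      using AE_W AE_neq[OF V Y, of p]
    proof eventually_elim
      case (elim q)
      then have "\<bar>kern N p (Y q)\<bar> \<le> 10 / dist p (Y q)"
        using Yh[of q] p by (intro kern_abs_le N) (auto simp: open_halfplane_def)
      then show ?case by (simp only: ennreal_mult[symmetric] zero_le_numeral zero_le_divide_1_iff zero_le_dist) (simp add: ennreal_leI)
    qed
  qed
  also have "\<dots> = ennreal 10 * (\<integral>\<^sup>+ q. ennreal (1 / dist p q) \<partial>distr W borel Y)"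
    by (subst nn_integral_cmult, measurable, subst nn_integral_distr) auto
  also have "\<dots> \<le> ennreal 10 * ennreal (2 * pi * B + M)"
    by (intro mult_left_mono tame_dist_le_inverse[OF V]) auto
  also have "\<dots> = ennreal (10 * (2 * pi * B + M))"
    using tame_nonneg[OF V] by (subst ennreal_mult[symmetric]) auto
  finally show ?thesis .
qed

lemma kern_integrable:
  assumes V: "tame (distr W borel Y) B M" and Y [measurable]: "Y \<in> borel_measurable borel"
    and Yh: "\<And>q. q \<in> open_halfplane \<Longrightarrow> Y q \<in> open_halfplane"
    and N: "admissible N" and p: "p \<in> open_halfplane"
  shows "integrable W (\<lambda>q. s q * kern N p (Y q))"
proof (rule integrableI_bounded)
  note [measurable] = measurable_kern_pair[OF N]
  show "(\<lambda>q. s q * kern N p (Y q)) \<in> borel_measurable W" by measurable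
  have "(\<integral>\<^sup>+ q. ennreal (norm (s q * kern N p (Y q))) \<partial>W) \<le> (\<integral>\<^sup>+ q. ennreal \<bar>kern N p (Y q)\<bar> \<partial>W)"
    using s_abs by (intro nn_integral_mono ennreal_leI) (auto simp: abs_mult intro: mult_left_le_one_le)
  also have "\<dots> < \<infinity>"
    unfolding infinity_ennreal_def by (rule le_less_trans[OF kern_integral_le[OF assms] ennreal_less_top])
  finally show "(\<integral>\<^sup>+ q. ennreal (norm (s q * kern N p (Y q))) \<partial>W) < \<infinity>" .
qed

lemma velocity_abs_le:
  assumes V: "tame (distr W borel Y) B M" and Y [measurable]: "Y \<in> borel_measurable borel"
    and Yh: "\<And>q. q \<in> open_halfplane \<Longrightarrow> Y q \<in> open_halfplane"
    and N: "admissible N" and p: "p \<in> open_halfplane"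
  shows "\<bar>lagrangian_velocity W s N Y p\<bar> \<le> 10 * (2 * pi * B + M)"
proof -
  have "ennreal (norm (\<integral>q. s q * kern N p (Y q) \<partial>W)) \<le> (\<integral>\<^sup>+ q. ennreal (norm (s q * kern N p (Y q))) \<partial>W)"
    by (rule integral_norm_bound_ennreal[OF kern_integrable[OF assms]])
  also have "\<dots> \<le> (\<integral>\<^sup>+ q. ennreal \<bar>kern N p (Y q)\<bar> \<partial>W)"
    using s_abs by (intro nn_integral_mono ennreal_leI) (auto simp: abs_mult intro: mult_left_le_one_le)
  also have "\<dots> \<le> ennreal (10 * (2 * pi * B + M))"
    by (rule kern_integral_le[OF assms])
  finally have *: "\<bar>\<integral>q. s q * kern N p (Y q) \<partial>W\<bar> \<le> 10 * (2 * pi * B + M)"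
    using tame_nonneg[OF V] by (subst (asm) ennreal_le_iff) auto
  have "1 / (2 * pi) \<le> 1" using pi_ge_two by simp
  then have "1 / (2 * pi) * \<bar>\<integral>q. s q * kern N p (Y q) \<partial>W\<bar> \<le> 1 * \<bar>\<integral>q. s q * kern N p (Y q) \<partial>W\<bar>"
    by (intro mult_right_mono) auto
  with * show ?thesis by (simp add: lagrangian_velocity_def abs_mult)
qed

end

text \<open>Made to dominate c times \<open>kernel_bound\<close> while containing only squares of
  the displacements c and d of two particles: close to the pole c \<le> (c^2 / l + l) / 2, far from
  it a product of displacements is at most c^2 + d^2. Its double integral is then controlled by the
  mean square displacement.\<close>

definition pair_weight :: "real \<Rightarrow> real \<Rightarrow> real \<Rightarrow> real \<Rightarrow> real" where
  "pair_weight l c d x = (c\<^sup>2 / l + l) / 2 * (if x < l then 1 / x else 0) + (c\<^sup>2 + d\<^sup>2) * (if l \<le> x then 1 / x\<^sup>2 else 0)"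

lemma pair_weight_nonneg: "0 < l \<Longrightarrow> 0 \<le> x \<Longrightarrow> 0 \<le> pair_weight l c d x"
  unfolding pair_weight_def by (intro add_nonneg_nonneg mult_nonneg_nonneg) auto

lemma kernel_bound_le_pair_weight:
  assumes c: "0 \<le> c" and d: "0 \<le> d" and l: "0 < l" and x: "0 < x" and e: "e = c \<or> e = d"
  shows "c * kernel_bound e x \<le> pair_weight l c d x"
proof (cases "x < l")
  case True
  have "c * kernel_bound e x \<le> c * (1 / x)"
    using c by (intro mult_left_mono) (auto simp: kernel_bound_def)
  also have "c \<le> (c\<^sup>2 / l + l) / 2"
  proof -
    have "2 * c * l \<le> c\<^sup>2 + l\<^sup>2" using sum_squares_bound[of c l] by simp
    then show ?thesis using l by (simp add: field_simps power2_eq_square)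
  qed
  finally show ?thesis using True x by (simp add: pair_weight_def divide_right_mono mult_right_mono)
next
  case False
  have "c * kernel_bound e x \<le> c * (e / x\<^sup>2)"
    using c by (intro mult_left_mono) (auto simp: kernel_bound_def)
  also have "\<dots> = (c * e) / x\<^sup>2" by simp
  also have "\<dots> \<le> (c\<^sup>2 + d\<^sup>2) / x\<^sup>2"
  proof (rule divide_right_mono)
    show "c * e \<le> c\<^sup>2 + d\<^sup>2"
      using e sum_squares_bound[of c d] mult_nonneg_nonneg[OF c d] by (auto simp: power2_eq_square)
  qed simp
  finally show ?thesis using False by (simp add: pair_weight_def)
qed

context signed_measure
begin

lemma pair_weight_integral_le:
  assumes VA: "tame (distr W borel A) B M" and A [measurable]: "A \<in> borel_measurable borel"
    and VC: "tame (distr W borel C) B M" and C [measurable]: "C \<in> borel_measurable borel"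
    and d [measurable]: "d \<in> borel_measurable borel" and e: "(\<integral>\<^sup>+ p. ennreal ((d p)\<^sup>2) \<partial>W) = ennreal e" "0 \<le> e"
    and l: "0 < l" "l \<le> 1"
  shows "(\<integral>\<^sup>+ p. \<integral>\<^sup>+ q. ennreal (pair_weight l (d p) (d q) (dist (A p) (C q))) \<partial>W \<partial>W)
    \<le> ennreal (pi * B * (e + l\<^sup>2 * M) + 2 * (2 * pi * B * ln (1 / l) + M) * e)"
proof -
  interpret finite_measure W by (rule finite_W)
  interpret pair_sigma_finite W W ..
  let ?g1 = "\<lambda>x. ennreal (if x < l then 1 / x else 0)" and ?g2 = "\<lambda>x. ennreal (if l \<le> x then 1 / x\<^sup>2 else 0)"
  let ?G = "2 * pi * B * ln (1 / l) + M"
  have ln: "0 \<le> ln (1 / l)" using l by simp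
  have G: "0 \<le> ?G" using tame_nonneg[OF VA] ln by simp
  have B: "0 \<le> B" "0 \<le> M" using tame_nonneg[OF VA] by auto
  have sp: "ennreal (pair_weight l (d p) (d q) x)
      = ennreal (((d p)\<^sup>2 / l + l) / 2) * ?g1 x + (ennreal ((d p)\<^sup>2) * ?g2 x + ennreal ((d q)\<^sup>2) * ?g2 x)" if "0 \<le> x" for p q x
    unfolding pair_weight_def distrib_right using l that
    by (subst ennreal_plus, simp, simp, subst ennreal_plus, simp, simp) (auto simp: ennreal_mult[symmetric])
  have i1: "(\<integral>\<^sup>+ q. ?g1 (dist c (C q)) \<partial>W) \<le> ennreal (B * (2 * pi * l))" for c
    using tame_singular_le[OF VC, of l c] l by (simp add: nn_integral_distr)
  have i2: "(\<integral>\<^sup>+ q. ?g2 (dist c (C q)) \<partial>W) \<le> ennreal ?G" for c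
    using tame_inverse_square_le[OF VC, of l c] l by (simp add: nn_integral_distr)
  have i3: "(\<integral>\<^sup>+ p. ?g2 (dist (A p) c) \<partial>W) \<le> ennreal ?G" for c
    using tame_inverse_square_le[OF VA, of l c] l unfolding dist_commute[of _ c] by (simp add: nn_integral_distr)
  have "(\<integral>\<^sup>+ p. \<integral>\<^sup>+ q. ennreal (pair_weight l (d p) (d q) (dist (A p) (C q))) \<partial>W \<partial>W)
      = (\<integral>\<^sup>+ p. ennreal (((d p)\<^sup>2 / l + l) / 2) * (\<integral>\<^sup>+ q. ?g1 (dist (A p) (C q)) \<partial>W)
          + (ennreal ((d p)\<^sup>2) * (\<integral>\<^sup>+ q. ?g2 (dist (A p) (C q)) \<partial>W)
          + (\<integral>\<^sup>+ q. ennreal ((d q)\<^sup>2) * ?g2 (dist (A p) (C q)) \<partial>W)) \<partial>W)"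
    unfolding sp[OF zero_le_dist]
    by (simp add: nn_integral_add nn_integral_cmult)
  also have "\<dots> \<le> (\<integral>\<^sup>+ p. ennreal (((d p)\<^sup>2 / l + l) / 2) * ennreal (B * (2 * pi * l))
          + (ennreal ((d p)\<^sup>2) * ennreal ?G
          + (\<integral>\<^sup>+ q. ennreal ((d q)\<^sup>2) * ?g2 (dist (A p) (C q)) \<partial>W)) \<partial>W)"
    by (intro nn_integral_mono add_mono mult_left_mono i1 i2) auto
  also have "\<dots> = (\<integral>\<^sup>+ p. ennreal (((d p)\<^sup>2 / l + l) / 2) \<partial>W) * ennreal (B * (2 * pi * l))
          + ((\<integral>\<^sup>+ p. ennreal ((d p)\<^sup>2) \<partial>W) * ennreal ?G
          + (\<integral>\<^sup>+ p. \<integral>\<^sup>+ q. ennreal ((d q)\<^sup>2) * ?g2 (dist (A p) (C q)) \<partial>W \<partial>W))"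
    by (simp add: nn_integral_add nn_integral_multc)
  \<comment> \<open>The displacement of \<open>q\<close> has to wait for the integral over
    \<open>p\<close>: only the latter, through tameness of the image under \<open>A\<close>,
    controls the singular factor uniformly.\<close>
  also have "(\<integral>\<^sup>+ p. \<integral>\<^sup>+ q. ennreal ((d q)\<^sup>2) * ?g2 (dist (A p) (C q)) \<partial>W \<partial>W)
      = (\<integral>\<^sup>+ q. \<integral>\<^sup>+ p. ennreal ((d q)\<^sup>2) * ?g2 (dist (A p) (C q)) \<partial>W \<partial>W)"
    by (rule Fubini') measurable
  also have "\<dots> = (\<integral>\<^sup>+ q. ennreal ((d q)\<^sup>2) * (\<integral>\<^sup>+ p. ?g2 (dist (A p) (C q)) \<partial>W) \<partial>W)"
    by (subst nn_integral_cmult) auto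
  also have "\<dots> \<le> (\<integral>\<^sup>+ q. ennreal ((d q)\<^sup>2) * ennreal ?G \<partial>W)"
    by (intro nn_integral_mono mult_left_mono i3) auto
  also have "\<dots> = ennreal e * ennreal ?G"
    by (subst nn_integral_multc) (auto simp: e)
  also have "(\<integral>\<^sup>+ p. ennreal (((d p)\<^sup>2 / l + l) / 2) \<partial>W) \<le> ennreal ((e / l + l * M) / 2)"
  proof -
    have "(\<integral>\<^sup>+ p. ennreal (((d p)\<^sup>2 / l + l) / 2) \<partial>W) = (\<integral>\<^sup>+ p. ennreal (1 / (2 * l)) * ennreal ((d p)\<^sup>2) + ennreal (l / 2) \<partial>W)"
      using l by (intro nn_integral_cong) (simp add: ennreal_mult[symmetric] ennreal_plus[symmetric] add_divide_distrib del: ennreal_plus)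
    also have "\<dots> = ennreal (1 / (2 * l)) * ennreal e + ennreal (l / 2) * emeasure W UNIV"
      by (simp add: nn_integral_add nn_integral_cmult e)
    also have "\<dots> \<le> ennreal (1 / (2 * l)) * ennreal e + ennreal (l / 2) * ennreal M"
      using mass_le[OF VA A] by (intro add_mono mult_left_mono) auto
    also have "\<dots> = ennreal ((e / l + l * M) / 2)"
      using l e B by (simp add: ennreal_mult[symmetric] ennreal_plus[symmetric] add_divide_distrib del: ennreal_plus)
    finally show ?thesis .
  qed
  finally have "(\<integral>\<^sup>+ p. \<integral>\<^sup>+ q. ennreal (pair_weight l (d p) (d q) (dist (A p) (C q))) \<partial>W \<partial>W)
     \<le> ennreal ((e / l + l * M) / 2) * ennreal (B * (2 * pi * l)) + (ennreal e * ennreal ?G + ennreal e * ennreal ?G)"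
    by (simp add: e add_mono mult_right_mono)
  also have "\<dots> = ennreal ((e / l + l * M) / 2 * (B * (2 * pi * l)) + (e * ?G + e * ?G))"
    using l e B G by (simp only: ennreal_mult[symmetric] ennreal_plus[symmetric] mult_nonneg_nonneg add_nonneg_nonneg divide_nonneg_nonneg pi_ge_zero zero_le_numeral less_imp_le)
  also have "(e / l + l * M) / 2 * (B * (2 * pi * l)) + (e * ?G + e * ?G) = pi * B * (e + l\<^sup>2 * M) + 2 * ?G * e"
    using l by (simp add: field_simps power2_eq_square)
  finally show ?thesis .
qed

text \<open>The weight \<open>dist (X p) (Y p)\<close> is the one appearing in the derivative of the
  mean square distance. The difference of kernels is telescoped through
  \<open>kern N (Y p) (X q)\<close>, so that each step moves one argument only.\<close>

lemma velocity_difference_le: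
  assumes VX: "tame (distr W borel X) B M" and X [measurable]: "X \<in> borel_measurable borel"
    and Xh: "\<And>q. q \<in> open_halfplane \<Longrightarrow> X q \<in> open_halfplane"
    and VY: "tame (distr W borel Y) B M" and Y [measurable]: "Y \<in> borel_measurable borel"
    and Yh: "\<And>q. q \<in> open_halfplane \<Longrightarrow> Y q \<in> open_halfplane"
    and N: "admissible N"
    and e: "(\<integral>\<^sup>+ p. ennreal ((dist (X p) (Y p))\<^sup>2) \<partial>W) = ennreal e" "0 \<le> e"
    and l: "0 < l" "l \<le> 1"
  shows "(\<integral>\<^sup>+ p. ennreal (dist (X p) (Y p) * \<bar>lagrangian_velocity W s N X (X p) - lagrangian_velocity W s N Y (Y p)\<bar>) \<partial>W)
    \<le> ennreal (640 * (pi * B * (e + l\<^sup>2 * M) + 2 * (2 * pi * B * ln (1 / l) + M) * e))"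
proof -
  note [measurable] = measurable_kern_pair[OF N]
  let ?d = "\<lambda>p. dist (X p) (Y p)"
  let ?w = "\<lambda>A C p q. ennreal (pair_weight l (?d p) (?d q) (dist (A p) (C q)))"
  have [measurable]: "(\<lambda>x. pair_weight l (f x) (g x) (h x)) \<in> borel_measurable S"
    if [measurable]: "f \<in> borel_measurable S" "g \<in> borel_measurable S" "h \<in> borel_measurable S"
    for f g h :: "real \<times> real \<Rightarrow> real" and S
    unfolding pair_weight_def by measurable
  have [measurable]: "(\<lambda>x. pair_weight l (f x) (g x) (h x)) \<in> borel_measurable S"
    if [measurable]: "f \<in> borel_measurable S" "g \<in> borel_measurable S" "h \<in> borel_measurable S"
    for f g h :: "(real \<times> real) \<times> (real \<times> real) \<Rightarrow> real" and S
    unfolding pair_weight_def by measurable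
  \<comment> \<open>The middle weight occurs twice because the intermediate pair, \<open>Y p\<close>
    with \<open>X q\<close>, borders both differences of the telescope.\<close>
  have arith: "u \<le> 160 * (a + b + b + c)"
    if "u \<le> 80 * x1 + 80 * x2 + 160 * x3 + 160 * x4" "x1 \<le> a" "x2 \<le> b" "x3 \<le> b" "x4 \<le> c" "0 \<le> a" "0 \<le> b" "0 \<le> c"
    for u a b c x1 x2 x3 x4 :: real
  proof -
    have "u \<le> 80 * a + 80 * b + 160 * b + 160 * c" using that(1-5) by linarith
    also have "\<dots> \<le> 160 * (a + b + b + c)" using that(6-8) by simp
    finally show ?thesis .
  qed
  have pt: "AE p in W. ennreal (?d p * \<bar>lagrangian_velocity W s N X (X p) - lagrangian_velocity W s N Y (Y p)\<bar>)
      \<le> ennreal 160 * (\<integral>\<^sup>+ q. ?w X X p q + ?w Y X p q + ?w Y X p q + ?w Y Y p q \<partial>W)"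
    using AE_W
  proof eventually_elim
    case (elim p)
    let ?k = "\<lambda>q. kern N (X p) (X q) - kern N (Y p) (Y q)"
    have Xp: "X p \<in> open_halfplane" and Yp: "Y p \<in> open_halfplane" using Xh Yh elim by auto
    note iX = kern_integrable[OF VX X Xh N Xp] and iY = kern_integrable[OF VY Y Yh N Yp]
    have i: "integrable W (\<lambda>q. s q * ?k q)"
      using Bochner_Integration.integrable_diff[OF iX iY] by (simp add: right_diff_distrib)
    have "\<bar>lagrangian_velocity W s N X (X p) - lagrangian_velocity W s N Y (Y p)\<bar>
        = 1 / (2 * pi) * \<bar>\<integral>q. s q * ?k q \<partial>W\<bar>"
      using iX iY unfolding lagrangian_velocity_def right_diff_distrib[symmetric] abs_mult
      by (simp add: right_diff_distrib)
    also have "\<dots> \<le> 1 * \<bar>\<integral>q. s q * ?k q \<partial>W\<bar>"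
      using pi_ge_two by (intro mult_right_mono) auto
    finally have "ennreal (?d p * \<bar>lagrangian_velocity W s N X (X p) - lagrangian_velocity W s N Y (Y p)\<bar>)
        \<le> ennreal (?d p) * ennreal (norm (\<integral>q. s q * ?k q \<partial>W))"
      by (subst ennreal_mult[symmetric]) (auto intro!: ennreal_leI mult_left_mono)
    also have "\<dots> \<le> ennreal (?d p) * (\<integral>\<^sup>+ q. ennreal (norm (s q * ?k q)) \<partial>W)"
      by (intro mult_left_mono integral_norm_bound_ennreal[OF i]) auto
    also have "\<dots> = (\<integral>\<^sup>+ q. ennreal (?d p) * ennreal (norm (s q * ?k q)) \<partial>W)"
      by (subst nn_integral_cmult) auto
    also have "\<dots> \<le> (\<integral>\<^sup>+ q. ennreal 160 * (?w X X p q + ?w Y X p q + ?w Y X p q + ?w Y Y p q) \<partial>W)"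
    proof (rule nn_integral_mono_AE)
      show "AE q in W. ennreal (?d p) * ennreal (norm (s q * ?k q)) \<le> ennreal 160 * (?w X X p q + ?w Y X p q + ?w Y X p q + ?w Y Y p q)"
        using AE_W AE_neq[OF VX X, of "X p"] AE_neq[OF VX X, of "Y p"] AE_neq[OF VY Y, of "Y p"]
      proof eventually_elim
        case (elim q)
        have Xq: "X q \<in> open_halfplane" and Yq: "Y q \<in> open_halfplane" using Xh Yh elim by auto
        have pos: "0 \<le> fst (X p)" "0 \<le> fst (Y p)" "0 \<le> fst (X q)" "0 \<le> fst (Y q)"
          using Xp Yp Xq Yq by (auto simp: open_halfplane_def)
        let ?P = "\<lambda>A C. pair_weight l (?d p) (?d q) (dist (A p) (C q))"
        have 1: "\<bar>kern N (X p) (X q) - kern N (Y p) (X q)\<bar> \<le> 80 * (kernel_bound (?d p) (dist (X p) (X q)) + kernel_bound (?d p) (dist (Y p) (X q)))"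
          using elim by (intro kern_diff_fst_le N pos) auto
        have 2: "\<bar>kern N (Y p) (X q) - kern N (Y p) (Y q)\<bar> \<le> 160 * (kernel_bound (?d q) (dist (Y p) (X q)) + kernel_bound (?d q) (dist (Y p) (Y q)))"
          using elim by (intro kern_diff_snd_le N pos) auto
        have kb: "?d p * kernel_bound (?d p) (dist (X p) (X q)) \<le> ?P X X"
          "?d p * kernel_bound (?d p) (dist (Y p) (X q)) \<le> ?P Y X"
          "?d p * kernel_bound (?d q) (dist (Y p) (X q)) \<le> ?P Y X"
          "?d p * kernel_bound (?d q) (dist (Y p) (Y q)) \<le> ?P Y Y"
          using elim l by (auto intro!: kernel_bound_le_pair_weight)
        have n: "0 \<le> ?P X X" "0 \<le> ?P Y X" "0 \<le> ?P Y Y"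
          using l by (auto intro!: pair_weight_nonneg)
        have "\<bar>?k q\<bar> \<le> \<bar>kern N (X p) (X q) - kern N (Y p) (X q)\<bar> + \<bar>kern N (Y p) (X q) - kern N (Y p) (Y q)\<bar>"
          by simp
        then have "\<bar>?k q\<bar> \<le> 80 * (kernel_bound (?d p) (dist (X p) (X q)) + kernel_bound (?d p) (dist (Y p) (X q)))
            + 160 * (kernel_bound (?d q) (dist (Y p) (X q)) + kernel_bound (?d q) (dist (Y p) (Y q)))"
          using 1 2 by linarith
        from mult_left_mono[OF this zero_le_dist[of "X p" "Y p"]]
        have "?d p * \<bar>?k q\<bar> \<le> 80 * (?d p * kernel_bound (?d p) (dist (X p) (X q))) + 80 * (?d p * kernel_bound (?d p) (dist (Y p) (X q)))
            + 160 * (?d p * kernel_bound (?d q) (dist (Y p) (X q))) + 160 * (?d p * kernel_bound (?d q) (dist (Y p) (Y q)))"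
          by (simp only: distrib_left mult.left_commute)
        then have D: "?d p * \<bar>?k q\<bar> \<le> 160 * (?P X X + ?P Y X + ?P Y X + ?P Y Y)"
          by (rule arith[OF _ kb n])
        have "norm (s q * ?k q) \<le> \<bar>?k q\<bar>"
          using s_abs[of q] by (auto simp: abs_mult intro: mult_left_le_one_le)
        then have "?d p * norm (s q * ?k q) \<le> 160 * (?P X X + ?P Y X + ?P Y X + ?P Y Y)"
          using order_trans[OF mult_left_mono[OF _ zero_le_dist] D] by blast
        then have "ennreal (?d p * norm (s q * ?k q)) \<le> ennreal (160 * (?P X X + ?P Y X + ?P Y X + ?P Y Y))"
          by (rule ennreal_leI)
        then show ?case
          using n by (simp only: ennreal_mult ennreal_plus zero_le_dist norm_ge_zero zero_le_numeral add_nonneg_nonneg)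
      qed
    qed
    also have "\<dots> = ennreal 160 * (\<integral>\<^sup>+ q. ?w X X p q + ?w Y X p q + ?w Y X p q + ?w Y Y p q \<partial>W)"
      by (subst nn_integral_cmult) auto
    finally show ?case .
  qed
  interpret finite_measure W by (rule finite_W)
  let ?Q = "pi * B * (e + l\<^sup>2 * M) + 2 * (2 * pi * B * ln (1 / l) + M) * e"
  have Q: "0 \<le> ?Q" using tame_nonneg[OF VX] e l by (intro add_nonneg_nonneg mult_nonneg_nonneg) auto
  have "(\<integral>\<^sup>+ p. ennreal (?d p * \<bar>lagrangian_velocity W s N X (X p) - lagrangian_velocity W s N Y (Y p)\<bar>) \<partial>W)
      \<le> (\<integral>\<^sup>+ p. ennreal 160 * (\<integral>\<^sup>+ q. ?w X X p q + ?w Y X p q + ?w Y X p q + ?w Y Y p q \<partial>W) \<partial>W)"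
    by (rule nn_integral_mono_AE[OF pt])
  also have "\<dots> = ennreal 160 * ((\<integral>\<^sup>+ p. \<integral>\<^sup>+ q. ?w X X p q \<partial>W \<partial>W) + (\<integral>\<^sup>+ p. \<integral>\<^sup>+ q. ?w Y X p q \<partial>W \<partial>W)
      + (\<integral>\<^sup>+ p. \<integral>\<^sup>+ q. ?w Y X p q \<partial>W \<partial>W) + (\<integral>\<^sup>+ p. \<integral>\<^sup>+ q. ?w Y Y p q \<partial>W \<partial>W))"
    by (simp add: nn_integral_cmult nn_integral_add)
  also have "\<dots> \<le> ennreal 160 * (ennreal ?Q + ennreal ?Q + ennreal ?Q + ennreal ?Q)"
    using e l by (intro mult_left_mono add_mono pair_weight_integral_le VX VY X Y) auto
  also have "\<dots> = ennreal (640 * ?Q)"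
  proof -
    have "ennreal 160 * (ennreal x + ennreal x + ennreal x + ennreal x) = ennreal (640 * x)" if "0 \<le> x" for x
    proof -
      have "ennreal x + ennreal x + ennreal x + ennreal x = ennreal (4 * x)"
        using that by (simp add: ennreal_plus[symmetric] del: ennreal_plus)
      then have "ennreal 160 * (ennreal x + ennreal x + ennreal x + ennreal x) = ennreal (160 * (4 * x))"
        using that by (simp only: ennreal_mult[symmetric] mult_nonneg_nonneg zero_le_numeral)
      then show ?thesis by simp
    qed
    from this[OF Q] show ?thesis .
  qed
  finally show ?thesis .
qed

end

context signed_measure
begin

lemma borel_measurable_velocity:
  assumes N: "admissible N" and [measurable]: "Y \<in> borel_measurable borel" "f \<in> borel_measurable borel"
  shows "(\<lambda>p. lagrangian_velocity W s N Y (f p)) \<in> borel_measurable borel"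
proof -
  interpret finite_measure W by (rule finite_W)
  note [measurable] = measurable_kern_pair[OF N]
  show ?thesis unfolding lagrangian_velocity_def by measurable
qed

text \<open>Yudovich's uniqueness argument: with \<open>e\<close> the mean square distance of the two flows,
  \<open>e' \<le> K ln (1/l) (e + l\<^sup>2)\<close> for every small \<open>l\<close>, so that Gronwall gives \<open>e \<le> l\<close> on \<open>[t, t + 1/K]\<close>.\<close>

lemma lagrangian_flow_unique_short:
  assumes X: "lagrangian_flow W s B M T X" and Y: "lagrangian_flow W s B M T Y" and BM: "0 \<le> B" "0 \<le> M"
    and XY: "\<And>p. p \<in> open_halfplane \<Longrightarrow> X 0 p = Y 0 p"
  shows "\<exists>K>0. \<forall>a\<in>{0..T}. (\<integral>p. (dist (X a p) (Y a p))\<^sup>2 \<partial>W) = 0 \<longrightarrow>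
      (\<forall>t\<in>{a..T}. t \<le> a + 1 / K \<longrightarrow> (\<integral>p. (dist (X t p) (Y t p))\<^sup>2 \<partial>W) = 0)"
    and "\<forall>t\<in>{0..T}. integrable W (\<lambda>p. (dist (X t p) (Y t p))\<^sup>2)"
proof -
  interpret finite_measure W by (rule finite_W)
  let ?I = "{0..T}"
  have Xm [measurable]: "\<And>t. t \<in> ?I \<Longrightarrow> X t \<in> borel_measurable borel"
    and Ym [measurable]: "\<And>t. t \<in> ?I \<Longrightarrow> Y t \<in> borel_measurable borel"
    and VX: "\<And>t. t \<in> ?I \<Longrightarrow> tame (distr W borel (X t)) B M" and VY: "\<And>t. t \<in> ?I \<Longrightarrow> tame (distr W borel (Y t)) B M"
    and Xh: "\<And>t p. t \<in> ?I \<Longrightarrow> p \<in> open_halfplane \<Longrightarrow> X t p \<in> open_halfplane"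
    and Yh: "\<And>t p. t \<in> ?I \<Longrightarrow> p \<in> open_halfplane \<Longrightarrow> Y t p \<in> open_halfplane"
    using X Y by (auto simp: lagrangian_flow_def)
  define ur where "ur t p = lagrangian_velocity W s num_r (X t) (X t p) - lagrangian_velocity W s num_r (Y t) (Y t p)" for t p
  define uz where "uz t p = lagrangian_velocity W s num_z (X t) (X t p) - lagrangian_velocity W s num_z (Y t) (Y t p)" for t p
  define x where "x t p = fst (X t p) - fst (Y t p)" for t p
  define y where "y t p = snd (X t p) - snd (Y t p)" for t p
  define U where "U = 20 * (2 * pi * B + M)"
  have U: "0 \<le> U" using BM by (simp add: U_def)
  have dx: "((\<lambda>t. x t p) has_real_derivative ur t p) (at t within ?I)"
    and dy: "((\<lambda>t. y t p) has_real_derivative uz t p) (at t within ?I)"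
    if "t \<in> ?I" "p \<in> open_halfplane" for t p
    using X Y that unfolding x_def y_def ur_def uz_def lagrangian_flow_def by (auto intro!: DERIV_diff)
  have u_le: "\<bar>ur t p\<bar> \<le> U" "\<bar>uz t p\<bar> \<le> U" if "t \<in> ?I" "p \<in> open_halfplane" for t p
  proof -
    have vX: "\<bar>lagrangian_velocity W s N (X t) (X t p)\<bar> \<le> 10 * (2 * pi * B + M)" if "admissible N" for N
      by (rule velocity_abs_le[OF VX[OF \<open>t \<in> ?I\<close>] Xm[OF \<open>t \<in> ?I\<close>] Xh[OF \<open>t \<in> ?I\<close>] that Xh[OF \<open>t \<in> ?I\<close> \<open>p \<in> open_halfplane\<close>]])
    have vY: "\<bar>lagrangian_velocity W s N (Y t) (Y t p)\<bar> \<le> 10 * (2 * pi * B + M)" if "admissible N" for N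
      by (rule velocity_abs_le[OF VY[OF \<open>t \<in> ?I\<close>] Ym[OF \<open>t \<in> ?I\<close>] Yh[OF \<open>t \<in> ?I\<close>] that Yh[OF \<open>t \<in> ?I\<close> \<open>p \<in> open_halfplane\<close>]])
    show "\<bar>ur t p\<bar> \<le> U" "\<bar>uz t p\<bar> \<le> U"
      unfolding ur_def uz_def U_def
      using vX[OF admissible_num_r] vY[OF admissible_num_r] vX[OF admissible_num_z] vY[OF admissible_num_z] by linarith+
  qed
  have dist_eq: "(dist (X t p) (Y t p))\<^sup>2 = (x t p)\<^sup>2 + (y t p)\<^sup>2" for t p
    by (simp add: dist_prod_def dist_real_def x_def y_def)
  \<comment> \<open>Only there to provide an integrable majorant for the derivative of the squared
    distance; the growth in T is harmless.\<close>
  have xy_le: "\<bar>x t p\<bar> \<le> U * T" "\<bar>y t p\<bar> \<le> U * T" if t: "t \<in> ?I" and p: "p \<in> open_halfplane" for t p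
  proof -
    have 0: "x 0 p = 0" "y 0 p = 0" using XY[OF p] by (auto simp: x_def y_def)
    have "U * t \<le> U * T" using t U by (intro mult_left_mono) auto
    moreover have "norm (x t p - x 0 p) \<le> U * norm (t - 0)"
      by (rule field_differentiable_bound[of ?I _ "\<lambda>t. ur t p"]) (use dx u_le p t in auto)
    moreover have "norm (y t p - y 0 p) \<le> U * norm (t - 0)"
      by (rule field_differentiable_bound[of ?I _ "\<lambda>t. uz t p"]) (use dy u_le p t in auto)
    ultimately show "\<bar>x t p\<bar> \<le> U * T" "\<bar>y t p\<bar> \<le> U * T" using 0 t by auto
  qed
  define f where "f t p = (dist (X t p) (Y t p))\<^sup>2" for t p
  define f' where "f' t p = 2 * x t p * ur t p + 2 * y t p * uz t p" for t p
  define e where "e t = (\<integral>p. f t p \<partial>W)" for t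
  have fm: "f t \<in> borel_measurable W" if "t \<in> ?I" for t
    unfolding f_def using that by measurable
  have [measurable]: "ur t \<in> borel_measurable borel" "uz t \<in> borel_measurable borel" if "t \<in> ?I" for t
    unfolding ur_def uz_def using that
    by (auto intro!: borel_measurable_diff borel_measurable_velocity admissible_num_r admissible_num_z)
  have f'm: "f' t \<in> borel_measurable W" if "t \<in> ?I" for t
    unfolding f'_def x_def y_def using that by measurable
  have der: "AE p in W. \<forall>t\<in>?I. ((\<lambda>t. f t p) has_real_derivative f' t p) (at t within ?I) \<and> \<bar>f' t p\<bar> \<le> 4 * (U * T) * U"
    using AE_W
  proof (eventually_elim, intro ballI conjI)
    fix p t assume p: "p \<in> open_halfplane" and t: "t \<in> ?I"
    show "((\<lambda>t. f t p) has_real_derivative f' t p) (at t within ?I)"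
      unfolding f_def f'_def dist_eq
      by (auto intro!: derivative_eq_intros dx[OF t p] dy[OF t p])
    have "\<bar>x t p * ur t p\<bar> \<le> (U * T) * U" "\<bar>y t p * uz t p\<bar> \<le> (U * T) * U"
      unfolding abs_mult using xy_le[OF t p] u_le[OF t p] by (auto intro!: mult_mono order_trans[OF abs_ge_zero])
    then show "\<bar>f' t p\<bar> \<le> 4 * (U * T) * U" unfolding f'_def by (simp add: mult.assoc)
  qed
  have f0: "integrable W (f 0)" if "0 \<le> T"
  proof -
    have "AE p in W. f 0 p = 0" using AE_W by eventually_elim (simp add: f_def XY)
    then show ?thesis using fm[of 0] that by (subst integrable_cong_AE[of _ _ "\<lambda>_. 0"]) auto
  qed
  have fi: "integrable W (f t)" if "t \<in> ?I" for t
    using that by (intro has_derivative_integral_bounded(2)[OF finite_W _ that fm f'm[OF that] der f0]) auto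
  then show "\<forall>t\<in>{0..T}. integrable W (\<lambda>p. (dist (X t p) (Y t p))\<^sup>2)" by (simp add: f_def[abs_def])
  have de: "(e has_real_derivative (\<integral>p. f' t p \<partial>W)) (at t within ?I)" if "t \<in> ?I" for t
    unfolding e_def
    using that by (intro has_derivative_integral_bounded(1)[OF finite_W _ that fm f'm[OF that] der f0]) auto
  have e0: "0 \<le> e t" for t unfolding e_def f_def by (intro integral_nonneg_AE) auto
  have nne: "(\<integral>\<^sup>+ p. ennreal ((dist (X t p) (Y t p))\<^sup>2) \<partial>W) = ennreal (e t)" if "t \<in> ?I" for t
    unfolding e_def f_def using fi[OF that] by (subst nn_integral_eq_integral) (auto simp: f_def[abs_def])
  \<comment> \<open>2560 = 2 (640 + 640): the factor 2 from differentiating a square, and 640 from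
    \<open>velocity_difference_le\<close> for each component. The added 1 keeps \<open>K\<close>
    positive when \<open>B\<close> and \<open>M\<close> vanish.\<close>
  define K where "K = 2560 * (pi * B * (1 + M) + 2 * (2 * pi * B + M)) + 1"
  have K: "0 < K" using BM unfolding K_def by (intro add_nonneg_pos mult_nonneg_nonneg add_nonneg_nonneg) auto
  have e'_le: "(\<integral>p. f' t p \<partial>W) \<le> K * ln (1 / l) * (e t + l\<^sup>2)" if t: "t \<in> ?I" and l: "0 < l" "l \<le> exp (-1)" for t l
  proof -
    let ?d = "\<lambda>p. dist (X t p) (Y t p)"
    have l1: "l \<le> 1" using l(2) by (rule order_trans) simp
    \<comment> \<open>The restriction l \<le> 1/e is there for this: terms without a logarithm can
      be multiplied by ln (1/l) as well.\<close>
    have L: "1 \<le> ln (1 / l)"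
      using l ln_mono[of l "exp (-1)"] by (simp add: ln_div)
    define Q where "Q = pi * B * (e t + l\<^sup>2 * M) + 2 * (2 * pi * B * ln (1 / l) + M) * e t"
    have Q0: "0 \<le> Q" unfolding Q_def using BM e0[of t] L by (intro add_nonneg_nonneg mult_nonneg_nonneg) auto
    have vd: "(\<integral>\<^sup>+ p. ennreal (?d p * \<bar>ur t p\<bar>) \<partial>W) \<le> ennreal (640 * Q)"
      "(\<integral>\<^sup>+ p. ennreal (?d p * \<bar>uz t p\<bar>) \<partial>W) \<le> ennreal (640 * Q)"
      unfolding ur_def uz_def Q_def
      by (intro velocity_difference_le VX VY Xm Ym Xh Yh t admissible_num_r admissible_num_z nne e0 l l1; assumption)+
    have fi': "integrable W (f' t)"
    proof (rule integrable_const_bound)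
      show "AE p in W. norm (f' t p) \<le> 4 * (U * T) * U"
        using der by eventually_elim (use t in auto)
    qed (rule f'm[OF t])
    have "ennreal (\<integral>p. f' t p \<partial>W) \<le> (\<integral>\<^sup>+ p. ennreal (norm (f' t p)) \<partial>W)"
      by (rule order_trans[OF ennreal_leI integral_norm_bound_ennreal[OF fi']]) simp
    also have "\<dots> \<le> (\<integral>\<^sup>+ p. ennreal 2 * (ennreal (?d p * \<bar>ur t p\<bar>) + ennreal (?d p * \<bar>uz t p\<bar>)) \<partial>W)"
    proof (rule nn_integral_mono)
      fix p
      have "\<bar>x t p\<bar> \<le> ?d p" "\<bar>y t p\<bar> \<le> ?d p"
        unfolding x_def y_def using dist_comp_le[of "X t p" "Y t p"] by auto
      then have "\<bar>x t p * ur t p\<bar> \<le> ?d p * \<bar>ur t p\<bar>" "\<bar>y t p * uz t p\<bar> \<le> ?d p * \<bar>uz t p\<bar>"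
        unfolding abs_mult by (auto intro: mult_right_mono)
      then have "norm (f' t p) \<le> 2 * (?d p * \<bar>ur t p\<bar> + ?d p * \<bar>uz t p\<bar>)"
        unfolding f'_def by (simp add: mult.assoc)
      then have "ennreal (norm (f' t p)) \<le> ennreal (2 * (?d p * \<bar>ur t p\<bar> + ?d p * \<bar>uz t p\<bar>))"
        by (rule ennreal_leI)
      then show "ennreal (norm (f' t p)) \<le> ennreal 2 * (ennreal (?d p * \<bar>ur t p\<bar>) + ennreal (?d p * \<bar>uz t p\<bar>))"
        by (simp only: ennreal_mult ennreal_plus zero_le_dist abs_ge_zero mult_nonneg_nonneg zero_le_numeral add_nonneg_nonneg)
    qed
    also have "\<dots> = ennreal 2 * ((\<integral>\<^sup>+ p. ennreal (?d p * \<bar>ur t p\<bar>) \<partial>W) + (\<integral>\<^sup>+ p. ennreal (?d p * \<bar>uz t p\<bar>) \<partial>W))"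
      using t by (simp add: nn_integral_cmult nn_integral_add)
    also have "\<dots> \<le> ennreal 2 * (ennreal (640 * Q) + ennreal (640 * Q))"
      by (intro mult_left_mono add_mono vd) auto
    also have "\<dots> = ennreal (2560 * Q)"
    proof -
      have "ennreal (640 * Q) + ennreal (640 * Q) = ennreal (1280 * Q)"
        using Q0 by (simp add: ennreal_plus[symmetric] del: ennreal_plus)
      then have "ennreal 2 * (ennreal (640 * Q) + ennreal (640 * Q)) = ennreal (2 * (1280 * Q))"
        using Q0 by (simp only: ennreal_mult[symmetric] mult_nonneg_nonneg zero_le_numeral)
      then show ?thesis by simp
    qed
    finally have 1: "(\<integral>p. f' t p \<partial>W) \<le> 2560 * Q"
      using Q0 by (subst (asm) ennreal_le_iff) auto
    have el: "0 \<le> e t + l\<^sup>2" using e0[of t] by simp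
    have "pi * B * (e t + l\<^sup>2 * M) \<le> pi * B * ((1 + M) * (e t + l\<^sup>2))"
      using BM e0[of t] by (intro mult_left_mono) (auto simp: algebra_simps)
    also have "\<dots> \<le> pi * B * ((1 + M) * (e t + l\<^sup>2)) * ln (1 / l)"
      using mult_left_mono[OF L, of "pi * B * ((1 + M) * (e t + l\<^sup>2))"] BM el by simp
    finally have 2: "pi * B * (e t + l\<^sup>2 * M) \<le> pi * B * (1 + M) * (ln (1 / l) * (e t + l\<^sup>2))"
      by (simp add: ac_simps)
    have "2 * pi * B * ln (1 / l) + M \<le> (2 * pi * B + M) * ln (1 / l)"
      using mult_left_mono[OF L, of M] BM by (simp add: algebra_simps)
    then have "2 * (2 * pi * B * ln (1 / l) + M) * e t \<le> 2 * ((2 * pi * B + M) * ln (1 / l)) * (e t + l\<^sup>2)"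
      using BM L e0[of t] by (intro mult_mono mult_left_mono mult_nonneg_nonneg) auto
    then have 3: "2 * (2 * pi * B * ln (1 / l) + M) * e t \<le> 2 * (2 * pi * B + M) * (ln (1 / l) * (e t + l\<^sup>2))"
      by (simp only: mult.assoc)
    have "Q \<le> (pi * B * (1 + M) + 2 * (2 * pi * B + M)) * (ln (1 / l) * (e t + l\<^sup>2))"
      unfolding Q_def distrib_right[of "pi * B * (1 + M)"] using 2 3 by (rule add_mono)
    then have "2560 * Q \<le> 2560 * ((pi * B * (1 + M) + 2 * (2 * pi * B + M)) * (ln (1 / l) * (e t + l\<^sup>2)))"
      by (rule mult_left_mono) simp
    also have "\<dots> = (K - 1) * (ln (1 / l) * (e t + l\<^sup>2))"
      unfolding K_def by (simp only: add_diff_cancel_right' mult.assoc)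
    also have "\<dots> \<le> K * (ln (1 / l) * (e t + l\<^sup>2))"
      using L el by (intro mult_right_mono) auto
    finally show ?thesis using 1 by (simp add: mult.assoc)
  qed
  show "\<exists>K>0. \<forall>a\<in>{0..T}. (\<integral>p. (dist (X a p) (Y a p))\<^sup>2 \<partial>W) = 0 \<longrightarrow>
      (\<forall>t\<in>{a..T}. t \<le> a + 1 / K \<longrightarrow> (\<integral>p. (dist (X t p) (Y t p))\<^sup>2 \<partial>W) = 0)"
  proof (intro exI[of _ K] conjI K ballI impI)
    fix a t assume a: "a \<in> {0..T}" and "(\<integral>p. (dist (X a p) (Y a p))\<^sup>2 \<partial>W) = 0" and t: "t \<in> {a..T}" "t \<le> a + 1 / K"
    then have ea: "e a = 0" by (simp add: e_def f_def[abs_def])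
    have bound: "e t \<le> l" if l: "0 < l" "l \<le> exp (-1)" for l
    proof -
      let ?k = "K * ln (1 / l)"
      have L: "0 \<le> ln (1 / l)" using l(1) order_trans[OF l(2), of 1] by simp
      \<comment> \<open>Gronwall by the mean value theorem: e + l^2 times this exponential has a
        nonpositive derivative, so the derivative of e never has to be integrated.\<close>
      have "(e t + l\<^sup>2) * exp (- ?k * t) \<le> (e a + l\<^sup>2) * exp (- ?k * a)"
      proof (cases "a = t")
        case False
        then have at: "a < t" using t by simp
        have D: "((\<lambda>u. (e u + l\<^sup>2) * exp (- ?k * u)) has_real_derivative
            (\<integral>p. f' u p \<partial>W) * exp (- ?k * u) + (e u + l\<^sup>2) * (- ?k * exp (- ?k * u))) (at u within {a..t})"
          if "u \<in> {a..t}" for u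
        proof -
          have "(e has_real_derivative (\<integral>p. f' u p \<partial>W)) (at u within {a..t})"
            by (rule DERIV_subset[OF de]) (use that a t in auto)
          then show ?thesis by (auto intro!: derivative_eq_intros simp: algebra_simps)
        qed
        obtain u where u: "u \<in> {a..t}" "(e t + l\<^sup>2) * exp (- ?k * t) - (e a + l\<^sup>2) * exp (- ?k * a)
            = ((\<integral>p. f' u p \<partial>W) * exp (- ?k * u) + (e u + l\<^sup>2) * (- ?k * exp (- ?k * u))) * (t - a)"
          using mvt_very_simple[OF less_imp_le[OF at], of "\<lambda>u. (e u + l\<^sup>2) * exp (- ?k * u)"
              "\<lambda>u h. ((\<integral>p. f' u p \<partial>W) * exp (- ?k * u) + (e u + l\<^sup>2) * (- ?k * exp (- ?k * u))) * h"]
            D[unfolded has_field_derivative_def] by auto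
        have "(\<integral>p. f' u p \<partial>W) * exp (- ?k * u) \<le> ?k * (e u + l\<^sup>2) * exp (- ?k * u)"
          using u a t by (intro mult_right_mono e'_le l) auto
        then have "(\<integral>p. f' u p \<partial>W) * exp (- ?k * u) + (e u + l\<^sup>2) * (- ?k * exp (- ?k * u)) \<le> 0"
          by (simp add: algebra_simps)
        then show ?thesis using u(2) at mult_nonpos_nonneg[of _ "t - a"] by fastforce
      qed simp
      then have "(e t + l\<^sup>2) * exp (- ?k * t) * exp (?k * t) \<le> l\<^sup>2 * exp (- ?k * a) * exp (?k * t)"
        using ea by (intro mult_right_mono) auto
      then have "e t + l\<^sup>2 \<le> l\<^sup>2 * exp (?k * (t - a))"
        by (simp add: mult.assoc exp_add[symmetric] algebra_simps)
      \<comment> \<open>Over a time of at most 1 / K the exponential has grown by at most 1 / l, and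
        the error l^2 becomes l, which still tends to 0.\<close>
      also have "exp (?k * (t - a)) \<le> exp (ln (1 / l))"
      proof -
        have "K * (t - a) \<le> 1" using t K by (simp add: field_simps)
        from mult_left_mono[OF this L] show ?thesis by (simp add: ac_simps)
      qed
      also have "l\<^sup>2 * exp (ln (1 / l)) = l" using l(1) by (simp add: power2_eq_square)
      finally have "e t + l\<^sup>2 \<le> l" by (simp add: mult_left_mono)
      then show ?thesis using zero_le_power2[of l] by linarith
    qed
    have "e t \<le> 0"
    proof (rule ccontr)
      assume "\<not> e t \<le> 0"
      then have "0 < min (exp (-1)) (e t / 2)" by simp
      from bound[OF this min.cobounded1] have "e t \<le> e t / 2" by (rule order_trans) simp
      then show False using \<open>\<not> e t \<le> 0\<close> by simp
    qed
    with e0[of t] have "e t = 0" by (rule antisym[rotated])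
    then show "(\<integral>p. (dist (X t p) (Y t p))\<^sup>2 \<partial>W) = 0" by (simp add: e_def f_def[abs_def])
  qed
qed

text \<open>The step length 1 / K does not depend on the starting time, so finitely many steps reach
  every t.\<close>

lemma lagrangian_flow_unique:
  assumes X: "lagrangian_flow W s B M T X" and Y: "lagrangian_flow W s B M T Y" and BM: "0 \<le> B" "0 \<le> M"
    and XY: "\<And>p. p \<in> open_halfplane \<Longrightarrow> X 0 p = Y 0 p" and t: "t \<in> {0..T}"
  shows "AE p in W. X t p = Y t p"
proof -
  obtain K where K: "0 < K" and step: "\<And>a t. a \<in> {0..T} \<Longrightarrow> (\<integral>p. (dist (X a p) (Y a p))\<^sup>2 \<partial>W) = 0 \<Longrightarrow>
      t \<in> {a..T} \<Longrightarrow> t \<le> a + 1 / K \<Longrightarrow> (\<integral>p. (dist (X t p) (Y t p))\<^sup>2 \<partial>W) = 0"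
    using lagrangian_flow_unique_short(1)[OF assms(1-5)] by blast
  have all: "\<forall>t\<in>{0..T}. t \<le> real n / K \<longrightarrow> (\<integral>p. (dist (X t p) (Y t p))\<^sup>2 \<partial>W) = 0" for n
  proof (induction n)
    case 0
    have "(\<integral>p. (dist (X 0 p) (Y 0 p))\<^sup>2 \<partial>W) = 0"
      using AE_W XY by (intro integral_eq_zero_AE) auto
    then show ?case by auto
  next
    case (Suc n)
    show ?case
    proof (intro ballI impI)
      fix t assume t: "t \<in> {0..T}" "t \<le> real (Suc n) / K"
      \<comment> \<open>The minimum also covers times that the previous steps have already
        reached.\<close>
      let ?a = "min t (real n / K)"
      have a: "?a \<in> {0..T}" "t \<in> {?a..T}" using t K by auto
      have "t \<le> ?a + 1 / K" using t K by (auto simp: min_def add_divide_distrib)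
      then show "(\<integral>p. (dist (X t p) (Y t p))\<^sup>2 \<partial>W) = 0"
        using a Suc by (intro step[of ?a t]) auto
    qed
  qed
  obtain n where "t * K \<le> real n" using real_arch_simple by blast
  then have "t \<le> real n / K" using K by (simp add: pos_le_divide_eq)
  then have "(\<integral>p. (dist (X t p) (Y t p))\<^sup>2 \<partial>W) = 0" using all t by blast
  then have "AE p in W. (dist (X t p) (Y t p))\<^sup>2 = 0"
    using lagrangian_flow_unique_short(2)[OF assms(1-5)] t by (subst (asm) integral_nonneg_eq_0_iff_AE) auto
  then show ?thesis by eventually_elim simp
qed

end

subsection \<open>The interaction kernel\<close>

definition reflect :: "real \<times> real \<Rightarrow> real \<times> real" where
  "reflect q = (fst q, - snd q)"

lemma reflect_simps [simp]: "fst (reflect q) = fst q" "snd (reflect q) = - snd q" "reflect (reflect q) = q"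
  by (simp_all add: reflect_def)

text \<open>In a double integral against a product measure with equal factors, the kernel of Z' may
  be replaced by half its sum with the transposed kernel; the sign is chosen to make this sum
  nonnegative.\<close>

definition sym_kern :: "real \<times> real \<Rightarrow> real \<times> real \<Rightarrow> real" where
  "sym_kern p q = - (kern num_z p q + kern num_z q p)"

text \<open>The squared distance of the two points after projecting to the horizontal plane, which
  is blind to reflection in z = 0.\<close>

definition planar_sq :: "real \<times> real \<Rightarrow> real \<times> real \<Rightarrow> real \<Rightarrow> real" where
  "planar_sq p q \<theta> = (fst p - fst q)\<^sup>2 + 2 * fst p * fst q * (1 - cos \<theta>)"

lemma planar_sq_nonneg: "0 \<le> fst p \<Longrightarrow> 0 \<le> fst q \<Longrightarrow> 0 \<le> planar_sq p q \<theta>"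
  unfolding planar_sq_def by (intro add_nonneg_nonneg mult_nonneg_nonneg) auto

lemma den_planar_sq: "den p q \<theta> = sqrt (planar_sq p q \<theta> + (snd p - snd q)\<^sup>2)"
  by (simp add: den_eq planar_sq_def dist_prod_def dist_real_def algebra_simps)

lemma continuous_planar_integrand:
  assumes "0 \<le> fst p" "0 \<le> fst q" "p \<noteq> q"
  shows "continuous_on S (\<lambda>\<theta>. planar_sq a b \<theta> / den p q \<theta> ^ 3)"
proof -
  have "den p q \<theta> \<noteq> 0" for \<theta> using den_pos[OF assms, of \<theta>] by simp
  then show ?thesis unfolding planar_sq_def by (intro continuous_intros) auto
qed

text \<open>Neither kernel has a sign by itself, but the weighted numerators add up to minus the
  squared horizontal distance, by the law of cosines.\<close>

lemma sym_kern_eq: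
  assumes p: "0 \<le> fst p" and q: "0 \<le> fst q" and pq: "p \<noteq> q"
  shows "sym_kern p q = angle_integral (\<lambda>\<theta>. planar_sq p q \<theta> / den p q \<theta> ^ 3)"
proof -
  have "kern num_z p q + kern num_z q p = angle_integral (\<lambda>\<theta>. fst q * num_z p q \<theta> / den p q \<theta> ^ 3 + fst p * num_z q p \<theta> / den q p \<theta> ^ 3)"
    unfolding kern_def
    by (rule angle_integral_add[symmetric]; rule continuous_kern_integrand[OF admissible_num_z]) (use assms in auto)
  also have "(\<lambda>\<theta>. fst q * num_z p q \<theta> / den p q \<theta> ^ 3 + fst p * num_z q p \<theta> / den q p \<theta> ^ 3)
     = (\<lambda>\<theta>. (-1) * (planar_sq p q \<theta> / den p q \<theta> ^ 3))"
  proof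
    fix \<theta>
    have "fst q * num_z p q \<theta> + fst p * num_z q p \<theta> = (-1) * planar_sq p q \<theta>"
      by (simp add: num_z_def planar_sq_def power2_eq_square algebra_simps)
    then show "fst q * num_z p q \<theta> / den p q \<theta> ^ 3 + fst p * num_z q p \<theta> / den q p \<theta> ^ 3 = (-1) * (planar_sq p q \<theta> / den p q \<theta> ^ 3)"
      by (simp only: den_commute[of q p] add_divide_distrib[symmetric] times_divide_eq_right)
  qed
  finally show ?thesis unfolding sym_kern_def by (simp only: set_integral_mult_right)
qed

lemma sym_gap_integrand_nonneg:
  assumes p: "0 \<le> fst p" "0 \<le> snd p" and q: "0 \<le> fst q" "0 \<le> snd q" and pq: "p \<noteq> q"
  shows "0 \<le> planar_sq p q \<theta> / den p q \<theta> ^ 3 - planar_sq p q \<theta> / den p (reflect q) \<theta> ^ 3"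
proof -
  have "(snd p - snd q)\<^sup>2 \<le> (snd p + snd q)\<^sup>2" using p q by (simp add: power2_diff power2_sum)
  then have "den p q \<theta> \<le> den p (reflect q) \<theta>"
    unfolding den_planar_sq by (simp add: planar_sq_def)
  then have "1 / den p (reflect q) \<theta> ^ 3 \<le> 1 / den p q \<theta> ^ 3"
    using den_pos[OF p(1) q(1) pq, of \<theta>] by (intro divide_left_mono power_mono mult_pos_pos zero_less_power) auto
  from mult_left_mono[OF this planar_sq_nonneg[OF p(1) q(1), of \<theta>]] show ?thesis by simp
qed

lemma sym_gap_eq:
  assumes p: "0 \<le> fst p" and q: "0 \<le> fst q" and pq: "p \<noteq> q" "p \<noteq> reflect q"
  shows "sym_kern p q - sym_kern p (reflect q)
    = angle_integral (\<lambda>\<theta>. planar_sq p q \<theta> / den p q \<theta> ^ 3 - planar_sq p q \<theta> / den p (reflect q) \<theta> ^ 3)"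
proof -
  have "planar_sq p (reflect q) = planar_sq p q" by (simp add: planar_sq_def fun_eq_iff)
  then show ?thesis
    using sym_kern_eq[OF p q pq(1)] sym_kern_eq[OF p _ pq(2)] q
    by (subst angle_integral_diff) (auto intro!: continuous_planar_integrand assms)
qed

lemma sym_gap_nonneg:
  assumes "0 \<le> fst p" "0 \<le> snd p" "0 \<le> fst q" "0 \<le> snd q" "p \<noteq> q" "p \<noteq> reflect q"
  shows "0 \<le> sym_kern p q - sym_kern p (reflect q)"
proof -
  have "angle_integral (\<lambda>_. 0) \<le> sym_kern p q - sym_kern p (reflect q)"
    unfolding sym_gap_eq[OF assms(1,3,5,6)]
    using assms by (intro angle_integral_mono continuous_on_const continuous_on_diff continuous_planar_integrand sym_gap_integrand_nonneg) auto
  then show ?thesis by simp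
qed

text \<open>All lengths are comparable to \<open>l\<close>, so by scaling the gap is a constant over
  \<open>l\<close>. The numbers: A + 4 l^2 \<le> 21 l^2 \<le> (5 l)^2, and (2/25) * 3 / (2 * 5^5)
  exceeds 1/30000. The gap itself comes from 3 l^2 = Y^2 - X^2.\<close>

lemma cube_gap_ge:
  fixes A l x y :: real
  assumes l: "0 < l" and A: "2 * l\<^sup>2 / 25 \<le> A" "A \<le> 17 * l\<^sup>2" and x: "x\<^sup>2 \<le> l\<^sup>2" and y: "4 * l\<^sup>2 \<le> y\<^sup>2"
  shows "1 / (30000 * l) \<le> A / sqrt (A + x\<^sup>2) ^ 3 - A / sqrt (A + y\<^sup>2) ^ 3"
proof -
  define X where "X = sqrt (A + l\<^sup>2)"
  define Y where "Y = sqrt (A + 4 * l\<^sup>2)"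
  have l2: "0 < l\<^sup>2" using l by simp
  have A0: "0 < A" using A l2 by linarith
  have XY: "0 < X" "0 < Y" "X \<le> Y" using A0 l2 by (auto simp: X_def Y_def intro: add_pos_pos)
  have sq: "X\<^sup>2 = A + l\<^sup>2" "Y\<^sup>2 = A + 4 * l\<^sup>2" using A0 l2 by (auto simp: X_def Y_def)
  have "Y\<^sup>2 \<le> (5 * l)\<^sup>2" using A l2 unfolding sq by (simp add: power_mult_distrib)
  then have Y5: "Y \<le> 5 * l" by (rule power2_le_imp_le) (use l in simp)
  have "3 * l\<^sup>2 / (2 * Y ^ 5) \<le> 1 / X ^ 3 - 1 / Y ^ 3"
  proof -
    have "3 * l\<^sup>2 = (Y - X) * (Y + X)" using sq by (simp add: algebra_simps power2_eq_square)
    also have "\<dots> \<le> (Y - X) * (2 * Y)" using XY by (intro mult_left_mono) auto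
    finally have "3 * l\<^sup>2 / (2 * Y ^ 5) \<le> (Y - X) * (2 * Y) / (2 * Y ^ 5)"
      using XY by (intro divide_right_mono) auto
    also have "\<dots> = (Y - X) / (Y * Y ^ 3)"
      using XY by (simp add: field_simps eval_nat_numeral)
    also have "\<dots> \<le> (Y - X) / (X * Y ^ 3)"
      using XY by (intro divide_left_mono mult_right_mono mult_pos_pos) auto
    also have "\<dots> = (1 / X - 1 / Y) * (1 / Y\<^sup>2)"
      using XY by (simp add: field_simps eval_nat_numeral)
    also have "\<dots> = 1 / (X * Y\<^sup>2) - 1 / Y ^ 3"
      using XY by (simp add: field_simps eval_nat_numeral)
    also have "1 / (X * Y\<^sup>2) \<le> 1 / X ^ 3"
    proof -
      have "X * X\<^sup>2 \<le> X * Y\<^sup>2" using XY by (intro mult_left_mono power_mono) auto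
      then show ?thesis using XY by (intro divide_left_mono mult_pos_pos zero_less_power) (auto simp: power3_eq_cube power2_eq_square)
    qed
    finally show ?thesis by simp
  qed
  moreover have "3 * l\<^sup>2 / (2 * (5 * l) ^ 5) \<le> 3 * l\<^sup>2 / (2 * Y ^ 5)"
    using XY Y5 l by (intro divide_left_mono mult_left_mono power_mono mult_pos_pos zero_less_power) auto
  moreover have "1 / X ^ 3 \<le> 1 / sqrt (A + x\<^sup>2) ^ 3"
    using x A0 unfolding X_def by (intro divide_left_mono power_mono mult_pos_pos zero_less_power) (auto intro: add_pos_nonneg)
  moreover have "1 / sqrt (A + y\<^sup>2) ^ 3 \<le> 1 / Y ^ 3"
    using y A0 l2 unfolding Y_def by (intro divide_left_mono power_mono mult_pos_pos zero_less_power) (auto intro: add_pos_nonneg)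
  ultimately have g: "3 * l\<^sup>2 / (2 * (5 * l) ^ 5) \<le> 1 / sqrt (A + x\<^sup>2) ^ 3 - 1 / sqrt (A + y\<^sup>2) ^ 3"
    by linarith
  have "1 / (30000 * l) \<le> (2 * l\<^sup>2 / 25) * (3 * l\<^sup>2 / (2 * (5 * l) ^ 5))"
    using l by (simp add: field_simps eval_nat_numeral)
  also have "\<dots> \<le> A * (1 / sqrt (A + x\<^sup>2) ^ 3 - 1 / sqrt (A + y\<^sup>2) ^ 3)"
    using g A l A0 by (intro mult_mono) auto
  finally show ?thesis by (simp add: right_diff_distrib)
qed

lemma one_minus_cos_le: "1 - cos \<theta> \<le> \<theta>\<^sup>2 / 2" for \<theta> :: real
proof -
  have "\<bar>sin (\<theta> / 2)\<bar> \<le> \<bar>\<theta> / 2\<bar>" by (rule abs_sin_x_le_abs_x)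
  then have "(sin (\<theta> / 2))\<^sup>2 \<le> (\<theta> / 2)\<^sup>2" by (simp only: abs_le_square_iff)
  moreover have "cos \<theta> = 1 - 2 * (sin (\<theta> / 2))\<^sup>2" using cos_double_sin[of "\<theta> / 2"] by simp
  ultimately show ?thesis by (simp add: power_divide)
qed

text \<open>Only angles between l/\<rho> and 2 l/\<rho> are used. There the horizontal distance is
  comparable to the side \<open>l\<close>, while the vertical distance is at most \<open>l\<close>
  to the point and at least 2 l to its mirror image. The window has length l/\<rho> and the
  integrand is at least 1 / (30000 l), so \<open>l\<close> cancels. In the upper bound 17 l^2, 16
  comes from the angle and 1 from the radii.\<close>

lemma sym_gap_box:
  assumes l: "0 < l" "l \<le> \<rho>" "l \<le> \<zeta>"
    and p: "\<rho> \<le> fst p" "fst p \<le> \<rho> + l" "\<zeta> \<le> snd p" "snd p \<le> \<zeta> + l"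
    and q: "\<rho> \<le> fst q" "fst q \<le> \<rho> + l" "\<zeta> \<le> snd q" "snd q \<le> \<zeta> + l" and pq: "p \<noteq> q"
  shows "1 / (30000 * \<rho>) \<le> sym_kern p q - sym_kern p (reflect q)"
proof -
  have r: "0 < \<rho>" using l by simp
  have p0: "0 \<le> fst p" "0 \<le> snd p" "0 \<le> fst q" "0 \<le> snd q" using p q l by auto
  have "p \<noteq> reflect q" using p q l by (auto simp: reflect_def prod_eq_iff)
  note gap = sym_gap_eq[OF p0(1,3) pq this]
  let ?u = "l / \<rho>"
  have u: "0 < ?u" "?u \<le> 1" using l r by (auto simp: divide_le_eq_1)
  let ?f = "\<lambda>\<theta>. planar_sq p q \<theta> / den p q \<theta> ^ 3 - planar_sq p q \<theta> / den p (reflect q) \<theta> ^ 3"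
  have cf: "continuous_on {0..pi} ?f"
    using \<open>p \<noteq> reflect q\<close> by (intro continuous_on_diff continuous_planar_integrand p0 pq) (use p0 in auto)
  have low: "indicator {?u..2 * ?u} \<theta> * (1 / (30000 * l)) \<le> ?f \<theta>" for \<theta>
  proof (cases "\<theta> \<in> {?u..2 * ?u}")
    case False
    then show ?thesis using sym_gap_integrand_nonneg[OF p0 pq, of \<theta>] by simp
  next
    case True
    then have t: "?u \<le> \<theta>" "\<theta> \<le> 2 * ?u" by auto
    have tp: "0 \<le> \<theta>" "\<theta> \<le> pi" using t u pi_ge_two by auto
    have t2: "?u\<^sup>2 \<le> \<theta>\<^sup>2" "\<theta>\<^sup>2 \<le> (2 * ?u)\<^sup>2" using t u tp by (auto intro!: power_mono)
    have rr: "\<rho> * \<rho> \<le> fst p * fst q" "fst p * fst q \<le> (2 * \<rho>) * (2 * \<rho>)"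
      using mult_mono[of \<rho> "fst p" \<rho> "fst q"] mult_mono[of "fst p" "2 * \<rho>" "fst q" "2 * \<rho>"] p q l r by auto
    have "2 * l\<^sup>2 / 25 = 2 * (\<rho> * \<rho>) * (?u\<^sup>2 / 25)" using r by (simp add: power2_eq_square)
    also have "\<dots> \<le> 2 * (fst p * fst q) * (1 - cos \<theta>)"
    proof -
      have "?u\<^sup>2 / 25 \<le> 1 - cos \<theta>" using one_minus_cos_ge[OF tp] t2(1) by linarith
      then show ?thesis by (intro mult_mono[OF mult_left_mono[OF rr(1)]]) (use p0 in auto)
    qed
    also have "\<dots> \<le> planar_sq p q \<theta>" by (simp add: planar_sq_def)
    finally have A1: "2 * l\<^sup>2 / 25 \<le> planar_sq p q \<theta>" .
    have "2 * (fst p * fst q) * (1 - cos \<theta>) \<le> 2 * ((2 * \<rho>) * (2 * \<rho>)) * ((2 * ?u)\<^sup>2 / 2)"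
    proof -
      have "1 - cos \<theta> \<le> (2 * ?u)\<^sup>2 / 2" using one_minus_cos_le[of \<theta>] t2(2) by linarith
      then show ?thesis by (intro mult_mono[OF mult_left_mono[OF rr(2)]]) auto
    qed
    also have "\<dots> = 16 * l\<^sup>2" using r by (simp add: power2_eq_square)
    finally have "2 * fst p * fst q * (1 - cos \<theta>) \<le> 16 * l\<^sup>2" by (simp add: mult.assoc)
    moreover have "(fst p - fst q)\<^sup>2 \<le> l\<^sup>2" using p q l by (intro power2_le_iff_abs_le[THEN iffD2]) auto
    ultimately have A2: "planar_sq p q \<theta> \<le> 17 * l\<^sup>2" by (simp add: planar_sq_def)
    have x: "(snd p - snd q)\<^sup>2 \<le> l\<^sup>2" using p q l by (intro power2_le_iff_abs_le[THEN iffD2]) auto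
    have y: "4 * l\<^sup>2 \<le> (snd p + snd q)\<^sup>2"
      using power_mono[of "2 * l" "snd p + snd q" 2] p q l by (simp add: power_mult_distrib)
    have "planar_sq p (reflect q) \<theta> = planar_sq p q \<theta>" by (simp add: planar_sq_def)
    then show ?thesis
      using cube_gap_ge[OF l(1) A1 A2 x y] True by (simp add: den_planar_sq)
  qed
  have "1 / (30000 * \<rho>) = (\<integral>\<theta>. indicator {?u..2 * ?u} \<theta> * (1 / (30000 * l)) \<partial>lborel)"
    using u l r by (simp add: divide_right_mono)
  also have "\<dots> \<le> angle_integral ?f"
    unfolding set_lebesgue_integral_def
  proof (rule integral_mono)
    show "integrable lborel (\<lambda>\<theta>. indicator {?u..2 * ?u} \<theta> * (1 / (30000 * l)))"
      by (intro integrable_mult_left integrable_real_indicator) (auto simp: emeasure_lborel_Icc_eq)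
    show "integrable lborel (\<lambda>\<theta>. indicat_real {0..pi} \<theta> *\<^sub>R ?f \<theta>)"
      using borel_integrable_atLeastAtMost'[OF cf] by (simp add: set_integrable_def)
    show "indicator {?u..2 * ?u} \<theta> * (1 / (30000 * l)) \<le> indicat_real {0..pi} \<theta> *\<^sub>R ?f \<theta>" for \<theta>
      using low[of \<theta>] u pi_ge_two by (auto simp: indicator_def split: if_splits)
  qed
  finally show ?thesis unfolding gap .
qed

text \<open>Only pairs inside a common set are counted, giving the sum of (mass)^2 / c over the
  family. Splitting each mass as sqrt c times mass / sqrt c, Cauchy-Schwarz bounds this sum below by
  the square of the covered mass over the sum of the weights. The lower bound on \<open>G\<close> is
  assumed off the diagonal, which is null as no point is charged.\<close>

lemma boxes_lower_bound:
  fixes V :: "'a measure" and G :: "'a \<Rightarrow> 'a \<Rightarrow> real" and E :: "'i \<Rightarrow> 'a set" and c :: "'i \<Rightarrow> real"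
  assumes V: "finite_measure V" and I: "finite I" and E [measurable]: "\<And>i. i \<in> I \<Longrightarrow> E i \<in> sets V"
    and dis: "disjoint_family_on E I" and c: "\<And>i. i \<in> I \<Longrightarrow> 0 < c i"
    and G: "\<And>i p q. i \<in> I \<Longrightarrow> p \<in> E i \<Longrightarrow> q \<in> E i \<Longrightarrow> p \<noteq> q \<Longrightarrow> 1 / c i \<le> G p q"
    and atoms: "\<And>p. p \<in> space V \<Longrightarrow> AE q in V. q \<noteq> p"
    and A: "A \<in> sets V" "A \<subseteq> (\<Union>i\<in>I. E i)" and C: "(\<Sum>i\<in>I. c i) \<le> C" "0 < C"
  shows "ennreal ((measure V A)\<^sup>2 / C) \<le> (\<integral>\<^sup>+ p. \<integral>\<^sup>+ q. ennreal (G p q) \<partial>V \<partial>V)"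
proof -
  interpret finite_measure V by fact
  have sum_le: "(\<Sum>i\<in>I. indicator (E i) p * indicator (E i) q * ennreal (1 / c i)) \<le> ennreal (G p q)" if "p \<noteq> q" for p q
  proof (cases "\<exists>i\<in>I. p \<in> E i \<and> q \<in> E i")
    case True
    then obtain i where i: "i \<in> I" "p \<in> E i" "q \<in> E i" by auto
    have "(\<Sum>j\<in>I. indicator (E j) p * indicator (E j) q * ennreal (1 / c j)) = (\<Sum>j\<in>{i}. indicator (E j) p * indicator (E j) q * ennreal (1 / c j))"
    proof (rule sum.mono_neutral_right[OF I])
      show "\<forall>j\<in>I - {i}. indicator (E j) p * indicator (E j) q * ennreal (1 / c j) = 0"
        using dis i by (force simp: disjoint_family_on_def indicator_def)
    qed (use i in auto)
    then show ?thesis using i G[OF i that] by (simp add: ennreal_leI)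
  next
    case False
    then have "(\<Sum>j\<in>I. indicator (E j) p * indicator (E j) q * ennreal (1 / c j)) = 0"
      by (intro sum.neutral) (auto simp: indicator_def)
    then show ?thesis by simp
  qed
  have "measure V A \<le> measure V (\<Union>i\<in>I. E i)"
    using A I by (intro finite_measure_mono) auto
  also have "\<dots> = (\<Sum>i\<in>I. measure V (E i))"
    by (rule finite_measure_finite_Union[OF I _ dis]) auto
  also have "\<dots> = (\<Sum>i\<in>I. sqrt (c i) * (measure V (E i) / sqrt (c i)))"
    using c by (intro sum.cong) (auto simp: less_imp_neq[symmetric])
  finally have "(measure V A)\<^sup>2 \<le> (\<Sum>i\<in>I. sqrt (c i) * (measure V (E i) / sqrt (c i)))\<^sup>2"
    by (intro power_mono) auto
  also have "\<dots> \<le> (\<Sum>i\<in>I. (sqrt (c i))\<^sup>2) * (\<Sum>i\<in>I. (measure V (E i) / sqrt (c i))\<^sup>2)"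
    by (rule Cauchy_Schwarz_ineq_sum)
  also have "\<dots> = (\<Sum>i\<in>I. c i) * (\<Sum>i\<in>I. (measure V (E i))\<^sup>2 / c i)"
    using c by (intro arg_cong2[where f = "(*)"] sum.cong) (auto simp: power_divide less_imp_le)
  also have "\<dots> \<le> C * (\<Sum>i\<in>I. (measure V (E i))\<^sup>2 / c i)"
    using C c by (intro mult_right_mono sum_nonneg) (auto simp: less_imp_le)
  finally have "(measure V A)\<^sup>2 / C \<le> (\<Sum>i\<in>I. (measure V (E i))\<^sup>2 / c i)"
    using C by (simp add: pos_divide_le_eq mult.commute)
  then have "ennreal ((measure V A)\<^sup>2 / C) \<le> ennreal (\<Sum>i\<in>I. (measure V (E i))\<^sup>2 / c i)" by (rule ennreal_leI)
  also have "\<dots> = (\<Sum>i\<in>I. ennreal ((measure V (E i))\<^sup>2 / c i))"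
    using c by (subst sum_ennreal) (auto simp: less_imp_le)
  also have "\<dots> = (\<Sum>i\<in>I. emeasure V (E i) * emeasure V (E i) * ennreal (1 / c i))"
    using c by (intro sum.cong) (auto simp: emeasure_eq_measure ennreal_mult[symmetric] power2_eq_square less_imp_le)
  also have "\<dots> = (\<Sum>i\<in>I. \<integral>\<^sup>+ p. indicator (E i) p * (\<integral>\<^sup>+ q. indicator (E i) q * ennreal (1 / c i) \<partial>V) \<partial>V)"
    by (intro sum.cong refl) (simp add: nn_integral_multc mult.assoc)
  also have "\<dots> = (\<integral>\<^sup>+ p. (\<Sum>i\<in>I. indicator (E i) p * (\<integral>\<^sup>+ q. indicator (E i) q * ennreal (1 / c i) \<partial>V)) \<partial>V)"
    by (rule nn_integral_sum[symmetric]) auto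
  also have "\<dots> = (\<integral>\<^sup>+ p. \<integral>\<^sup>+ q. (\<Sum>i\<in>I. indicator (E i) p * indicator (E i) q * ennreal (1 / c i)) \<partial>V \<partial>V)"
  proof (intro nn_integral_cong)
    fix p
    have "(\<integral>\<^sup>+ q. (\<Sum>i\<in>I. indicator (E i) p * indicator (E i) q * ennreal (1 / c i)) \<partial>V)
        = (\<Sum>i\<in>I. \<integral>\<^sup>+ q. indicator (E i) p * indicator (E i) q * ennreal (1 / c i) \<partial>V)"
      by (rule nn_integral_sum) auto
    also have "\<dots> = (\<Sum>i\<in>I. indicator (E i) p * (\<integral>\<^sup>+ q. indicator (E i) q * ennreal (1 / c i) \<partial>V))"
      by (intro sum.cong refl) (simp add: nn_integral_cmult mult.assoc)
    finally show "(\<Sum>i\<in>I. indicator (E i) p * (\<integral>\<^sup>+ q. indicator (E i) q * ennreal (1 / c i) \<partial>V))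
        = (\<integral>\<^sup>+ q. (\<Sum>i\<in>I. indicator (E i) p * indicator (E i) q * ennreal (1 / c i)) \<partial>V)" by simp
  qed
  also have "\<dots> \<le> (\<integral>\<^sup>+ p. \<integral>\<^sup>+ q. ennreal (G p q) \<partial>V \<partial>V)"
  proof (rule nn_integral_mono, rule nn_integral_mono_AE)
    fix p assume "p \<in> space V"
    from atoms[OF this] show "AE q in V. (\<Sum>i\<in>I. indicator (E i) p * indicator (E i) q * ennreal (1 / c i)) \<le> ennreal (G p q)"
      by eventually_elim (rule sum_le, auto)
  qed
  finally show ?thesis .
qed

section \<open>Whitney squares and the sum of their weights\<close>

lemma dyadic_scale:
  fixes x \<eta> :: real
  assumes "0 < \<eta>" "\<eta> \<le> x"
  shows "\<exists>n. 2 ^ n * \<eta> \<le> x \<and> x < 2 ^ Suc n * \<eta>"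
proof -
  obtain m where m: "x / \<eta> < 2 ^ m" using real_arch_pow[of 2 "x / \<eta>"] by auto
  define k where "k = (LEAST m. x / \<eta> < 2 ^ m)"
  have k: "x / \<eta> < 2 ^ k" unfolding k_def by (rule LeastI[of _ m]) (rule m)
  have "k \<noteq> 0"
  proof
    assume "k = 0"
    then show False using k assms by (simp add: divide_less_eq_1)
  qed
  then obtain n where n: "k = Suc n" using not0_implies_Suc by blast
  have "\<not> x / \<eta> < 2 ^ n"
    using not_less_Least[of n "\<lambda>m. x / \<eta> < 2 ^ m"] n by (simp add: k_def)
  then have "2 ^ n * \<eta> \<le> x" using assms(1) by (simp add: not_less pos_le_divide_eq)
  moreover have "x < 2 ^ Suc n * \<eta>" using k assms(1) unfolding n by (simp add: pos_divide_less_eq)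
  ultimately show ?thesis by blast
qed

text \<open>Squares of side 2^n \<eta>, where n is the dyadic scale of r and j counts upwards; they
  serve the region r < z. In \<open>wide_box\<close> the roles are exchanged for z \<le> r. The side
  is thus comparable to the smaller coordinate. Taking j or i from 1 on puts the square at least one
  side away from axis and plane.\<close>

definition tall_box :: "real \<Rightarrow> nat \<times> nat \<Rightarrow> (real \<times> real) set" where
  "tall_box \<eta> = (\<lambda>(n, j). {2 ^ n * \<eta>..<2 ^ Suc n * \<eta>} \<times> {real j * (2 ^ n * \<eta>)..<real (Suc j) * (2 ^ n * \<eta>)})"

definition wide_box :: "real \<Rightarrow> nat \<times> nat \<Rightarrow> (real \<times> real) set" where
  "wide_box \<eta> = (\<lambda>(n, i). {real i * (2 ^ n * \<eta>)..<real (Suc i) * (2 ^ n * \<eta>)} \<times> {2 ^ n * \<eta>..<2 ^ Suc n * \<eta>})"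

lemma dyadic_unique:
  assumes \<eta>: "0 < \<eta>" and x: "2 ^ n * \<eta> \<le> x" "x < 2 ^ Suc n * \<eta>" "2 ^ m * \<eta> \<le> x" "x < 2 ^ Suc m * (\<eta> :: real)"
  shows "n = m"
proof -
  have "n \<le> m" if "2 ^ n * \<eta> \<le> x" "x < 2 ^ Suc m * \<eta>" for n m
  proof -
    have "2 ^ n * \<eta> < 2 ^ Suc m * \<eta>" using that by linarith
    then have "(2 :: real) ^ n < 2 ^ Suc m" using \<eta> by simp
    then have "n < Suc m" by (rule power_less_imp_less_exp[rotated]) simp
    then show ?thesis by simp
  qed
  then show ?thesis using x by (meson antisym)
qed

lemma grid_unique:
  assumes "0 < l" "real i * l \<le> x" "x < real (Suc i) * l" "real j * l \<le> x" "x < real (Suc j) * (l :: real)"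
  shows "i = j"
proof -
  have "i \<le> j" if "real i * l \<le> x" "x < real (Suc j) * l" for i j
  proof -
    have "real i * l < real (Suc j) * l" using that by linarith
    then show ?thesis using assms(1) by simp
  qed
  then show ?thesis using assms by (meson antisym)
qed

lemma grid_exists:
  assumes "0 < l" "l \<le> (x :: real)"
  shows "\<exists>i\<ge>1. real i * l \<le> x \<and> x < real (Suc i) * l"
proof -
  define i where "i = nat \<lfloor>x / l\<rfloor>"
  have "1 \<le> x / l" using assms by simp
  then have i: "1 \<le> i" "real i = of_int \<lfloor>x / l\<rfloor>" unfolding i_def by (auto simp: le_nat_iff le_floor_iff)
  then have "real i \<le> x / l" "x / l < real i + 1" by linarith+
  then show ?thesis using assms i(1) by (intro exI[of _ i]) (auto simp: pos_le_divide_eq pos_divide_less_eq add.commute)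
qed

lemma disjoint_tall_box:
  assumes \<eta>: "0 < \<eta>" shows "disjoint_family_on (tall_box \<eta>) I"
proof -
  have "n = m \<and> i = j" if "q \<in> tall_box \<eta> (n, i)" "q \<in> tall_box \<eta> (m, j)" for q n i m j
  proof -
    have "n = m"
      by (rule dyadic_unique[OF \<eta>, of _ "fst q"]) (use that in \<open>auto simp: tall_box_def\<close>)
    moreover have "i = j" if "n = m"
      by (rule grid_unique[of "2 ^ n * \<eta>" _ "snd q"]) (use \<open>q \<in> tall_box \<eta> (n, i)\<close> \<open>q \<in> tall_box \<eta> (m, j)\<close> \<eta> that in \<open>auto simp: tall_box_def\<close>)
    ultimately show ?thesis by blast
  qed
  then show ?thesis unfolding disjoint_family_on_def by fast
qed

lemma disjoint_wide_box:
  assumes \<eta>: "0 < \<eta>" shows "disjoint_family_on (wide_box \<eta>) I"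
proof -
  have "n = m \<and> i = j" if "q \<in> wide_box \<eta> (n, i)" "q \<in> wide_box \<eta> (m, j)" for q n i m j
  proof -
    have "n = m"
      by (rule dyadic_unique[OF \<eta>, of _ "snd q"]) (use that in \<open>auto simp: wide_box_def\<close>)
    moreover have "i = j" if "n = m"
      by (rule grid_unique[of "2 ^ n * \<eta>" _ "fst q"]) (use \<open>q \<in> wide_box \<eta> (n, i)\<close> \<open>q \<in> wide_box \<eta> (m, j)\<close> \<eta> that in \<open>auto simp: wide_box_def\<close>)
    ultimately show ?thesis by blast
  qed
  then show ?thesis unfolding disjoint_family_on_def by fast
qed

lemma sum_inverse_dyadic: "(\<Sum>n\<le>L. 1 / (2 ^ n * \<eta>)) \<le> 2 / (\<eta> :: real)" if "0 < \<eta>"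
proof -
  have "(\<Sum>n\<le>L. (1 / 2 :: real) ^ n) \<le> 2"
    by (induction L) (auto simp: sum_gp0)
  then have "(\<Sum>n\<le>L. (1 / 2 :: real) ^ n) / \<eta> \<le> 2 / \<eta>" using that by (intro divide_right_mono) auto
  then show ?thesis by (simp add: sum_divide_distrib power_one_over)
qed


text \<open>At side l there are at most R / l squares, each at distance at most R from the axis, so
  the scale contributes R^2 / l. The sum over scales is geometric and the smallest side
  decides.\<close>

lemma sum_dyadic_wide:
  fixes \<eta> R :: real
  assumes \<eta>: "0 < \<eta>"
  shows "(\<Sum>(n, i)\<in>(SIGMA n:{..L}. {1..nat \<lfloor>R / (2 ^ n * \<eta>)\<rfloor>}). 30000 * (real i * (2 ^ n * \<eta>))) \<le> 60000 * R\<^sup>2 / \<eta>"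
proof -
  have "(\<Sum>(n, i)\<in>(SIGMA n:{..L}. {1..nat \<lfloor>R / (2 ^ n * \<eta>)\<rfloor>}). 30000 * (real i * (2 ^ n * \<eta>)))
      = (\<Sum>n\<le>L. \<Sum>i\<in>{1..nat \<lfloor>R / (2 ^ n * \<eta>)\<rfloor>}. 30000 * (real i * (2 ^ n * \<eta>)))"
    by (rule sum.Sigma[symmetric]) auto
  also have "\<dots> \<le> (\<Sum>n\<le>L. 30000 * R\<^sup>2 * (1 / (2 ^ n * \<eta>)))"
  proof (rule sum_mono)
    fix n
    let ?l = "2 ^ n * \<eta>" and ?k = "nat \<lfloor>R / (2 ^ n * \<eta>)\<rfloor>"
    have l: "0 < ?l" using \<eta> by simp
    have k: "(real ?k)\<^sup>2 \<le> (R / ?l)\<^sup>2"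
    proof (cases "0 \<le> R / ?l")
      case True
      then have "real ?k \<le> R / ?l" by simp
      then show ?thesis by (intro power_mono) auto
    next
      case False
      then have "?k = 0" by simp
      then show ?thesis by simp
    qed
    have "(\<Sum>i\<in>{1..?k}. 30000 * (real i * ?l)) \<le> of_nat (card {1..?k}) * (30000 * (real ?k * ?l))"
      using l by (intro sum_bounded_above mult_left_mono mult_right_mono) auto
    also have "\<dots> = 30000 * ((real ?k)\<^sup>2 * ?l)" by (simp add: power2_eq_square)
    also have "\<dots> \<le> 30000 * ((R / ?l)\<^sup>2 * ?l)" using k l by (intro mult_left_mono mult_right_mono) auto
    also have "\<dots> = 30000 * R\<^sup>2 * (1 / ?l)" using l by (simp add: power2_eq_square)
    finally show "(\<Sum>i\<in>{1..?k}. 30000 * (real i * ?l)) \<le> 30000 * R\<^sup>2 * (1 / ?l)" .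
  qed
  also have "\<dots> = 30000 * R\<^sup>2 * (\<Sum>n\<le>L. 1 / (2 ^ n * \<eta>))" by (simp add: sum_distrib_left)
  also have "\<dots> \<le> 30000 * R\<^sup>2 * (2 / \<eta>)" using sum_inverse_dyadic[OF \<eta>] by (intro mult_left_mono) auto
  finally show ?thesis by simp
qed

text \<open>At side l the weight is l and there are at most H / l squares, so every scale
  contributes the same H and the number of scales is what counts.\<close>

lemma sum_dyadic_tall:
  fixes \<eta> H R :: real
  assumes \<eta>: "0 < \<eta>" and L: "2 ^ L * \<eta> \<le> R" and H: "0 \<le> H"
  shows "(\<Sum>(n, j)\<in>(SIGMA n:{..L}. {1..nat \<lfloor>H / (2 ^ n * \<eta>)\<rfloor>}). 30000 * (2 ^ n * \<eta>)) \<le> 30000 * H * (R / \<eta>)"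
proof -
  have "(\<Sum>(n, j)\<in>(SIGMA n:{..L}. {1..nat \<lfloor>H / (2 ^ n * \<eta>)\<rfloor>}). 30000 * (2 ^ n * \<eta>))
      = (\<Sum>n\<le>L. \<Sum>j\<in>{1..nat \<lfloor>H / (2 ^ n * \<eta>)\<rfloor>}. 30000 * (2 ^ n * \<eta>))"
    by (rule sum.Sigma[symmetric]) auto
  also have "\<dots> \<le> (\<Sum>n\<le>L. 30000 * H)"
  proof (rule sum_mono)
    fix n
    let ?l = "2 ^ n * \<eta>" and ?k = "nat \<lfloor>H / (2 ^ n * \<eta>)\<rfloor>"
    have l: "0 < ?l" using \<eta> by simp
    have "real ?k \<le> H / ?l" using H l by simp
    then have "real ?k * ?l \<le> H" using l by (simp add: pos_le_divide_eq)
    then show "(\<Sum>j\<in>{1..?k}. 30000 * ?l) \<le> 30000 * H" by simp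
  qed
  also have "\<dots> = 30000 * H * real (L + 1)" by simp
  also have "\<dots> \<le> 30000 * H * (R / \<eta>)"
  proof (intro mult_left_mono)
    \<comment> \<open>The number of scales is logarithmic in R/\<eta>; the crude linear bound is
      affordable because the wide squares cost R^4 anyway.\<close>
    have "L + 1 \<le> 2 ^ L" by (simp add: Suc_leI less_exp)
    then have "real (L + 1) \<le> 2 ^ L" by (metis of_nat_le_iff of_nat_numeral of_nat_power)
    also have "\<dots> \<le> R / \<eta>" using L \<eta> by (simp add: pos_le_divide_eq)
    finally show "real (L + 1) \<le> R / \<eta>" .
  qed (use H in auto)
  finally show ?thesis .
qed

text \<open>The 16 comes from working with a quarter of the mass, the next factor is the \<kappa>
  that fixes the cutoff \<eta>, and the last collects the weights of the wide squares (60000 M) and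
  the tall ones (120000 Z).\<close>

definition gap_constant :: "real \<Rightarrow> real \<Rightarrow> real \<Rightarrow> real" where
  "gap_constant \<Lambda> M Z = 16 * (8 * \<Lambda> + 8 * Z + M + 1) * (60000 * M + 120000 * Z)"

text \<open>The kernel is at least of order \<open>1 / \<rho>\<close> on a square of side \<open>l\<close> at distance \<open>\<rho> \<ge> l\<close> from
  the axis and at least \<open>l\<close> from the plane \<open>z = 0\<close>. The region \<open>\<eta> \<le> r \<le> R, \<eta> \<le> z \<le> H\<close>, which
  carries half of the mass, is covered by a Whitney family of such squares, of side comparable to
  \<open>min r z\<close>; Cauchy--Schwarz over the squares gives the bound.\<close>

lemma sym_gap_lower_bound:
  assumes V: "tame V B M" and half: "AE q in V. 0 < fst q \<and> 0 < snd q"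
    and dens: "\<And>f. f \<in> borel_measurable borel \<Longrightarrow>
        (\<integral>\<^sup>+ q. f q \<partial>V) \<le> (\<integral>\<^sup>+ q. ennreal (\<Lambda> * fst q) * indicator open_halfplane q * f q \<partial>lborel)"
    and \<Lambda>: "0 \<le> \<Lambda>" and mom: "(\<integral>\<^sup>+ q. ennreal (snd q) \<partial>V) \<le> ennreal Z" and Z: "0 < Z" and R: "1 \<le> R"
  shows "ennreal ((measure V {q. fst q \<le> R}) ^ 4 / (gap_constant \<Lambda> M Z * R ^ 4))
    \<le> (\<integral>\<^sup>+ p. \<integral>\<^sup>+ q. ennreal (sym_kern p q - sym_kern p (reflect q)) \<partial>V \<partial>V)"
proof -
  interpret finite_measure V by (rule tame_finite[OF V])
  have sV [measurable_cong]: "sets V = sets borel" by (rule tame_sets[OF V])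
  have space: "space V = UNIV" using sets_eq_imp_space_eq[OF sV] by simp
  define m where "m = measure V {q. fst q \<le> R}"
  have m0: "0 \<le> m" by (simp add: m_def)
  have "ennreal (measure V UNIV) \<le> ennreal M"
    using V space by (simp add: tame_def emeasure_eq_measure)
  then have "measure V UNIV \<le> M" using tame_nonneg[OF V] by (simp add: ennreal_le_iff)
  moreover have "m \<le> measure V UNIV" unfolding m_def by (intro finite_measure_mono) auto
  ultimately have mM: "m \<le> M" by simp
  show ?thesis
  proof (cases "m = 0")
    case True
    then show ?thesis by (simp add: m_def)
  next
    case False
    with m0 have m: "0 < m" by simp
    \<comment> \<open>The cutoffs budget the lost half of \<open>m\<close>: density at most
      \<Lambda> r gives mass at most \<Lambda> R^2 \<eta> \<le> m/8 next to the plane and \<Lambda>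
      \<eta>^2 H \<le> m/8 next to the axis, and the moment leaves at most Z/H = m/4 above height H.
      The summand M in \<kappa> ensures \<eta> \<le> 1 \<le> R.\<close>
    define \<kappa> where "\<kappa> = 8 * \<Lambda> + 8 * Z + M + 1"
    define \<eta> where "\<eta> = m / (\<kappa> * R\<^sup>2)"
    define H where "H = 4 * Z / m"
    have R2: "1 \<le> R\<^sup>2" using R by simp
    have \<kappa>: "1 \<le> \<kappa>" "M \<le> \<kappa>" "8 * \<Lambda> \<le> \<kappa>" using \<Lambda> Z m mM by (auto simp: \<kappa>_def)
    have \<eta>: "0 < \<eta>" using m \<kappa> R by (simp add: \<eta>_def)
    have H: "0 < H" using Z m by (simp add: H_def)
    have "\<eta> \<le> m / (\<kappa> * 1)" unfolding \<eta>_def using m \<kappa> R2 R by (intro divide_left_mono mult_left_mono mult_pos_pos zero_less_power) auto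
    also have "\<dots> \<le> 1" using mM \<kappa> by (simp add: divide_le_eq_1)
    finally have \<eta>R: "\<eta> \<le> R" using R by simp
    define A where "A = {q. \<eta> \<le> fst q \<and> fst q \<le> R \<and> \<eta> \<le> snd q \<and> snd q \<le> H}"
    have A_meas [measurable]: "A \<in> sets V" unfolding A_def by simp
    have rect: "measure V {q. 0 < fst q \<and> fst q \<le> a \<and> 0 < snd q \<and> snd q \<le> b} \<le> \<Lambda> * a * (a * b)"
      if ab: "0 \<le> a" "0 \<le> b" for a b
    proof -
      let ?S = "{q. 0 < fst q \<and> fst q \<le> a \<and> 0 < snd q \<and> snd q \<le> b} :: (real \<times> real) set"
      have S: "?S = {0<..a} \<times> {0<..b}" by auto
      have "emeasure V ?S = (\<integral>\<^sup>+ q. indicator ?S q \<partial>V)" by (subst nn_integral_indicator) auto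
      also have "\<dots> \<le> (\<integral>\<^sup>+ q. ennreal (\<Lambda> * fst q) * indicator open_halfplane q * indicator ?S q \<partial>lborel)"
        by (rule dens) simp
      also have "\<dots> \<le> (\<integral>\<^sup>+ q. ennreal (\<Lambda> * a) * indicator ?S q \<partial>lborel)"
        using \<Lambda> by (intro nn_integral_mono) (auto simp: indicator_def intro!: ennreal_leI mult_left_mono)
      also have "\<dots> = ennreal (\<Lambda> * a) * emeasure lborel ?S"
        by (rule nn_integral_cmult_indicator) simp
      also have "emeasure lborel ?S = ennreal (a * b)"
        unfolding S using ab by (simp add: lborel_prod[symmetric] lborel.emeasure_pair_measure_Times ennreal_mult)
      also have "ennreal (\<Lambda> * a) * ennreal (a * b) = ennreal (\<Lambda> * a * (a * b))"
        using \<Lambda> ab by (subst ennreal_mult[symmetric]) auto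
      finally show ?thesis using \<Lambda> ab by (simp add: emeasure_eq_measure ennreal_le_iff)
    qed
    have S1: "measure V {q. 0 < fst q \<and> fst q \<le> \<eta> \<and> 0 < snd q \<and> snd q \<le> H} \<le> m / 8"
    proof -
      have "32 * (\<Lambda> * Z) \<le> \<kappa> * \<kappa>"
      proof -
        have "(8 * \<Lambda> + 8 * Z) * (8 * \<Lambda> + 8 * Z) \<le> \<kappa> * \<kappa>"
          using \<Lambda> Z m mM by (intro mult_mono) (auto simp: \<kappa>_def)
        moreover have "32 * (\<Lambda> * Z) \<le> (8 * \<Lambda> + 8 * Z) * (8 * \<Lambda> + 8 * Z)"
          using \<Lambda> Z by (simp add: algebra_simps add_nonneg_nonneg)
        ultimately show ?thesis by linarith
      qed
      then have "32 * (\<Lambda> * Z) * 1 \<le> \<kappa> * \<kappa> * (R\<^sup>2 * R\<^sup>2)"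
        by (rule mult_mono) (use R2 \<kappa> mult_mono[OF R2 R2] in auto)
      then have "32 * (\<Lambda> * Z) * m \<le> \<kappa> * \<kappa> * (R\<^sup>2 * R\<^sup>2) * m"
        using m by (intro mult_right_mono) auto
      then have "\<Lambda> * \<eta> * (\<eta> * H) \<le> m / 8"
        using m \<kappa> R by (simp add: \<eta>_def H_def divide_simps) (simp add: ac_simps)
      then show ?thesis using rect[of \<eta> H] \<eta> H by simp
    qed
    have S2: "measure V {q. 0 < fst q \<and> fst q \<le> R \<and> 0 < snd q \<and> snd q \<le> \<eta>} \<le> m / 8"
    proof -
      have "\<Lambda> * R * (R * \<eta>) = \<Lambda> * m / \<kappa>" using \<kappa> R by (simp add: \<eta>_def power2_eq_square)
      also have "\<dots> \<le> m / 8" using \<kappa> m mult_right_mono[OF \<kappa>(3), of m] by (simp add: divide_simps ac_simps)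
      finally show ?thesis using rect[of R \<eta>] \<eta> R by simp
    qed
    have S3: "measure V {q. H < snd q} \<le> m / 4"
    proof -
      have "ennreal H * emeasure V {q. H < snd q} = (\<integral>\<^sup>+ q. ennreal H * indicator {q. H < snd q} q \<partial>V)"
        by (subst nn_integral_cmult_indicator) auto
      also have "\<dots> \<le> (\<integral>\<^sup>+ q. ennreal (snd q) \<partial>V)"
        by (intro nn_integral_mono) (auto simp: indicator_def intro!: ennreal_leI)
      also have "\<dots> \<le> ennreal Z" by (rule mom)
      finally have "H * measure V {q. H < snd q} \<le> Z"
        using H Z by (simp add: emeasure_eq_measure ennreal_mult[symmetric] ennreal_le_iff)
      then show ?thesis using m Z by (simp add: H_def field_simps)
    qed
    have half_mass: "m / 2 \<le> measure V A"
    proof -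
      let ?S1 = "{q. 0 < fst q \<and> fst q \<le> \<eta> \<and> 0 < snd q \<and> snd q \<le> H} :: (real \<times> real) set"
      let ?S2 = "{q. 0 < fst q \<and> fst q \<le> R \<and> 0 < snd q \<and> snd q \<le> \<eta>} :: (real \<times> real) set"
      let ?S3 = "{q. H < snd q} :: (real \<times> real) set"
      have "m \<le> measure V (A \<union> (?S1 \<union> (?S2 \<union> ?S3)))"
        unfolding m_def
      proof (rule finite_measure_mono_AE)
        show "AE q in V. q \<in> {q. fst q \<le> R} \<longrightarrow> q \<in> A \<union> (?S1 \<union> (?S2 \<union> ?S3))"
          using half by eventually_elim (auto simp: A_def)
      qed simp
      also have "\<dots> \<le> measure V A + (measure V ?S1 + (measure V ?S2 + measure V ?S3))"
        by (intro order_trans[OF measure_Un_le] add_left_mono) auto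
      finally show ?thesis using S1 S2 S3 by linarith
    qed
    obtain L where L: "2 ^ L * \<eta> \<le> R" "R < 2 ^ Suc L * \<eta>" using dyadic_scale[OF \<eta> \<eta>R] by blast
    have nL: "n \<le> L" if "2 ^ n * \<eta> \<le> x" "x \<le> R" for n x
    proof -
      have "2 ^ n * \<eta> < 2 ^ Suc L * \<eta>" using that L by linarith
      then have "(2 :: real) ^ n < 2 ^ Suc L" using \<eta> by simp
      then have "n < Suc L" by (rule power_less_imp_less_exp[rotated]) simp
      then show ?thesis by simp
    qed
    have inat: "i \<in> {1..nat \<lfloor>x / l\<rfloor>}" if "1 \<le> i" "real i * l \<le> x" "0 < l" for i :: nat and x l :: real
    proof -
      have "real i \<le> x / l" using that by (simp add: pos_le_divide_eq)
      then show ?thesis using that(1) by (auto simp: le_nat_floor)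
    qed
    \<comment> \<open>One bound for both families: the wide squares weigh the order of R^4 / m, the
      tall ones R^3 / m^2, and m \<le> M and R \<ge> 1 bring both to R^4 / m^2.\<close>
    define C where "C = R ^ 4 / m\<^sup>2 * (\<kappa> * (60000 * M + 120000 * Z))"
    have C0: "0 < C" using R m \<kappa> mM Z unfolding C_def by (intro mult_pos_pos divide_pos_pos add_nonneg_pos) auto
    have C1: "60000 * R\<^sup>2 / \<eta> \<le> C"
    proof -
      have "60000 * R\<^sup>2 / \<eta> = R ^ 4 / m\<^sup>2 * (\<kappa> * (60000 * m))"
        using m \<kappa> R by (simp add: \<eta>_def field_simps eval_nat_numeral)
      also have "\<dots> \<le> C" unfolding C_def using m mM Z \<kappa> R by (intro mult_left_mono) auto
      finally show ?thesis .
    qed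
    have C2: "30000 * H * (R / \<eta>) \<le> C"
    proof -
      have "30000 * H * (R / \<eta>) = R ^ 3 / m\<^sup>2 * (\<kappa> * (120000 * Z))"
        using m \<kappa> R by (simp add: \<eta>_def H_def field_simps eval_nat_numeral)
      also have "\<dots> \<le> R ^ 4 / m\<^sup>2 * (\<kappa> * (60000 * M + 120000 * Z))"
        using m mM Z \<kappa> R by (intro mult_mono divide_right_mono power_increasing mult_left_mono) auto
      finally show ?thesis by (simp add: C_def)
    qed
    let ?D = "\<integral>\<^sup>+ p. \<integral>\<^sup>+ q. ennreal (sym_kern p q - sym_kern p (reflect q)) \<partial>V \<partial>V"
    \<comment> \<open>At least one of the two parts carries a quarter of \<open>m\<close>, so each
      family may be treated on its own.\<close>
    let ?A1 = "A \<inter> {q. snd q \<le> fst q}" and ?A2 = "A \<inter> {q. fst q < snd q}"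
    have box_sets: "wide_box \<eta> x \<in> sets V" "tall_box \<eta> x \<in> sets V" for x
      unfolding sV wide_box_def tall_box_def by (auto simp: split_beta borel_prod[symmetric])
    have D1: "ennreal ((measure V ?A1)\<^sup>2 / C) \<le> ?D"
    proof (rule boxes_lower_bound[OF finite_measure_axioms _ box_sets(1) disjoint_wide_box[OF \<eta>]])
      show "finite (SIGMA n:{..L}. {1..nat \<lfloor>R / (2 ^ n * \<eta>)\<rfloor>})" by auto
      show "0 < (case x of (n, i) \<Rightarrow> 30000 * (real i * (2 ^ n * \<eta>)))"
        if "x \<in> (SIGMA n:{..L}. {1..nat \<lfloor>R / (2 ^ n * \<eta>)\<rfloor>})" for x
        using that \<eta> by auto
      show "1 / (case x of (n, i) \<Rightarrow> 30000 * (real i * (2 ^ n * \<eta>))) \<le> sym_kern p q - sym_kern p (reflect q)"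
        if x: "x \<in> (SIGMA n:{..L}. {1..nat \<lfloor>R / (2 ^ n * \<eta>)\<rfloor>})" and "p \<in> wide_box \<eta> x" "q \<in> wide_box \<eta> x" "p \<noteq> q" for x p q
      proof -
        obtain n i where xi: "x = (n, i)" "1 \<le> i" using x by auto
        have "2 ^ n * \<eta> \<le> real i * (2 ^ n * \<eta>)" using xi \<eta> by simp
        then have "1 / (30000 * (real i * (2 ^ n * \<eta>))) \<le> sym_kern p q - sym_kern p (reflect q)"
        proof -
          have "real i * (2 ^ n * \<eta>) \<le> fst x \<and> fst x \<le> real i * (2 ^ n * \<eta>) + 2 ^ n * \<eta> \<and> 2 ^ n * \<eta> \<le> snd x \<and> snd x \<le> 2 ^ n * \<eta> + 2 ^ n * \<eta>"
            if "x \<in> wide_box \<eta> (n, i)" for x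
            using that by (auto simp: wide_box_def algebra_simps)
          from this[of p] this[of q] show ?thesis
            using that \<eta> \<open>2 ^ n * \<eta> \<le> real i * (2 ^ n * \<eta>)\<close> unfolding xi
            by (intro sym_gap_box[of "2 ^ n * \<eta>" _ "2 ^ n * \<eta>"]) auto
        qed
        then show ?thesis by (simp add: xi)
      qed
      show "AE q in V. q \<noteq> p" for p by (rule tame_AE_neq[OF V])
      show "?A1 \<subseteq> (\<Union>x\<in>(SIGMA n:{..L}. {1..nat \<lfloor>R / (2 ^ n * \<eta>)\<rfloor>}). wide_box \<eta> x)"
      proof
        fix q assume q: "q \<in> ?A1"
        then obtain n where n: "2 ^ n * \<eta> \<le> snd q" "snd q < 2 ^ Suc n * \<eta>"
          using dyadic_scale[OF \<eta>, of "snd q"] by (auto simp: A_def)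
        obtain i where i: "1 \<le> i" "real i * (2 ^ n * \<eta>) \<le> fst q" "fst q < real (Suc i) * (2 ^ n * \<eta>)"
          using grid_exists[of "2 ^ n * \<eta>" "fst q"] n q \<eta> by auto
        have "n \<le> L" using nL[of n "snd q"] n q by (auto simp: A_def)
        moreover have "i \<in> {1..nat \<lfloor>R / (2 ^ n * \<eta>)\<rfloor>}"
          using i q \<eta> by (intro inat) (auto simp: A_def)
        moreover have "q \<in> wide_box \<eta> (n, i)" using n i by (cases q) (auto simp: wide_box_def)
        ultimately show "q \<in> (\<Union>x\<in>(SIGMA n:{..L}. {1..nat \<lfloor>R / (2 ^ n * \<eta>)\<rfloor>}). wide_box \<eta> x)" by blast
      qed
      show "(\<Sum>x\<in>(SIGMA n:{..L}. {1..nat \<lfloor>R / (2 ^ n * \<eta>)\<rfloor>}). case x of (n, i) \<Rightarrow> 30000 * (real i * (2 ^ n * \<eta>))) \<le> C"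
        using sum_dyadic_wide[OF \<eta>, of L R] C1 by linarith
    qed (use C0 in auto)
    have D2: "ennreal ((measure V ?A2)\<^sup>2 / C) \<le> ?D"
    proof (rule boxes_lower_bound[OF finite_measure_axioms _ box_sets(2) disjoint_tall_box[OF \<eta>]])
      show "finite (SIGMA n:{..L}. {1..nat \<lfloor>H / (2 ^ n * \<eta>)\<rfloor>})" by auto
      show "0 < (case x of (n, j) \<Rightarrow> 30000 * (2 ^ n * \<eta>))"
        if "x \<in> (SIGMA n:{..L}. {1..nat \<lfloor>H / (2 ^ n * \<eta>)\<rfloor>})" for x :: "nat \<times> nat"
        using that \<eta> by auto
      show "1 / (case x of (n, j) \<Rightarrow> 30000 * (2 ^ n * \<eta>)) \<le> sym_kern p q - sym_kern p (reflect q)"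
        if x: "x \<in> (SIGMA n:{..L}. {1..nat \<lfloor>H / (2 ^ n * \<eta>)\<rfloor>})" and "p \<in> tall_box \<eta> x" "q \<in> tall_box \<eta> x" "p \<noteq> q" for x p q
      proof -
        obtain n j where xj: "x = (n, j)" "1 \<le> j" using x by auto
        have "2 ^ n * \<eta> \<le> real j * (2 ^ n * \<eta>)" using xj \<eta> by simp
        then have "1 / (30000 * (2 ^ n * \<eta>)) \<le> sym_kern p q - sym_kern p (reflect q)"
        proof -
          have "2 ^ n * \<eta> \<le> fst x \<and> fst x \<le> 2 ^ n * \<eta> + 2 ^ n * \<eta> \<and> real j * (2 ^ n * \<eta>) \<le> snd x \<and> snd x \<le> real j * (2 ^ n * \<eta>) + 2 ^ n * \<eta>"
            if "x \<in> tall_box \<eta> (n, j)" for x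
            using that by (auto simp: tall_box_def algebra_simps)
          from this[of p] this[of q] show ?thesis
            using that \<eta> \<open>2 ^ n * \<eta> \<le> real j * (2 ^ n * \<eta>)\<close> unfolding xj
            by (intro sym_gap_box[of "2 ^ n * \<eta>" _ "real j * (2 ^ n * \<eta>)"]) auto
        qed
        then show ?thesis by (simp add: xj)
      qed
      show "AE q in V. q \<noteq> p" for p by (rule tame_AE_neq[OF V])
      show "?A2 \<subseteq> (\<Union>x\<in>(SIGMA n:{..L}. {1..nat \<lfloor>H / (2 ^ n * \<eta>)\<rfloor>}). tall_box \<eta> x)"
      proof
        fix q assume q: "q \<in> ?A2"
        then obtain n where n: "2 ^ n * \<eta> \<le> fst q" "fst q < 2 ^ Suc n * \<eta>"
          using dyadic_scale[OF \<eta>, of "fst q"] by (auto simp: A_def)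
        obtain j where j: "1 \<le> j" "real j * (2 ^ n * \<eta>) \<le> snd q" "snd q < real (Suc j) * (2 ^ n * \<eta>)"
          using grid_exists[of "2 ^ n * \<eta>" "snd q"] n q \<eta> by auto
        have "n \<le> L" using nL[of n "fst q"] n q by (auto simp: A_def)
        moreover have "j \<in> {1..nat \<lfloor>H / (2 ^ n * \<eta>)\<rfloor>}"
          using j q \<eta> by (intro inat) (auto simp: A_def)
        moreover have "q \<in> tall_box \<eta> (n, j)" using n j by (cases q) (auto simp: tall_box_def)
        ultimately show "q \<in> (\<Union>x\<in>(SIGMA n:{..L}. {1..nat \<lfloor>H / (2 ^ n * \<eta>)\<rfloor>}). tall_box \<eta> x)" by blast
      qed
      show "(\<Sum>x\<in>(SIGMA n:{..L}. {1..nat \<lfloor>H / (2 ^ n * \<eta>)\<rfloor>}). case x of (n, j) \<Rightarrow> 30000 * (2 ^ n * \<eta>)) \<le> C"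
        using sum_dyadic_tall[OF \<eta> L(1), of H] C2 H by linarith
    qed (use C0 in auto)
    have "A \<subseteq> ?A1 \<union> ?A2" by auto
    then have "measure V A \<le> measure V ?A1 + measure V ?A2"
      by (intro order_trans[OF finite_measure_mono measure_Un_le]) auto
    then consider "m / 4 \<le> measure V ?A1" | "m / 4 \<le> measure V ?A2" using half_mass by linarith
    then have "ennreal ((m / 4)\<^sup>2 / C) \<le> ?D"
    proof cases
      case 1
      then have "(m / 4)\<^sup>2 / C \<le> (measure V ?A1)\<^sup>2 / C" using m C0 by (intro divide_right_mono power_mono) auto
      then show ?thesis using D1 ennreal_leI order_trans by blast
    next
      case 2
      then have "(m / 4)\<^sup>2 / C \<le> (measure V ?A2)\<^sup>2 / C" using m C0 by (intro divide_right_mono power_mono) auto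
      then show ?thesis using D2 ennreal_leI order_trans by blast
    qed
    moreover have "(m / 4)\<^sup>2 / C = m ^ 4 / (gap_constant \<Lambda> M Z * R ^ 4)"
    proof -
      have "(m / 4)\<^sup>2 / (x / m\<^sup>2 * (\<kappa> * g)) = m ^ 4 / (16 * \<kappa> * g * x)" if "0 < x" "0 < g" for x g
        using that m \<kappa>(1) by (simp add: field_simps eval_nat_numeral)
      moreover have "0 < 60000 * M + 120000 * Z" using m mM Z by simp
      ultimately show ?thesis
        using R unfolding C_def gap_constant_def \<kappa>_def[symmetric] by simp
    qed
    ultimately show ?thesis by (simp add: m_def)
  qed
qed

subsection \<open>Flows with odd vorticity\<close>

lemma measurable_reflect [measurable]: "reflect \<in> borel_measurable borel"
  unfolding reflect_def by (intro borel_measurable_continuous_onI continuous_intros)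

lemma reflect_open_halfplane [simp]: "reflect q \<in> open_halfplane \<longleftrightarrow> q \<in> open_halfplane"
  by (auto simp: open_halfplane_def reflect_def)

lemma dist_reflect [simp]: "dist (reflect a) (reflect b) = dist a b"
  by (simp add: dist_prod_def dist_real_def abs_minus_commute)

lemma den_reflect: "den (reflect a) (reflect b) = den a b"
  by (simp add: den_eq fun_eq_iff)

lemma den_reflect_fst: "den (reflect a) b = den a (reflect b)"
  using den_reflect[of a "reflect b"] by simp

lemma kern_num_r_reflect: "kern num_r (reflect a) (reflect b) = - kern num_r a b"
proof -
  have "(\<lambda>\<theta>. fst b * num_r (reflect a) (reflect b) \<theta> / den a b \<theta> ^ 3) = (\<lambda>\<theta>. (-1) * (fst b * num_r a b \<theta> / den a b \<theta> ^ 3))"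
    by (intro ext) (simp add: num_r_def algebra_simps diff_divide_distrib)
  then show ?thesis unfolding kern_def den_reflect reflect_simps by (simp only: set_integral_mult_right)
qed

lemma kern_num_z_reflect: "kern num_z (reflect a) (reflect b) = kern num_z a b"
  unfolding kern_def den_reflect by (simp add: num_z_def)

lemma kern_num_z_reflect_fst: "kern num_z (reflect a) b = kern num_z a (reflect b)"
  unfolding kern_def den_reflect_fst by (simp add: num_z_def)

lemma distr_reflect_lborel: "distr lborel borel reflect = (lborel :: (real \<times> real) measure)"
proof -
  have "distr lborel borel reflect = distr (lborel \<Otimes>\<^sub>M lborel) (borel \<Otimes>\<^sub>M borel) (\<lambda>(x :: real, y :: real). (x, - y))"
    unfolding lborel_prod borel_prod by (intro arg_cong2[where f = "distr lborel"] refl ext) (auto simp: reflect_def)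
  also have "\<dots> = distr lborel borel (\<lambda>x :: real. x) \<Otimes>\<^sub>M distr lborel borel (\<lambda>y :: real. - y)"
    using lborel_distr_uminus
    by (subst pair_measure_distr) (auto simp: lborel.sigma_finite_measure_axioms)
  also have "\<dots> = lborel"
    using lborel_distr_uminus by (simp add: distr_id2 lborel_prod)
  finally show ?thesis .
qed

lemma tame_reflect:
  assumes V: "tame V B M" shows "tame (distr V borel reflect) B M"
proof -
  have [measurable_cong]: "sets V = sets borel" by (rule tame_sets[OF V])
  have sp: "space V = UNIV" using sets_eq_imp_space_eq[OF tame_sets[OF V]] by simp
  have "(\<integral>\<^sup>+ q. f q \<partial>distr V borel reflect) \<le> ennreal B * (\<integral>\<^sup>+ q. f q \<partial>lborel)" if [measurable]: "f \<in> borel_measurable borel" for f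
  proof -
    have "(\<integral>\<^sup>+ q. f q \<partial>distr V borel reflect) = (\<integral>\<^sup>+ q. f (reflect q) \<partial>V)"
      by (rule nn_integral_distr) auto
    also have "\<dots> \<le> ennreal B * (\<integral>\<^sup>+ q. f (reflect q) \<partial>lborel)"
    proof -
      have "(\<lambda>q. f (reflect q)) \<in> borel_measurable borel" by measurable
      then show ?thesis using V unfolding tame_def by blast
    qed
    also have "(\<integral>\<^sup>+ q. f (reflect q) \<partial>lborel) = (\<integral>\<^sup>+ q. f q \<partial>distr lborel borel reflect)"
      by (rule nn_integral_distr[symmetric]) auto
    finally show ?thesis by (simp only: distr_reflect_lborel)
  qed
  then show ?thesis using V by (auto simp: tame_def emeasure_distr sp)
qed

text \<open>The Euler equations reduced to what the argument needs of the flow. The sup bound B may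
  depend on T, whereas \<Lambda>, M and Z do not; only these three may enter the final
  estimate.\<close>

locale odd_flow =
  fixes W :: "(real \<times> real) measure" and X :: "real \<Rightarrow> real \<times> real \<Rightarrow> real \<times> real" and \<Lambda> M Z :: real
  assumes sets_W [measurable_cong]: "sets W = sets borel"
    and AE_W: "AE q in W. q \<in> open_halfplane"
    and finite_W: "finite_measure W"
    and W_reflect: "distr W borel reflect = W"
    and X_init: "\<And>p. p \<in> open_halfplane \<Longrightarrow> X 0 p = p"
    and X_inj: "\<And>t. 0 \<le> t \<Longrightarrow> inj_on (X t) open_halfplane"
    and flow: "\<And>T. 0 \<le> T \<Longrightarrow> \<exists>B. lagrangian_flow W (\<lambda>q. sgn (snd q)) B M T X"
    and dens: "\<And>t f. 0 \<le> t \<Longrightarrow> f \<in> borel_measurable borel \<Longrightarrow>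
        (\<integral>\<^sup>+ q. f (X t q) \<partial>W) \<le> (\<integral>\<^sup>+ q. ennreal (\<Lambda> * fst q) * indicator open_halfplane q * f q \<partial>lborel)"
    and \<Lambda>: "0 \<le> \<Lambda>" and M: "0 \<le> M" and Z: "0 < Z"
    and moment: "(\<integral>\<^sup>+ q. ennreal (snd q) \<partial>W) \<le> ennreal Z"
begin

abbreviation "sg \<equiv> (\<lambda>q :: real \<times> real. sgn (snd q))"

sublocale signed_measure W sg
proof (rule signed_measure.intro)
  show "sg \<in> borel_measurable borel" unfolding sgn_real_def by measurable
  show "\<bar>sg q\<bar> \<le> 1" for q by (simp add: sgn_real_def)
qed (fact sets_W AE_W finite_W)+

lemma X_measurable: "0 \<le> t \<Longrightarrow> X t \<in> borel_measurable borel"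
  and X_halfplane: "0 \<le> t \<Longrightarrow> p \<in> open_halfplane \<Longrightarrow> X t p \<in> open_halfplane"
  using flow[of t] by (auto simp: lagrangian_flow_def)

lemma X_continuous:
  assumes p: "p \<in> open_halfplane" shows "continuous_on {0..} (\<lambda>t. X t p)"
proof -
  have "continuous_on {0..T} (\<lambda>t. X t p)" if T: "0 \<le> T" for T
  proof -
    obtain B where "lagrangian_flow W sg B M T X" using flow[OF T] by blast
    then have "continuous_on {0..T} (\<lambda>t. fst (X t p))" "continuous_on {0..T} (\<lambda>t. snd (X t p))"
      using p by (auto simp: lagrangian_flow_def intro!: DERIV_continuous_on)
    from continuous_on_Pair[OF this] show ?thesis by simp
  qed
  note c = this
  show ?thesis
    unfolding continuous_on_eq_continuous_within
  proof
    fix t :: real assume t: "t \<in> {0..}"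
    have "continuous (at t within {0..t + 1}) (\<lambda>t. X t p)"
      using c[of "t + 1"] t by (auto simp: continuous_on_eq_continuous_within)
    moreover have "at t within {0..t + 1} = at t within {0..}"
      by (rule at_within_nhd[of _ "{..<t + 1}"]) (use t in auto)
    ultimately show "continuous (at t within {0..}) (\<lambda>t. X t p)" by (simp only:)
  qed
qed

lemma integral_reflect:
  assumes [measurable]: "g \<in> borel_measurable borel"
  shows "(\<integral>q. g (reflect q) \<partial>W) = (\<integral>q. g q \<partial>W :: real)"
  by (subst (2) W_reflect[symmetric], subst integral_distr) auto

text \<open>The flow seen in the mirror z = 0, to be identified with \<open>X\<close> by
  uniqueness.\<close>

definition "Y t p = reflect (X t (reflect p))"

lemma Y_measurable: "0 \<le> t \<Longrightarrow> Y t \<in> borel_measurable borel"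
  unfolding Y_def using X_measurable[of t] by measurable

text \<open>\<open>W\<close> is invariant under reflection and the sign is odd; the kernel of u_r
  changes sign when both points are reflected, the kernel of u_z does not.\<close>

lemma velocity_reflect:
  assumes t: "0 \<le> t"
  shows "lagrangian_velocity W sg num_r (X t) (reflect p) = lagrangian_velocity W sg num_r (Y t) p"
    and "lagrangian_velocity W sg num_z (X t) (reflect p) = - lagrangian_velocity W sg num_z (Y t) p"
proof -
  note [measurable] = X_measurable[OF t] Y_measurable[OF t] measurable_kern_pair[OF admissible_num_r] measurable_kern_pair[OF admissible_num_z]
  have XY: "X t (reflect q) = reflect (Y t q)" for q by (simp add: Y_def)
  have "(\<integral>q. sg q * kern num_r (reflect p) (X t q) \<partial>W) = (\<integral>q. sg (reflect q) * kern num_r (reflect p) (X t (reflect q)) \<partial>W)"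
    by (rule integral_reflect[symmetric]) measurable
  also have "\<dots> = (\<integral>q. sg q * kern num_r p (Y t q) \<partial>W)"
    unfolding XY kern_num_r_reflect by (simp add: sgn_minus)
  finally show "lagrangian_velocity W sg num_r (X t) (reflect p) = lagrangian_velocity W sg num_r (Y t) p"
    by (simp add: lagrangian_velocity_def)
  have "(\<integral>q. sg q * kern num_z (reflect p) (X t q) \<partial>W) = (\<integral>q. sg (reflect q) * kern num_z (reflect p) (X t (reflect q)) \<partial>W)"
    by (rule integral_reflect[symmetric]) measurable
  also have "\<dots> = - (\<integral>q. sg q * kern num_z p (Y t q) \<partial>W)"
    unfolding XY kern_num_z_reflect by (simp add: sgn_minus)
  finally show "lagrangian_velocity W sg num_z (X t) (reflect p) = - lagrangian_velocity W sg num_z (Y t) p"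
    by (simp add: lagrangian_velocity_def)
qed

lemma Y_flow:
  assumes X: "lagrangian_flow W sg B M T X"
  shows "lagrangian_flow W sg B M T Y"
  unfolding lagrangian_flow_def
proof (intro ballI conjI)
  fix t assume t: "t \<in> {0..T}"
  then have t0: "0 \<le> t" by simp
  note [measurable] = X_measurable[OF t0] Y_measurable[OF t0]
  show "Y t \<in> borel_measurable borel" by (rule Y_measurable[OF t0])
  have "distr W borel (Y t) = distr (distr W borel reflect) borel (Y t)" by (simp add: W_reflect)
  also have "\<dots> = distr (distr W borel (X t)) borel reflect"
    by (subst distr_distr, measurable, subst distr_distr, measurable) (simp add: comp_def Y_def)
  finally show "tame (distr W borel (Y t)) B M"
    using X t by (simp add: tame_reflect lagrangian_flow_def)
  fix p assume p: "p \<in> open_halfplane"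
  show "Y t p \<in> open_halfplane" using X_halfplane[OF t0, of "reflect p"] p by (simp add: Y_def)
  have XY: "X t (reflect p) = reflect (Y t p)" by (simp add: Y_def)
  have "reflect p \<in> open_halfplane" using p by simp
  then have d: "((\<lambda>u. fst (X u (reflect p))) has_real_derivative lagrangian_velocity W sg num_r (X t) (X t (reflect p))) (at t within {0..T})"
    "((\<lambda>u. snd (X u (reflect p))) has_real_derivative lagrangian_velocity W sg num_z (X t) (X t (reflect p))) (at t within {0..T})"
    using X t unfolding lagrangian_flow_def by blast+
  show "((\<lambda>u. fst (Y u p)) has_real_derivative lagrangian_velocity W sg num_r (Y t) (Y t p)) (at t within {0..T})"
    using d(1) unfolding XY velocity_reflect[OF t0] by (simp add: Y_def)
  show "((\<lambda>u. snd (Y u p)) has_real_derivative lagrangian_velocity W sg num_z (Y t) (Y t p)) (at t within {0..T})"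
    using DERIV_minus[OF d(2)] unfolding XY velocity_reflect[OF t0] by (simp add: Y_def)
qed

text \<open>Uniqueness gives a null set for each time. Rational times need only countably many of
  them, and continuity of the trajectories extends the identity to all times.\<close>

lemma X_eq_Y: "AE p in W. \<forall>t\<ge>0. X t p = Y t p"
proof -
  have 1: "AE p in W. X t p = Y t p" if t: "0 \<le> t" for t
  proof -
    obtain B where X: "lagrangian_flow W sg B M t X" using flow[OF t] by blast
    then have "0 \<le> B" using t by (auto simp: lagrangian_flow_def dest: tame_nonneg)
    then show ?thesis
      using t M by (intro lagrangian_flow_unique[OF X Y_flow[OF X]]) (auto simp: Y_def X_init)
  qed
  have "AE p in W. \<forall>t\<in>\<rat> \<inter> {0..}. X t p = Y t p"
    by (subst AE_ball_countable) (auto intro: countable_Int1 countable_rat 1)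
  then show ?thesis
    using AE_W
  proof eventually_elim
    case (elim p)
    have cX: "continuous_on {0..} (\<lambda>t. X t p)" by (rule X_continuous) fact
    have cY: "continuous_on {0..} (\<lambda>t. Y t p)"
    proof -
      have Yp: "Y t p = (fst (X t (reflect p)), - snd (X t (reflect p)))" for t
        by (simp add: prod_eq_iff Y_def)
      have "continuous_on {0..} (\<lambda>t. X t (reflect p))" by (rule X_continuous) (use elim in simp)
      then show ?thesis unfolding Yp by (intro continuous_intros)
    qed
    have c0: "continuous_on {0..} (\<lambda>t. dist (X t p) (Y t p))" by (intro continuous_intros cX cY)
    have "dist (X t p) (Y t p) = 0" if t: "0 \<le> t" for t
    proof (rule ccontr)
      assume n: "dist (X t p) (Y t p) \<noteq> 0"
      have "\<exists>d>0. \<forall>u\<in>{0..}. dist u t < d \<longrightarrow> dist (dist (X u p) (Y u p)) (dist (X t p) (Y t p)) < dist (X t p) (Y t p)"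
        using c0[unfolded continuous_on_iff, rule_format, of t "dist (X t p) (Y t p)"] t n by (auto simp: dist_commute)
      then obtain d where d: "0 < d" "\<And>u. 0 \<le> u \<Longrightarrow> dist u t < d \<Longrightarrow> dist (dist (X u p) (Y u p)) (dist (X t p) (Y t p)) < dist (X t p) (Y t p)"
        by auto
      obtain u where u: "u \<in> \<rat>" "t < u" "u < t + d" using Rats_dense_in_real[of t "t + d"] d(1) by auto
      then have "dist (X u p) (Y u p) = 0" using elim t by auto
      then show False using d(2)[of u] u t by (auto simp: dist_real_def)
    qed
    then show ?case by simp
  qed
qed

lemma upper_invariant: "AE p in W. 0 < snd p \<longrightarrow> (\<forall>t\<ge>0. 0 < snd (X t p))"
  using X_eq_Y AE_W
proof eventually_elim
  case (elim p)
  show ?case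
  proof (intro impI allI)
    fix t :: real assume p: "0 < snd p" and t: "0 \<le> t"
    have nz: "snd (X u p) \<noteq> 0" if u: "0 \<le> u" for u
    proof
      assume "snd (X u p) = 0"
      then have "X u p = reflect (X u p)" by (simp add: reflect_def prod_eq_iff)
      also have "\<dots> = X u (reflect p)" using elim u by (simp add: Y_def)
      finally have "p = reflect p" using X_inj[OF u] elim by (auto dest!: inj_onD)
      then show False using p by (simp add: reflect_def prod_eq_iff)
    qed
    show "0 < snd (X t p)"
    proof (rule ccontr)
      assume "\<not> 0 < snd (X t p)"
      moreover have "0 < snd (X 0 p)" using p X_init[OF elim(2)] by (simp only:)
      moreover have "continuous_on {0..t} (\<lambda>u. snd (X u p))"
        using X_continuous[of p] elim by (intro continuous_on_snd) (auto elim: continuous_on_subset)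
      ultimately obtain u where "0 \<le> u" "u \<le> t" "snd (X u p) = 0"
        using IVT2'[of "\<lambda>u. snd (X u p)" t 0 0] t by auto
      then show False using nz by blast
    qed
  qed
qed

end

section \<open>The upper half and the decay of its moment\<close>

definition gap :: "real \<times> real \<Rightarrow> real \<times> real \<Rightarrow> real" where
  "gap p q = sym_kern p q - sym_kern p (reflect q)"

lemma measurable_gap [measurable (raw)]:
  assumes [measurable]: "f \<in> S \<rightarrow>\<^sub>M borel" "g \<in> S \<rightarrow>\<^sub>M borel"
  shows "(\<lambda>x. gap (f x) (g x)) \<in> borel_measurable S"
proof -
  note [measurable] = measurable_kern_pair[OF admissible_num_z]
  show ?thesis unfolding gap_def sym_kern_def by measurable
qed

context odd_flow
begin

definition "Wp = density W (indicator {q. 0 < snd q})"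

lemma sets_Wp [measurable_cong, simp]: "sets Wp = sets borel"
  by (simp add: Wp_def sets_W)

lemma space_Wp [simp]: "space Wp = UNIV"
  using sets_eq_imp_space_eq[OF sets_Wp] by simp

lemma AE_Wp: "(AE q in Wp. P q) \<longleftrightarrow> (AE q in W. 0 < snd q \<longrightarrow> P q)"
  unfolding Wp_def by (subst AE_density) (auto simp: indicator_def intro!: AE_cong)

lemma nn_integral_Wp: "f \<in> borel_measurable borel \<Longrightarrow> (\<integral>\<^sup>+ q. f q \<partial>Wp) = (\<integral>\<^sup>+ q. indicator {q. 0 < snd q} q * f q \<partial>W)"
  unfolding Wp_def by (subst nn_integral_density) auto

lemma nn_integral_Wp_le:
  assumes [measurable]: "f \<in> borel_measurable borel"
  shows "(\<integral>\<^sup>+ q. f q \<partial>Wp) \<le> (\<integral>\<^sup>+ q. f q \<partial>W)"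
  by (subst nn_integral_Wp) (auto intro!: nn_integral_mono simp: indicator_def)

lemma emeasure_W_le: "emeasure W UNIV \<le> ennreal M"
proof -
  obtain B where "lagrangian_flow W sg B M 0 X" using flow[of 0] by blast
  then show ?thesis using mass_le[of "X 0"] by (auto simp: lagrangian_flow_def)
qed

lemma emeasure_Wp_le: "emeasure Wp UNIV \<le> ennreal M"
  using nn_integral_Wp_le[of "\<lambda>_. 1"] emeasure_W_le by simp

lemma finite_Wp: "finite_measure Wp"
proof (rule finite_measureI)
  show "emeasure Wp (space Wp) \<noteq> \<infinity>"
    unfolding space_Wp using le_less_trans[OF emeasure_Wp_le ennreal_less_top] by simp
qed

sublocale upper: finite_measure Wp by (rule finite_Wp)

text \<open>Folds the lower half onto the upper one: invariance of \<open>W\<close> turns the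
  negative vorticity into an image term with a minus sign. Labels on the plane itself contribute
  nothing, as their sign is 0.\<close>

lemma integral_W_split:
  fixes g :: "real \<times> real \<Rightarrow> real"
  assumes [measurable]: "g \<in> borel_measurable borel" and g: "integrable W (\<lambda>q. sg q * g q)"
  shows "(\<integral>q. sg q * g q \<partial>W) = (\<integral>q. g q - g (reflect q) \<partial>Wp)"
    and "integrable Wp g" and "integrable Wp (\<lambda>q. g (reflect q))"
proof -
  have Wi: "integrable Wp f \<longleftrightarrow> integrable W (\<lambda>q. indicator {q. 0 < snd q} q * f q)"
    and WI: "(\<integral>q. f q \<partial>Wp) = (\<integral>q. indicator {q. 0 < snd q} q * f q \<partial>W)"
    if [measurable]: "f \<in> borel_measurable borel" for f :: "real \<times> real \<Rightarrow> real"
  proof -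
    have *: "Wp = density W (\<lambda>q. ennreal (indicator {q. 0 < snd q} q))"
      unfolding Wp_def by (simp add: ennreal_indicator)
    show "integrable Wp f \<longleftrightarrow> integrable W (\<lambda>q. indicator {q. 0 < snd q} q * f q)"
      unfolding * by (subst integrable_density) auto
    show "(\<integral>q. f q \<partial>Wp) = (\<integral>q. indicator {q. 0 < snd q} q * f q \<partial>W)"
      unfolding * by (subst integral_density) auto
  qed
  have sets: "{q. 0 < snd q} \<in> sets W" "{q. snd q < 0} \<in> sets W" by measurable
  have "(\<lambda>q. indicator {q. 0 < snd q} q * g q) = (\<lambda>q. indicator {q. 0 < snd q} q *\<^sub>R (sg q * g q))"
    by (auto simp: fun_eq_iff indicator_def)
  then have 1: "integrable W (\<lambda>q. indicator {q. 0 < snd q} q * g q)"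
    using integrable_mult_indicator[OF sets(1) g] by (simp only:)
  have "(\<lambda>q. indicator {q. snd q < 0} q * g q) = (\<lambda>q. - (indicator {q. snd q < 0} q *\<^sub>R (sg q * g q)))"
    by (auto simp: fun_eq_iff indicator_def)
  then have 2: "integrable W (\<lambda>q. indicator {q. snd q < 0} q * g q)"
    using Bochner_Integration.integrable_minus[OF integrable_mult_indicator[OF sets(2) g]] by (simp only:)
  have "integrable (distr W borel reflect) (\<lambda>q. indicator {q. snd q < 0} q * g q)"
    using 2 by (simp add: W_reflect)
  then have "integrable W (\<lambda>q. indicator {q. snd q < 0} (reflect q) * g (reflect q))"
    by (subst (asm) integrable_distr_eq) auto
  then have 3: "integrable W (\<lambda>q. indicator {q. 0 < snd q} q * g (reflect q))"
    by (rule Bochner_Integration.integrable_cong[THEN iffD1, rotated 2]) (auto simp: indicator_def)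
  show i1: "integrable Wp g" using 1 by (simp add: Wi)
  show i2: "integrable Wp (\<lambda>q. g (reflect q))" using 3 by (simp add: Wi)
  have "(\<integral>q. sg q * g q \<partial>W) = (\<integral>q. indicator {q. 0 < snd q} q * g q - indicator {q. snd q < 0} q * g q \<partial>W)"
    by (intro Bochner_Integration.integral_cong) (auto simp: indicator_def sgn_real_def)
  also have "\<dots> = (\<integral>q. indicator {q. 0 < snd q} q * g q \<partial>W) - (\<integral>q. indicator {q. snd q < 0} q * g q \<partial>W)"
    using 1 2 by simp
  also have "(\<integral>q. indicator {q. snd q < 0} q * g q \<partial>W) = (\<integral>q. indicator {q. snd q < 0} (reflect q) * g (reflect q) \<partial>W)"
    by (rule integral_reflect[symmetric]) measurable
  also have "\<dots> = (\<integral>q. indicator {q. 0 < snd q} q * g (reflect q) \<partial>W)"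
    by (intro Bochner_Integration.integral_cong) (auto simp: indicator_def)
  finally show "(\<integral>q. sg q * g q \<partial>W) = (\<integral>q. g q - g (reflect q) \<partial>Wp)"
    using i1 i2 by (simp add: WI)
qed

definition "mean_height t = (\<integral>p. snd (X t p) \<partial>Wp)"

text \<open>The measure \<mu> of the overview at time t, expressed by labels.\<close>

definition "V t = distr Wp borel (X t)"

lemma AE_Wp_upper: "AE q in Wp. q \<in> open_halfplane \<and> (\<forall>t\<ge>0. 0 < snd (X t q)) \<and> (\<forall>t\<ge>0. X t (reflect q) = reflect (X t q))"
  unfolding AE_Wp using upper_invariant AE_W X_eq_Y
  by eventually_elim (auto simp: Y_def)

lemma AE_Wp_pos:
  assumes t: "0 \<le> t" shows "AE q in Wp. X t q \<in> open_halfplane \<and> 0 < snd (X t q)"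
  using AE_Wp_upper by eventually_elim (use t X_halfplane[OF t] in blast)

lemma V_tame:
  assumes t: "0 \<le> t" shows "\<exists>B. tame (V t) B M"
proof -
  note [measurable] = X_measurable[OF t]
  obtain B where B: "lagrangian_flow W sg B M t X" using flow[OF t] by blast
  then have T: "tame (distr W borel (X t)) B M" using t by (auto simp: lagrangian_flow_def)
  have "(\<integral>\<^sup>+ q. f q \<partial>V t) \<le> ennreal B * (\<integral>\<^sup>+ q. f q \<partial>lborel)" if [measurable]: "f \<in> borel_measurable borel" for f
  proof -
    have "(\<integral>\<^sup>+ q. f q \<partial>V t) = (\<integral>\<^sup>+ q. f (X t q) \<partial>Wp)"
      unfolding V_def by (rule nn_integral_distr) auto
    also have "\<dots> \<le> (\<integral>\<^sup>+ q. f (X t q) \<partial>W)" by (rule nn_integral_Wp_le) measurable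
    also have "\<dots> = (\<integral>\<^sup>+ q. f q \<partial>distr W borel (X t))" by (rule nn_integral_distr[symmetric]) auto
    also have "\<dots> \<le> ennreal B * (\<integral>\<^sup>+ q. f q \<partial>lborel)" using T by (auto simp: tame_def)
    finally show ?thesis .
  qed
  then have "tame (V t) B M"
    using T emeasure_Wp_le by (auto simp: tame_def V_def emeasure_distr)
  then show ?thesis by blast
qed

lemma V_half: assumes t: "0 \<le> t" shows "AE q in V t. 0 < fst q \<and> 0 < snd q"
proof -
  note [measurable] = X_measurable[OF t]
  have "AE q in Wp. 0 < fst (X t q) \<and> 0 < snd (X t q)"
    using AE_Wp_pos[OF t] by eventually_elim (simp add: open_halfplane_def split_beta)
  then show ?thesis unfolding V_def by (subst AE_distr_iff) auto
qed

lemma V_dens: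
  assumes t: "0 \<le> t" and [measurable]: "f \<in> borel_measurable borel"
  shows "(\<integral>\<^sup>+ q. f q \<partial>V t) \<le> (\<integral>\<^sup>+ q. ennreal (\<Lambda> * fst q) * indicator open_halfplane q * f q \<partial>lborel)"
proof -
  note [measurable] = X_measurable[OF t]
  have "(\<integral>\<^sup>+ q. f q \<partial>V t) = (\<integral>\<^sup>+ q. f (X t q) \<partial>Wp)"
    unfolding V_def by (rule nn_integral_distr) auto
  also have "\<dots> \<le> (\<integral>\<^sup>+ q. f (X t q) \<partial>W)" by (rule nn_integral_Wp_le) measurable
  also have "\<dots> \<le> (\<integral>\<^sup>+ q. ennreal (\<Lambda> * fst q) * indicator open_halfplane q * f q \<partial>lborel)"
    by (rule dens[OF t]) fact
  finally show ?thesis .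
qed

definition "descent_rate t = - (\<integral>p. lagrangian_velocity W sg num_z (X t) (X t p) \<partial>Wp)"

lemma mean_height_derivative:
  assumes T: "0 \<le> T" and t: "t \<in> {0..T}"
  shows "(mean_height has_real_derivative - descent_rate t) (at t within {0..T})"
    and "integrable Wp (\<lambda>p. snd (X t p))"
proof -
  obtain B where B: "lagrangian_flow W sg B M T X" using flow[OF T] by blast
  have Xm [measurable]: "\<And>s. s \<in> {0..T} \<Longrightarrow> X s \<in> borel_measurable borel" using X_measurable by simp
  have vm: "(\<lambda>p. lagrangian_velocity W sg num_z (X t) (X t p)) \<in> borel_measurable Wp"
    using borel_measurable_velocity[OF admissible_num_z Xm[OF t] Xm[OF t]] by measurable
  have sm: "\<And>s. s \<in> {0..T} \<Longrightarrow> (\<lambda>p. snd (X s p)) \<in> borel_measurable Wp" by measurable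
  have der: "AE p in Wp. \<forall>s\<in>{0..T}. ((\<lambda>s. snd (X s p)) has_real_derivative lagrangian_velocity W sg num_z (X s) (X s p)) (at s within {0..T})
      \<and> \<bar>lagrangian_velocity W sg num_z (X s) (X s p)\<bar> \<le> 10 * (2 * pi * B + M)"
    using AE_Wp_upper
  proof (eventually_elim, intro ballI conjI)
    fix p s assume p: "p \<in> open_halfplane \<and> (\<forall>t\<ge>0. 0 < snd (X t p)) \<and> (\<forall>t\<ge>0. X t (reflect p) = reflect (X t p))" and s: "s \<in> {0..T}"
    then have s0: "0 \<le> s" by simp
    show "((\<lambda>s. snd (X s p)) has_real_derivative lagrangian_velocity W sg num_z (X s) (X s p)) (at s within {0..T})"
      using B p s by (auto simp: lagrangian_flow_def)
    have "tame (distr W borel (X s)) B M" using B s by (auto simp: lagrangian_flow_def)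
    then show "\<bar>lagrangian_velocity W sg num_z (X s) (X s p)\<bar> \<le> 10 * (2 * pi * B + M)"
      using p by (intro velocity_abs_le X_measurable X_halfplane s0 admissible_num_z) auto
  qed
  have f0: "integrable Wp (\<lambda>p. snd (X 0 p))"
  proof -
    have "integrable Wp snd"
    proof (rule integrableI_nonneg)
      show "AE q in Wp. 0 \<le> snd q" by (simp add: AE_Wp)
      have "(\<integral>\<^sup>+ q. ennreal (snd q) \<partial>Wp) \<le> ennreal Z"
        by (rule order_trans[OF nn_integral_Wp_le moment]) measurable
      then show "(\<integral>\<^sup>+ q. ennreal (snd q) \<partial>Wp) < \<infinity>"
        unfolding infinity_ennreal_def by (rule le_less_trans[OF _ ennreal_less_top])
    qed simp
    moreover have "AE p in Wp. snd p = snd (X 0 p)" using AE_Wp_upper by eventually_elim (simp add: X_init)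
    ultimately show ?thesis using sm[of 0] T by (subst integrable_cong_AE[of _ _ snd]) auto
  qed
  note D = has_derivative_integral_bounded[OF finite_Wp T t sm vm der f0]
  show "(mean_height has_real_derivative - descent_rate t) (at t within {0..T})"
    using D(1) unfolding mean_height_def descent_rate_def by simp
  show "integrable Wp (\<lambda>p. snd (X t p))" by (rule D(2))
qed

lemma mean_height_init: "mean_height 0 \<le> Z"
proof -
  have "integrable Wp (\<lambda>p. snd (X 0 p))" by (rule mean_height_derivative(2)[of 0 0]) auto
  then have "ennreal (mean_height 0) = (\<integral>\<^sup>+ p. ennreal (snd (X 0 p)) \<partial>Wp)"
    unfolding mean_height_def
  proof (intro nn_integral_eq_integral[symmetric])
    show "AE p in Wp. 0 \<le> snd (X 0 p)" using AE_Wp_pos[of 0] by (rule eventually_mono) auto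
  qed
  also have "\<dots> = (\<integral>\<^sup>+ p. ennreal (snd p) \<partial>Wp)"
    by (rule nn_integral_cong_AE) (use AE_Wp_upper in eventually_elim, simp add: X_init)
  also have "\<dots> \<le> ennreal Z" by (rule order_trans[OF nn_integral_Wp_le moment]) measurable
  finally show ?thesis using Z by (simp add: ennreal_le_iff)
qed

lemma mean_height_nonneg: "0 \<le> t \<Longrightarrow> 0 \<le> mean_height t"
  unfolding mean_height_def by (intro integral_nonneg_AE eventually_mono[OF AE_Wp_pos[of t]]) auto

text \<open>Folding writes the vertical velocity with \<open>k - k'\<close>, the kernel minus its
  mirror term. Exchanging the two variables then symmetrises the double integral; this is legitimate
  because both kernels have uniformly bounded integrals over \<open>q\<close> and \<open>Wp\<close>
  is finite. The sign follows from \<open>sym_gap_nonneg\<close>, once coinciding points are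
  discarded as a null set.\<close>

lemma descent_rate_gap:
  assumes t: "0 \<le> t"
  shows "(\<integral>\<^sup>+ p. \<integral>\<^sup>+ q. ennreal (gap p q) \<partial>V t \<partial>V t) = ennreal (4 * pi * descent_rate t)" and "0 \<le> descent_rate t"
proof -
  note [measurable] = X_measurable[OF t] measurable_kern_pair[OF admissible_num_z]
  interpret pp: pair_sigma_finite Wp Wp ..
  obtain B where "lagrangian_flow W sg B M t X" using flow[OF t] by blast
  then have tm: "tame (distr W borel (X t)) B M" using t by (auto simp: lagrangian_flow_def)
  define k where "k p q = kern num_z (X t p) (X t q)" for p q
  define k' where "k' p q = kern num_z (X t p) (reflect (X t q))" for p q
  have km [measurable]: "(\<lambda>x. k (fst x) (snd x)) \<in> borel_measurable (Wp \<Otimes>\<^sub>M Wp)" "(\<lambda>x. k' (fst x) (snd x)) \<in> borel_measurable (Wp \<Otimes>\<^sub>M Wp)"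
    unfolding k_def k'_def by measurable
  have gi: "integrable W (\<lambda>q. sg q * kern num_z (X t p) (X t q))" if p: "p \<in> open_halfplane" for p
    by (intro kern_integrable[OF tm] X_measurable X_halfplane t p admissible_num_z)
  have kX: "(\<lambda>q. kern num_z a (X t q)) \<in> borel_measurable borel" for a by measurable
  \<comment> \<open>The flow commutes with the reflection only for almost every label, so the mirror
    term is exchanged under the integral and not pointwise.\<close>
  have refl_eq: "AE q in Wp. kern num_z (X t p) (X t (reflect q)) = k' p q" for p
    using AE_Wp_upper by eventually_elim (use t in \<open>simp add: k'_def\<close>)
  have split: "(\<integral>q. sg q * kern num_z (X t p) (X t q) \<partial>W) = (\<integral>q. k p q - k' p q \<partial>Wp)"
    and kp: "integrable Wp (k p)" and k'p: "integrable Wp (k' p)" if p: "p \<in> open_halfplane" for p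
  proof -
    note s = integral_W_split[OF kX gi[OF p]]
    show "integrable Wp (k p)" using s(2) by (simp add: k_def[abs_def])
    have k'm: "k' p \<in> borel_measurable Wp" unfolding k'_def by measurable
    show "integrable Wp (k' p)"
      using s(3) refl_eq[of p] k'm by (subst integrable_cong_AE[of "k' p" _ "\<lambda>q. kern num_z (X t p) (X t (reflect q))"]) (auto elim!: eventually_mono)
    have "(\<integral>q. kern num_z (X t p) (X t q) - kern num_z (X t p) (X t (reflect q)) \<partial>Wp) = (\<integral>q. k p q - k' p q \<partial>Wp)"
    proof (rule integral_cong_AE)
      show "AE q in Wp. kern num_z (X t p) (X t q) - kern num_z (X t p) (X t (reflect q)) = k p q - k' p q"
        using refl_eq[of p] by eventually_elim (simp add: k_def)
    qed (auto simp: k_def k'_def)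
    then show "(\<integral>q. sg q * kern num_z (X t p) (X t q) \<partial>W) = (\<integral>q. k p q - k' p q \<partial>Wp)" using s(1) by simp
  qed
  have bound: "(\<integral>\<^sup>+ q. ennreal \<bar>k p q\<bar> \<partial>Wp) \<le> ennreal (10 * (2 * pi * B + M))"
    "(\<integral>\<^sup>+ q. ennreal \<bar>k' p q\<bar> \<partial>Wp) \<le> ennreal (10 * (2 * pi * B + M))" if p: "p \<in> open_halfplane" for p
  proof -
    have b: "(\<integral>\<^sup>+ q. ennreal \<bar>kern num_z a (X t q)\<bar> \<partial>Wp) \<le> ennreal (10 * (2 * pi * B + M))" if a: "a \<in> open_halfplane" for a
      by (rule order_trans[OF nn_integral_Wp_le kern_integral_le[OF tm]])
        (auto intro: X_measurable X_halfplane t a admissible_num_z)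
    show "(\<integral>\<^sup>+ q. ennreal \<bar>k p q\<bar> \<partial>Wp) \<le> ennreal (10 * (2 * pi * B + M))"
      unfolding k_def by (intro b X_halfplane t p)
    show "(\<integral>\<^sup>+ q. ennreal \<bar>k' p q\<bar> \<partial>Wp) \<le> ennreal (10 * (2 * pi * B + M))"
      unfolding k'_def kern_num_z_reflect_fst[symmetric] using X_halfplane[OF t p] by (intro b) simp
  qed
  have ki: "integrable (Wp \<Otimes>\<^sub>M Wp) (\<lambda>x. f (fst x) (snd x))"
    if m: "(\<lambda>x. f (fst x) (snd x)) \<in> borel_measurable (Wp \<Otimes>\<^sub>M Wp)"
      and b: "\<And>p. p \<in> open_halfplane \<Longrightarrow> (\<integral>\<^sup>+ q. ennreal \<bar>f p q\<bar> \<partial>Wp) \<le> ennreal (10 * (2 * pi * B + M))" for f :: "real \<times> real \<Rightarrow> real \<times> real \<Rightarrow> real"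
  proof (rule integrableI_bounded[OF m])
    have "(\<integral>\<^sup>+ x. ennreal (norm (f (fst x) (snd x))) \<partial>(Wp \<Otimes>\<^sub>M Wp)) = (\<integral>\<^sup>+ p. \<integral>\<^sup>+ q. ennreal \<bar>f p q\<bar> \<partial>Wp \<partial>Wp)"
      using m by (subst upper.nn_integral_fst[symmetric]) auto
    also have "\<dots> \<le> (\<integral>\<^sup>+ p. ennreal (10 * (2 * pi * B + M)) \<partial>Wp)"
    proof (rule nn_integral_mono_AE)
      show "AE p in Wp. (\<integral>\<^sup>+ q. ennreal \<bar>f p q\<bar> \<partial>Wp) \<le> ennreal (10 * (2 * pi * B + M))"
        using AE_Wp_upper by eventually_elim (rule b, simp)
    qed
    also have "\<dots> < \<infinity>"
      by (simp add: upper.emeasure_eq_measure ennreal_mult_less_top)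
    finally show "(\<integral>\<^sup>+ x. ennreal (norm (f (fst x) (snd x))) \<partial>(Wp \<Otimes>\<^sub>M Wp)) < \<infinity>" .
  qed
  have i1: "integrable (Wp \<Otimes>\<^sub>M Wp) (\<lambda>x. k (fst x) (snd x))" and i2: "integrable (Wp \<Otimes>\<^sub>M Wp) (\<lambda>x. k' (fst x) (snd x))"
    by (intro ki km bound; assumption)+
  have i1': "integrable (Wp \<Otimes>\<^sub>M Wp) (\<lambda>x. k (snd x) (fst x))" and i2': "integrable (Wp \<Otimes>\<^sub>M Wp) (\<lambda>x. k' (snd x) (fst x))"
    using pp.integrable_product_swap[OF i1] pp.integrable_product_swap[OF i2] by (simp_all only: case_prod_unfold fst_conv snd_conv)
  have sw1: "(\<integral>x. k (snd x) (fst x) \<partial>(Wp \<Otimes>\<^sub>M Wp)) = (\<integral>x. k (fst x) (snd x) \<partial>(Wp \<Otimes>\<^sub>M Wp))"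
    and sw2: "(\<integral>x. k' (snd x) (fst x) \<partial>(Wp \<Otimes>\<^sub>M Wp)) = (\<integral>x. k' (fst x) (snd x) \<partial>(Wp \<Otimes>\<^sub>M Wp))"
    using pp.integral_product_swap[OF borel_measurable_integrable[OF i1]] pp.integral_product_swap[OF borel_measurable_integrable[OF i2]]
    by (simp_all only: case_prod_unfold fst_conv snd_conv)
  define I where "I = (\<integral>x. k (fst x) (snd x) - k' (fst x) (snd x) \<partial>(Wp \<Otimes>\<^sub>M Wp))"
  have "descent_rate t = - (\<integral>p. 1 / (2 * pi) * (\<integral>q. k p q - k' p q \<partial>Wp) \<partial>Wp)"
    unfolding descent_rate_def lagrangian_velocity_def
  proof (intro arg_cong[where f = uminus] integral_cong_AE)
    show "AE p in Wp. 1 / (2 * pi) * (\<integral>q. sg q * kern num_z (X t p) (X t q) \<partial>W) = 1 / (2 * pi) * (\<integral>q. k p q - k' p q \<partial>Wp)"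
      using AE_Wp_upper by eventually_elim (simp add: split)
    show "(\<lambda>p. 1 / (2 * pi) * (\<integral>q. sg q * kern num_z (X t p) (X t q) \<partial>W)) \<in> borel_measurable Wp"
      using borel_measurable_velocity[OF admissible_num_z X_measurable[OF t] X_measurable[OF t]]
      unfolding lagrangian_velocity_def by measurable
    show "(\<lambda>p. 1 / (2 * pi) * (\<integral>q. k p q - k' p q \<partial>Wp)) \<in> borel_measurable Wp"
      unfolding k_def k'_def by measurable
  qed
  also have "\<dots> = - (1 / (2 * pi) * I)"
    unfolding I_def using i1 i2 by (simp add: pp.integral_fst'[of "\<lambda>x. k (fst x) (snd x) - k' (fst x) (snd x)", simplified])
  finally have dI: "4 * pi * descent_rate t = - 2 * I" by (simp add: field_simps)
  \<comment> \<open>Reflecting either argument gives the same value, so the mirror term is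
    symmetrised along with the direct one. The integral is - 2 I, and together with the 1 / (2
    \<pi>) of the velocity this produces the factor 4 \<pi>.\<close>
  have gk: "gap (X t p) (X t q) = - k p q - k q p + k' p q + k' q p" for p q
    unfolding gap_def sym_kern_def k_def k'_def kern_num_z_reflect_fst by simp
  have gapi: "integrable (Wp \<Otimes>\<^sub>M Wp) (\<lambda>x. gap (X t (fst x)) (X t (snd x)))"
    unfolding gk using i1 i2 i1' i2' by (intro Bochner_Integration.integrable_add Bochner_Integration.integrable_diff Bochner_Integration.integrable_minus)
  have gapI: "(\<integral>x. gap (X t (fst x)) (X t (snd x)) \<partial>(Wp \<Otimes>\<^sub>M Wp)) = 4 * pi * descent_rate t"
    unfolding gk dI I_def using i1 i2 i1' i2' by (simp add: sw1 sw2)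
  obtain B' where B': "tame (V t) B' M" using V_tame[OF t] by blast
  have Vs [measurable_cong]: "sets (V t) = sets borel" by (simp add: V_def)
  interpret Vf: finite_measure "V t" by (rule tame_finite[OF B'])
  have pos: "AE p in Wp. AE q in Wp. 0 \<le> gap (X t p) (X t q)"
    using AE_Wp_pos[OF t]
  proof eventually_elim
    case p: (elim p)
    have "AE q in Wp. X t q \<noteq> X t p"
      using tame_AE_neq[OF B'] unfolding V_def by (subst (asm) AE_distr_iff) auto
    then show ?case
      using AE_Wp_pos[OF t]
    proof eventually_elim
      case (elim q)
      have "X t p \<noteq> reflect (X t q)"
      proof
        assume "X t p = reflect (X t q)"
        then have "snd (X t p) = - snd (X t q)" by simp
        then show False using p elim by linarith
      qed
      then show ?case
        unfolding gap_def using elim p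
        by (intro sym_gap_nonneg) (simp_all add: open_halfplane_def split_beta)
    qed
  qed
  have pos': "AE x in Wp \<Otimes>\<^sub>M Wp. 0 \<le> gap (X t (fst x)) (X t (snd x))"
  proof (rule pp.AE_pair_measure)
    have [measurable]: "(\<lambda>x. gap (X t (fst x)) (X t (snd x))) \<in> borel_measurable (Wp \<Otimes>\<^sub>M Wp)"
      using gapi by (rule borel_measurable_integrable)
    show "{x \<in> space (Wp \<Otimes>\<^sub>M Wp). 0 \<le> gap (X t (fst x)) (X t (snd x))} \<in> sets (Wp \<Otimes>\<^sub>M Wp)"
      by measurable
  qed (use pos in simp)
  have "(\<integral>\<^sup>+ p. \<integral>\<^sup>+ q. ennreal (gap p q) \<partial>V t \<partial>V t) = (\<integral>\<^sup>+ p. \<integral>\<^sup>+ q. ennreal (gap (X t p) q) \<partial>V t \<partial>Wp)"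
    by (rule nn_integral_distr[of "X t" Wp borel "\<lambda>p. \<integral>\<^sup>+ q. ennreal (gap p q) \<partial>V t", folded V_def]) measurable
  also have "\<dots> = (\<integral>\<^sup>+ p. \<integral>\<^sup>+ q. ennreal (gap (X t p) (X t q)) \<partial>Wp \<partial>Wp)"
    unfolding V_def by (intro nn_integral_cong nn_integral_distr) measurable
  also have "\<dots> = (\<integral>\<^sup>+ x. ennreal (gap (X t (fst x)) (X t (snd x))) \<partial>(Wp \<Otimes>\<^sub>M Wp))"
    by (subst upper.nn_integral_fst[symmetric]) auto
  also have "\<dots> = ennreal (4 * pi * descent_rate t)"
    unfolding gapI[symmetric] by (rule nn_integral_eq_integral[OF gapi pos'])
  finally show "(\<integral>\<^sup>+ p. \<integral>\<^sup>+ q. ennreal (gap p q) \<partial>V t \<partial>V t) = ennreal (4 * pi * descent_rate t)" .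
  have "0 \<le> 4 * pi * descent_rate t" unfolding gapI[symmetric] using pos' by (rule integral_nonneg_AE)
  then show "0 \<le> descent_rate t" using mult_le_cancel_left_pos[of "4 * pi" 0 "descent_rate t"] by simp
qed


text \<open>The gauge integral recovers a function from any everywhere defined derivative, so
  neither continuity nor measurability of the rate in t has to be checked.\<close>

lemma descent_rate_integral:
  assumes T: "0 \<le> T" shows "(descent_rate has_integral mean_height 0 - mean_height T) {0..T}"
proof -
  have "((\<lambda>t. - mean_height t) has_vector_derivative descent_rate t) (at t within {0..T})" if "t \<in> {0..T}" for t
    using DERIV_minus[OF mean_height_derivative(1)[OF T that]] by (simp add: has_real_derivative_iff_has_vector_derivative)
  from fundamental_theorem_of_calculus[OF T this] show ?thesis by simp
qed

lemma mean_height_le: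
  assumes t: "0 \<le> t" shows "mean_height t \<le> Z"
proof -
  have "0 \<le> mean_height 0 - mean_height t"
    by (rule has_integral_nonneg[OF descent_rate_integral[OF t]]) (simp add: descent_rate_gap(2))
  then show ?thesis using mean_height_init by linarith
qed

section \<open>The integral in time of the partial mass\<close>

definition "lower_mass R t = measure (V t) {q. fst q \<le> R}"

lemma lower_mass_power_le:
  assumes R: "1 \<le> R" and t: "0 \<le> t" and M1: "0 < M"
  shows "lower_mass R t ^ 4 \<le> 4 * pi * gap_constant \<Lambda> M Z * R ^ 4 * descent_rate t"
proof -
  note [measurable] = X_measurable[OF t]
  obtain B where B: "tame (V t) B M" using V_tame[OF t] by blast
  have mom: "(\<integral>\<^sup>+ q. ennreal (snd q) \<partial>V t) \<le> ennreal Z"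
  proof -
    have "(\<integral>\<^sup>+ q. ennreal (snd q) \<partial>V t) = (\<integral>\<^sup>+ q. ennreal (snd (X t q)) \<partial>Wp)"
      unfolding V_def by (rule nn_integral_distr) measurable
    also have "\<dots> = ennreal (mean_height t)"
      unfolding mean_height_def
    proof (rule nn_integral_eq_integral)
      show "integrable Wp (\<lambda>p. snd (X t p))" using mean_height_derivative(2)[OF t, of t] t by simp
      show "AE p in Wp. 0 \<le> snd (X t p)" using AE_Wp_pos[OF t] by (rule eventually_mono) auto
    qed
    finally show ?thesis using mean_height_le[OF t] by (simp add: ennreal_leI)
  qed
  have g: "0 < gap_constant \<Lambda> M Z"
    unfolding gap_constant_def using \<Lambda> M1 Z by (intro mult_pos_pos add_nonneg_pos add_nonneg_nonneg) auto
  have "ennreal (lower_mass R t ^ 4 / (gap_constant \<Lambda> M Z * R ^ 4)) \<le> ennreal (4 * pi * descent_rate t)"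
    using sym_gap_lower_bound[OF B V_half[OF t] V_dens[OF t] \<Lambda> mom Z R]
    unfolding lower_mass_def descent_rate_gap(1)[OF t, symmetric] gap_def by simp
  then have "lower_mass R t ^ 4 / (gap_constant \<Lambda> M Z * R ^ 4) \<le> 4 * pi * descent_rate t"
    using descent_rate_gap(2)[OF t] by (simp add: ennreal_le_iff)
  then show ?thesis using g R by (simp add: pos_divide_le_eq ac_simps)
qed

text \<open>The indicator of r \<le> R is the pointwise limit of the continuous ramps
  \<open>\<phi> k\<close>, which fall with slope k from 1 at R to 0. Integrals of a ramp are
  continuous in t by dominated convergence along the trajectories, and the partial mass is their
  limit.\<close>

lemma lower_mass_measurable: "(\<lambda>t. indicat_real {0..} t *\<^sub>R lower_mass R t) \<in> borel_measurable borel"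
proof -
  define \<phi> where "\<phi> k x = max 0 (min 1 (1 - real k * (x - R)))" for k x
  have \<phi>_cont: "continuous_on UNIV (\<phi> k)" for k
    unfolding \<phi>_def by (intro continuous_intros)
  have \<phi>_abs: "\<bar>\<phi> k x\<bar> \<le> 1" for k x by (auto simp: \<phi>_def)
  have \<phi>_meas [measurable]: "\<phi> k \<in> borel_measurable borel" for k
    by (rule borel_measurable_continuous_onI[OF \<phi>_cont])
  define F where "F k t = (\<integral>q. \<phi> k (fst (X t q)) \<partial>Wp)" for k t
  have F_cont: "continuous_on {0..} (F k)" for k
    unfolding continuous_on_sequentially
  proof (intro allI impI ballI)
    fix u a assume a0: "a \<in> {0..}" and a1: "(\<forall>n. u n \<in> {0..}) \<and> u \<longlonglongrightarrow> (a :: real)"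
    note a = conjI[OF a0 a1]
    then have m [measurable]: "X a \<in> borel_measurable borel" "\<And>n. X (u n) \<in> borel_measurable borel"
      by (auto intro: X_measurable)
    show "(F k \<circ> u) \<longlonglongrightarrow> F k a"
      unfolding F_def comp_def
    proof (rule integral_dominated_convergence[where w = "\<lambda>_. 1"])
      show "AE q in Wp. (\<lambda>n. \<phi> k (fst (X (u n) q))) \<longlonglongrightarrow> \<phi> k (fst (X a q))"
        using AE_Wp_upper
      proof eventually_elim
        case (elim q)
        then have "continuous_on {0..} (\<lambda>t. \<phi> k (fst (X t q)))"
          using X_continuous[of q] by (intro continuous_on_compose2[OF \<phi>_cont] continuous_on_fst) auto
        then show ?case using a unfolding continuous_on_sequentially comp_def by blast
      qed
    qed (auto simp: \<phi>_abs)
  qed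
  have Fm [measurable]: "(\<lambda>t. indicat_real {0..} t *\<^sub>R F k t) \<in> borel_measurable borel" for k
    by (rule borel_measurable_continuous_on_indicator[OF _ F_cont]) auto
  show ?thesis
  proof (rule borel_measurable_LIMSEQ_real[OF _ Fm])
    fix t :: real
    show "(\<lambda>k. indicat_real {0..} t *\<^sub>R F k t) \<longlonglongrightarrow> indicat_real {0..} t *\<^sub>R lower_mass R t"
    proof (cases "0 \<le> t")
      case True
      note [measurable] = X_measurable[OF True]
      have "(\<lambda>k. F k t) \<longlonglongrightarrow> (\<integral>q. indicator {q. fst (X t q) \<le> R} q \<partial>Wp)"
        unfolding F_def
      proof (rule integral_dominated_convergence[where w = "\<lambda>_. 1"])
        have "(\<lambda>k. \<phi> k x) \<longlonglongrightarrow> (if x \<le> R then 1 else 0)" for x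
        proof (cases "x \<le> R")
          case True
          then have "\<phi> k x = 1" for k by (simp add: \<phi>_def mult_nonneg_nonpos)
          then show ?thesis using True by simp
        next
          case False
          obtain n :: nat where n: "1 / (x - R) \<le> real n" using real_arch_simple by blast
          have "\<phi> k x = 0" if "n \<le> k" for k
          proof -
            have "1 \<le> real n * (x - R)" using n False by (simp add: pos_divide_le_eq)
            also have "\<dots> \<le> real k * (x - R)" using that False by (intro mult_right_mono) auto
            finally show ?thesis by (simp add: \<phi>_def)
          qed
          then have "\<forall>\<^sub>F k in sequentially. \<phi> k x = 0" by (auto simp: eventually_sequentially)
          then show ?thesis using False by (simp add: tendsto_eventually)
        qed
        from this show "AE q in Wp. (\<lambda>k. \<phi> k (fst (X t q))) \<longlonglongrightarrow> indicator {q. fst (X t q) \<le> R} q"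
          by (simp add: indicator_def of_bool_def)
      qed (auto simp: \<phi>_abs)
      also have "(\<integral>q. indicator {q. fst (X t q) \<le> R} q \<partial>Wp) = lower_mass R t"
        unfolding lower_mass_def V_def by (subst measure_distr) (auto simp: vimage_def)
      finally show ?thesis using True by simp
    qed simp
  qed
qed

text \<open>On [0, n] the integral is at most a constant times the drop of the moment. The moment
  starts below Z and stays nonnegative, so the bound does not depend on n, and monotone convergence
  extends it to all times.\<close>

lemma lower_mass_integral:
  assumes R: "1 \<le> R" and M1: "0 < M"
  shows "set_integrable lborel {0..} (\<lambda>t. lower_mass R t ^ 4)"
    and "(LINT t:{0..}|lborel. lower_mass R t ^ 4) \<le> 4 * pi * gap_constant \<Lambda> M Z * Z * R ^ 4"
proof -
  let ?c = "4 * pi * gap_constant \<Lambda> M Z * R ^ 4"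
  have c: "0 \<le> ?c" unfolding gap_constant_def using \<Lambda> M1 Z R by (intro mult_nonneg_nonneg add_nonneg_nonneg) auto
  note [measurable] = lower_mass_measurable[of R]
  have hm: "(\<lambda>t. indicat_real {0..} t *\<^sub>R lower_mass R t ^ 4) \<in> borel_measurable borel"
  proof -
    have "(\<lambda>t. indicat_real {0..} t *\<^sub>R lower_mass R t ^ 4) = (\<lambda>t. (indicat_real {0..} t *\<^sub>R lower_mass R t) ^ 4)"
      by (auto simp: fun_eq_iff indicator_def)
    then show ?thesis by (simp only: borel_measurable_power lower_mass_measurable)
  qed
  have le: "lower_mass R t ^ 4 \<le> M ^ 4" "0 \<le> lower_mass R t" if t: "0 \<le> t" for t
  proof -
    note [measurable] = X_measurable[OF t]
    have "lower_mass R t \<le> measure Wp UNIV"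
      unfolding lower_mass_def V_def by (subst measure_distr) (auto intro!: upper.finite_measure_mono)
    also have "\<dots> \<le> M" using emeasure_Wp_le M1 by (simp add: upper.emeasure_eq_measure ennreal_le_iff)
    finally show "lower_mass R t ^ 4 \<le> M ^ 4" by (intro power_mono) (auto simp: lower_mass_def)
    show "0 \<le> lower_mass R t" by (simp add: lower_mass_def)
  qed
  have step: "(\<integral>\<^sup>+ t. ennreal (indicat_real {0..real n} t * lower_mass R t ^ 4) \<partial>lborel) \<le> ennreal (?c * Z)" for n
  proof -
    have si: "set_integrable lborel {0..real n} (\<lambda>t. lower_mass R t ^ 4)"
      unfolding set_integrable_def
    proof (rule integrableI_bounded_set[where A = "{0..real n}" and B = "M ^ 4"])
      have "(\<lambda>t. indicat_real {0..real n} t *\<^sub>R lower_mass R t ^ 4) = (\<lambda>t. indicat_real {..real n} t *\<^sub>R (indicat_real {0..} t *\<^sub>R lower_mass R t ^ 4))"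
        by (auto simp: fun_eq_iff indicator_def)
      then show "(\<lambda>t. indicat_real {0..real n} t *\<^sub>R lower_mass R t ^ 4) \<in> borel_measurable lborel" using hm by simp
    qed (use le in \<open>auto simp: emeasure_lborel_Icc_eq intro!: AE_I2\<close>)
    have hi: "((\<lambda>t. lower_mass R t ^ 4) has_integral (LINT t:{0..real n}|lborel. lower_mass R t ^ 4)) {0..real n}"
      using integrable_integral[OF set_borel_integral_eq_integral(1)[OF si]] set_borel_integral_eq_integral(2)[OF si] by simp
    have "(LINT t:{0..real n}|lborel. lower_mass R t ^ 4) \<le> ?c * (mean_height 0 - mean_height (real n))"
      by (rule has_integral_le[OF hi has_integral_mult_right[OF descent_rate_integral]])
        (use lower_mass_power_le[OF R _ M1] in auto)
    also have "\<dots> \<le> ?c * Z"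
      using mean_height_init mean_height_nonneg[of "real n"] c by (intro mult_left_mono) auto
    finally have "ennreal (LINT t:{0..real n}|lborel. lower_mass R t ^ 4) \<le> ennreal (?c * Z)" by (rule ennreal_leI)
    moreover have "(\<integral>\<^sup>+ t. ennreal (indicat_real {0..real n} t * lower_mass R t ^ 4) \<partial>lborel) = ennreal (LINT t:{0..real n}|lborel. lower_mass R t ^ 4)"
      unfolding set_lebesgue_integral_def using si le(2)
      by (subst nn_integral_eq_integral) (auto simp: set_integrable_def indicator_def)
    ultimately show ?thesis by simp
  qed
  have "(\<lambda>n. \<integral>\<^sup>+ t. ennreal (indicat_real {0..real n} t * lower_mass R t ^ 4) \<partial>lborel)
      \<longlonglongrightarrow> (\<integral>\<^sup>+ t. ennreal (indicat_real {0..} t * lower_mass R t ^ 4) \<partial>lborel)"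
  proof (rule nn_integral_LIMSEQ)
    show "incseq (\<lambda>n t. ennreal (indicat_real {0..real n} t * lower_mass R t ^ 4))"
      by (auto simp: incseq_def le_fun_def indicator_def intro!: ennreal_leI)
    show "(\<lambda>t. ennreal (indicat_real {0..real n} t * lower_mass R t ^ 4)) \<in> borel_measurable lborel" for n
    proof -
      have "(\<lambda>t. indicat_real {0..real n} t * lower_mass R t ^ 4) = (\<lambda>t. indicat_real {..real n} t *\<^sub>R (indicat_real {0..} t *\<^sub>R lower_mass R t ^ 4))"
        by (auto simp: fun_eq_iff indicator_def)
      moreover have "(\<lambda>t. indicat_real {..real n} t *\<^sub>R (indicat_real {0..} t *\<^sub>R lower_mass R t ^ 4)) \<in> borel_measurable borel"
        by (intro borel_measurable_scaleR borel_measurable_indicator hm) auto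
      ultimately have "(\<lambda>t. indicat_real {0..real n} t * lower_mass R t ^ 4) \<in> borel_measurable borel"
        by (simp only:)
      from measurable_compose[OF this measurable_ennreal] show ?thesis by simp
    qed
    show "(\<lambda>n. ennreal (indicat_real {0..real n} t * lower_mass R t ^ 4)) \<longlonglongrightarrow> ennreal (indicat_real {0..} t * lower_mass R t ^ 4)" for t
    proof (rule tendsto_eventually)
      obtain N where N: "t \<le> real N" using real_arch_simple by blast
      show "\<forall>\<^sub>F n in sequentially. ennreal (indicat_real {0..real n} t * lower_mass R t ^ 4) = ennreal (indicat_real {0..} t * lower_mass R t ^ 4)"
        unfolding eventually_sequentially using N by (intro exI[of _ N]) (auto simp: indicator_def)
    qed
  qed
  then have nn: "(\<integral>\<^sup>+ t. ennreal (indicat_real {0..} t * lower_mass R t ^ 4) \<partial>lborel) \<le> ennreal (?c * Z)"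
    by (rule LIMSEQ_le_const2) (use step in auto)
  show int: "set_integrable lborel {0..} (\<lambda>t. lower_mass R t ^ 4)"
    unfolding set_integrable_def
  proof (rule integrableI_nonneg)
    show "(\<integral>\<^sup>+ t. ennreal (indicat_real {0..} t *\<^sub>R lower_mass R t ^ 4) \<partial>lborel) < \<infinity>"
      unfolding infinity_ennreal_def real_scaleR_def by (rule le_less_trans[OF nn ennreal_less_top])
  qed (use hm le(2) in \<open>auto simp: indicator_def\<close>)
  have "ennreal (LINT t:{0..}|lborel. lower_mass R t ^ 4) \<le> ennreal (?c * Z)"
    unfolding set_lebesgue_integral_def
    by (subst nn_integral_eq_integral[symmetric]) (use int le(2) nn in \<open>auto simp: set_integrable_def indicator_def\<close>)
  then have "(LINT t:{0..}|lborel. lower_mass R t ^ 4) \<le> ?c * Z"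
    by (rule ennreal_le_iff[THEN iffD1, rotated]) (rule mult_nonneg_nonneg[OF c less_imp_le[OF Z]])
  then show "(LINT t:{0..}|lborel. lower_mass R t ^ 4) \<le> 4 * pi * gap_constant \<Lambda> M Z * Z * R ^ 4"
    by (simp only: mult.assoc mult.commute[of "R ^ 4"])
qed

end

subsection \<open>The partial mass of an Euler solution\<close>

text \<open>Only the composition with \<open>cyl\<close> is known to be measurable, and values at r
  < 0 are arbitrary. Cutting off outside the open half plane yields a Borel function with the same
  integrals there.\<close>

definition halfplane_part :: "(real \<times> real \<Rightarrow> real) \<Rightarrow> real \<times> real \<Rightarrow> real" where
  "halfplane_part f q = indicator open_halfplane q * f q"

lemma open_halfplane_iff: "q \<in> open_halfplane \<longleftrightarrow> 0 < fst q"
  by (simp add: open_halfplane_def split_beta)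

lemma halfplane_part_in: "q \<in> open_halfplane \<Longrightarrow> halfplane_part f q = f q"
  and halfplane_part_out: "q \<notin> open_halfplane \<Longrightarrow> halfplane_part f q = 0"
  by (simp_all add: halfplane_part_def)

lemma L1_Linf_leD:
  assumes f: "L1_Linf_le B f"
  shows "halfplane_part f \<in> borel_measurable borel" and "0 \<le> B"
    and "AE q in lborel. \<bar>halfplane_part f q\<bar> \<le> B"
    and "(\<integral>\<^sup>+ q. ennreal (2 * pi * fst q) * ennreal \<bar>halfplane_part f q\<bar> \<partial>lborel) \<le> ennreal B"
proof -
  have i: "integrable lborel (\<lambda>x. f (cyl x))" and n: "(LINT x|lborel. \<bar>f (cyl x)\<bar>) \<le> B"
    and b: "AE x in lborel. \<bar>f (cyl x)\<bar> \<le> B"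
    using f by (auto simp: L1_Linf_le_def)
  have m: "(\<lambda>x. f (cyl x)) \<in> borel_measurable borel" using borel_measurable_integrable[OF i] by simp
  \<comment> \<open>A continuous section of \<open>cyl\<close> over the open half plane: composing
    with it carries measurability from space back to (r, z).\<close>
  have v: "(\<lambda>q. vector [fst q, 0, snd q] :: real ^ 3) \<in> borel \<rightarrow>\<^sub>M borel"
    unfolding vector3_eq by (intro borel_measurable_continuous_onI continuous_intros)
  have c: "cyl (vector [fst q, 0, snd q]) = q" if "q \<in> open_halfplane" for q
    using that by (simp add: cyl_def vector_3 open_halfplane_iff)
  have "halfplane_part f = (\<lambda>q. indicator open_halfplane q * f (cyl (vector [fst q, 0, snd q])))"
    by (auto simp: fun_eq_iff halfplane_part_def indicator_def c)
  moreover have "\<dots> \<in> borel_measurable borel"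
    using measurable_compose[OF v m] by measurable
  ultimately show hm [measurable]: "halfplane_part f \<in> borel_measurable borel" by simp
  have "0 \<le> (LINT x|lborel. \<bar>f (cyl x)\<bar>)" by (intro integral_nonneg_AE) auto
  with n show B: "0 \<le> B" by linarith
  have le: "\<bar>halfplane_part f q\<bar> \<le> \<bar>f q\<bar>" for q by (simp add: halfplane_part_def indicator_def)
  have "AE x in lborel. \<bar>halfplane_part f (cyl x)\<bar> \<le> B"
    using b by eventually_elim (rule order_trans[OF le])
  then have "AE q in distr lborel borel cyl. \<bar>halfplane_part f q\<bar> \<le> B"
    by (subst AE_distr_iff) auto
  then have "AE q in lborel. q \<in> open_halfplane \<longrightarrow> \<bar>halfplane_part f q\<bar> \<le> B"
    unfolding distr_cyl by (rule AE_axi_volume[THEN iffD1])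
  then show "AE q in lborel. \<bar>halfplane_part f q\<bar> \<le> B"
    by eventually_elim (use B halfplane_part_out in fastforce)
  have "(\<integral>\<^sup>+ q. ennreal (2 * pi * fst q) * ennreal \<bar>halfplane_part f q\<bar> \<partial>lborel)
      = (\<integral>\<^sup>+ q. ennreal (2 * pi * fst q) * indicator open_halfplane q * ennreal \<bar>halfplane_part f q\<bar> \<partial>lborel)"
    by (intro nn_integral_cong) (auto simp: indicator_def halfplane_part_def)
  also have "\<dots> = (\<integral>\<^sup>+ q. ennreal \<bar>halfplane_part f q\<bar> \<partial>distr lborel borel cyl)"
    unfolding distr_cyl by (rule nn_integral_axi_volume[symmetric]) simp
  also have "\<dots> = (\<integral>\<^sup>+ x. ennreal \<bar>halfplane_part f (cyl x)\<bar> \<partial>lborel)"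
    by (rule nn_integral_distr) auto
  also have "\<dots> \<le> (\<integral>\<^sup>+ x. ennreal \<bar>f (cyl x)\<bar> \<partial>lborel)"
    by (intro nn_integral_mono ennreal_leI le)
  also have "\<dots> = ennreal (LINT x|lborel. \<bar>f (cyl x)\<bar>)"
    using i by (intro nn_integral_eq_integral) auto
  also have "\<dots> \<le> ennreal B" using n by (rule ennreal_leI)
  finally show "(\<integral>\<^sup>+ q. ennreal (2 * pi * fst q) * ennreal \<bar>halfplane_part f q\<bar> \<partial>lborel) \<le> ennreal B" .
qed

lemma AE_reflect:
  assumes "AE q in (lborel :: (real \<times> real) measure). P q"
  shows "AE q in (lborel :: (real \<times> real) measure). P (reflect q)"
proof -
  have "AE q in distr lborel borel reflect. P q" unfolding distr_reflect_lborel by fact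
  then show ?thesis by (rule AE_distrD[rotated]) simp
qed

lemma AE_lborel_snd_neq: "AE q in (lborel :: (real \<times> real) measure). snd q \<noteq> c"
proof (rule AE_I[of _ _ "UNIV \<times> {c}"])
  show "emeasure lborel ((UNIV :: real set) \<times> {c}) = 0"
    by (simp add: lborel_prod[symmetric] lborel.emeasure_pair_measure_Times)
  show "(UNIV :: real set) \<times> {c} \<in> sets lborel" by (simp add: lborel_prod[symmetric])
qed auto

lemma integral_axi_volume:
  fixes f :: "real \<times> real \<Rightarrow> real"
  assumes [measurable]: "f \<in> borel_measurable borel"
  shows "(\<integral>p. f p \<partial>axi_volume) = (\<integral>p. 2 * pi * fst p * indicator open_halfplane p * f p \<partial>lborel)"
proof -
  have *: "axi_volume = density lborel (\<lambda>p. ennreal (2 * pi * fst p * indicator open_halfplane p))"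
    unfolding axi_volume_alt by (intro arg_cong[where f = "density lborel"]) (auto simp: fun_eq_iff indicator_def)
  show ?thesis
    unfolding * by (subst integral_density) (auto simp: indicator_def open_halfplane_iff)
qed

text \<open>One solution with its flow. The parameters \<Lambda>, M and Z are to be chosen from the
  initial data alone, so the resulting constant is common to all solutions.\<close>

locale vorticity_transport =
  fixes \<omega>\<^sub>0 :: "real \<times> real \<Rightarrow> real" and \<omega> :: "real \<Rightarrow> real \<times> real \<Rightarrow> real" and X and \<Lambda> M Z :: real
  assumes h0_measurable [measurable]: "halfplane_part \<omega>\<^sub>0 \<in> borel_measurable borel"
    and h0_le: "AE q in lborel. \<bar>halfplane_part \<omega>\<^sub>0 q\<bar> \<le> \<Lambda> * fst q \<or> q \<notin> open_halfplane"
    and h0_mass: "(\<integral>\<^sup>+ q. ennreal \<bar>halfplane_part \<omega>\<^sub>0 q\<bar> \<partial>lborel) \<le> ennreal M"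
    and \<Lambda>_nonneg: "0 \<le> \<Lambda>" and M_pos: "0 < M" and Z_pos: "0 < Z"
    and odd: "AE (r, z) in lborel. 0 \<le> r \<longrightarrow> \<omega>\<^sub>0 (r, - z) = - \<omega>\<^sub>0 (r, z)"
    and nonneg: "AE (r, z) in lborel. 0 \<le> r \<and> 0 \<le> z \<longrightarrow> 0 \<le> \<omega>\<^sub>0 (r, z)"
    and moment: "vertical_moment \<omega>\<^sub>0 \<le> ennreal Z"
    and bounded: "\<And>T. \<exists>B. \<forall>t\<in>{0..T}. L1_Linf_le B (\<omega> t)"
    and flow: "particle_flow \<omega> X"
    and transport: "\<And>t. 0 \<le> t \<Longrightarrow> AE p in lborel. p \<in> open_halfplane \<longrightarrow> \<omega> t (X t p) / fst (X t p) = \<omega>\<^sub>0 p / fst p"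
begin

abbreviation "h0 \<equiv> halfplane_part \<omega>\<^sub>0"

abbreviation "h t \<equiv> halfplane_part (\<omega> t)"

definition "W = density lborel (\<lambda>q. ennreal \<bar>h0 q\<bar>)"

lemma X_facts:
  assumes "0 \<le> t"
  shows "X t \<in> borel_measurable borel" "p \<in> open_halfplane \<Longrightarrow> X t p \<in> open_halfplane"
    "inj_on (X t) open_halfplane" "distr axi_volume borel (X t) = axi_volume"
  using assms flow unfolding particle_flow_def by (auto dest: bij_betw_apply bij_betw_imp_inj_on)

lemma h_measurable [measurable]: "0 \<le> t \<Longrightarrow> h t \<in> borel_measurable borel"
  using bounded[of t] by (auto dest: L1_Linf_leD(1))

lemma h0_sign: "AE q in lborel. h0 q = sgn (snd q) * \<bar>h0 q\<bar>"
  and h0_reflect: "AE q in lborel. \<bar>h0 (reflect q)\<bar> = \<bar>h0 q\<bar>"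
proof -
  have o: "AE q in lborel. 0 \<le> fst q \<longrightarrow> \<omega>\<^sub>0 (reflect q) = - \<omega>\<^sub>0 q"
    using odd by (simp add: split_beta reflect_def)
  have n: "AE q in lborel. 0 \<le> fst q \<and> 0 \<le> snd q \<longrightarrow> 0 \<le> \<omega>\<^sub>0 q"
    using nonneg by (simp add: split_beta)
  show "AE q in lborel. h0 q = sgn (snd q) * \<bar>h0 q\<bar>"
    using o n AE_reflect[OF n] AE_lborel_snd_neq[of 0]
    by eventually_elim (auto simp: halfplane_part_def indicator_def open_halfplane_iff sgn_real_def)
  show "AE q in lborel. \<bar>h0 (reflect q)\<bar> = \<bar>h0 q\<bar>"
    using o by eventually_elim (auto simp: halfplane_part_def indicator_def open_halfplane_iff)
qed

lemma h0_transport: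
  assumes t: "0 \<le> t"
  shows "AE q in axi_volume. h0 q / fst q = h t (X t q) / fst (X t q)"
  unfolding AE_axi_volume using transport[OF t]
  by eventually_elim (auto simp: halfplane_part_in X_facts(2)[OF t])

text \<open>In terms of volume, |\<omega>| dr dz is |\<omega>/r| / (2 \<pi>) times
  \<open>axi_volume\<close>. The first factor is constant along trajectories and the second is
  preserved by the flow, so the image of \<open>W\<close> under \<open>X t\<close> has density
  |\<omega> t|.\<close>

lemma nn_integral_transport:
  assumes t: "0 \<le> t" and [measurable]: "f \<in> borel_measurable borel"
  shows "(\<integral>\<^sup>+ q. f (X t q) \<partial>W) = (\<integral>\<^sup>+ q. ennreal \<bar>h t q\<bar> * f q \<partial>lborel)"
proof -
  note [measurable] = X_facts(1)[OF t] h_measurable[OF t]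
  have axi: "(\<integral>\<^sup>+ q. ennreal \<bar>g q\<bar> * k q \<partial>lborel) = (\<integral>\<^sup>+ q. ennreal \<bar>g q / fst q / (2 * pi)\<bar> * k q \<partial>axi_volume)"
    if [measurable]: "g \<in> borel_measurable borel" "k \<in> borel_measurable borel" and g: "\<And>q. q \<notin> open_halfplane \<Longrightarrow> g q = 0" for g k
  proof (subst nn_integral_axi_volume, measurable, intro nn_integral_cong)
    fix q
    show "ennreal \<bar>g q\<bar> * k q = ennreal (2 * pi * fst q) * indicator open_halfplane q * (ennreal \<bar>g q / fst q / (2 * pi)\<bar> * k q)"
    proof (cases "q \<in> open_halfplane")
      case True
      then have "\<bar>g q\<bar> = 2 * pi * fst q * \<bar>g q / fst q / (2 * pi)\<bar>" by (simp add: open_halfplane_iff abs_mult)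
      then have "ennreal \<bar>g q\<bar> = ennreal (2 * pi * fst q) * ennreal \<bar>g q / fst q / (2 * pi)\<bar>"
        using True by (simp add: open_halfplane_iff ennreal_mult[symmetric])
      then show ?thesis using True by (simp add: mult.assoc)
    qed (simp add: g)
  qed
  have "(\<integral>\<^sup>+ q. f (X t q) \<partial>W) = (\<integral>\<^sup>+ q. ennreal \<bar>h0 q\<bar> * f (X t q) \<partial>lborel)"
    unfolding W_def by (subst nn_integral_density) auto
  also have "\<dots> = (\<integral>\<^sup>+ q. ennreal \<bar>h0 q / fst q / (2 * pi)\<bar> * f (X t q) \<partial>axi_volume)"
    by (rule axi) (auto simp: halfplane_part_out)
  also have "\<dots> = (\<integral>\<^sup>+ q. ennreal \<bar>h t (X t q) / fst (X t q) / (2 * pi)\<bar> * f (X t q) \<partial>axi_volume)"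
    by (rule nn_integral_cong_AE) (use h0_transport[OF t] in eventually_elim, simp)
  also have "\<dots> = (\<integral>\<^sup>+ q. ennreal \<bar>h t q / fst q / (2 * pi)\<bar> * f q \<partial>distr axi_volume borel (X t))"
    by (rule nn_integral_distr[symmetric]) auto
  also have "\<dots> = (\<integral>\<^sup>+ q. ennreal \<bar>h t q\<bar> * f q \<partial>lborel)"
    unfolding X_facts(4)[OF t] by (rule axi[symmetric]) (auto simp: halfplane_part_out)
  finally show ?thesis .
qed

lemma integral_transport:
  fixes f :: "real \<times> real \<Rightarrow> real"
  assumes t: "0 \<le> t" and [measurable]: "f \<in> borel_measurable borel"
  shows "(\<integral>q. sgn (snd q) * f (X t q) \<partial>W) = (\<integral>q. f q * h t q \<partial>lborel)"
proof -
  note [measurable] = X_facts(1)[OF t] h_measurable[OF t]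
  have axi: "(\<integral>q. g q * k q \<partial>lborel) = (\<integral>q. g q / fst q / (2 * pi) * k q \<partial>axi_volume)"
    if [measurable]: "g \<in> borel_measurable borel" "k \<in> borel_measurable borel" and g: "\<And>q. q \<notin> open_halfplane \<Longrightarrow> g q = 0" for g k :: "real \<times> real \<Rightarrow> real"
  proof (subst integral_axi_volume, measurable, intro Bochner_Integration.integral_cong refl)
    fix q
    show "g q * k q = 2 * pi * fst q * indicator open_halfplane q * (g q / fst q / (2 * pi) * k q)"
      by (cases "q \<in> open_halfplane") (simp_all add: open_halfplane_iff g)
  qed
  have "(\<integral>q. sgn (snd q) * f (X t q) \<partial>W) = (\<integral>q. \<bar>h0 q\<bar> * (sgn (snd q) * f (X t q)) \<partial>lborel)"
    unfolding W_def by (subst integral_density) (auto simp: sgn_real_def)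
  also have "\<dots> = (\<integral>q. h0 q * f (X t q) \<partial>lborel)"
  proof (rule integral_cong_AE)
    show "AE q in lborel. \<bar>h0 q\<bar> * (sgn (snd q) * f (X t q)) = h0 q * f (X t q)"
      using h0_sign by eventually_elim (metis mult.assoc mult.commute)
  qed (auto simp: sgn_real_def)
  also have "\<dots> = (\<integral>q. h0 q / fst q / (2 * pi) * f (X t q) \<partial>axi_volume)"
    by (rule axi) (auto simp: halfplane_part_out)
  also have "\<dots> = (\<integral>q. h t (X t q) / fst (X t q) / (2 * pi) * f (X t q) \<partial>axi_volume)"
  proof (rule integral_cong_AE)
    show "AE q in axi_volume. h0 q / fst q / (2 * pi) * f (X t q) = h t (X t q) / fst (X t q) / (2 * pi) * f (X t q)"
      using h0_transport[OF t] by eventually_elim (simp only:)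
  qed measurable
  also have "\<dots> = (\<integral>q. h t q / fst q / (2 * pi) * f q \<partial>distr axi_volume borel (X t))"
    by (rule integral_distr[symmetric]) auto
  also have "\<dots> = (\<integral>q. h t q * f q \<partial>lborel)"
    unfolding X_facts(4)[OF t] by (rule axi[symmetric]) (auto simp: halfplane_part_out)
  finally show ?thesis by (simp add: mult.commute)
qed

lemma emeasure_W_le: "emeasure W UNIV \<le> ennreal M"
  using h0_mass unfolding W_def by (subst emeasure_density) auto

lemma h_tame:
  assumes t: "0 \<le> t" and B: "L1_Linf_le B (\<omega> t)"
  shows "tame (density lborel (\<lambda>q. ennreal \<bar>h t q\<bar>)) B M" and "tame (distr W borel (X t)) B M"
proof -
  note [measurable] = X_facts(1)[OF t] h_measurable[OF t]
  have sW [measurable_cong]: "sets W = sets borel" by (simp add: W_def)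
  have eq: "distr W borel (X t) = density lborel (\<lambda>q. ennreal \<bar>h t q\<bar>)"
  proof (rule measure_eqI)
    fix A assume "A \<in> sets (distr W borel (X t))"
    then have [measurable]: "A \<in> sets borel" by simp
    have "emeasure (distr W borel (X t)) A = (\<integral>\<^sup>+ q. indicator A (X t q) \<partial>W)"
      by (subst nn_integral_indicator[symmetric], simp, subst nn_integral_distr) auto
    also have "\<dots> = (\<integral>\<^sup>+ q. ennreal \<bar>h t q\<bar> * indicator A q \<partial>lborel)" by (rule nn_integral_transport[OF t]) simp
    also have "\<dots> = emeasure (density lborel (\<lambda>q. ennreal \<bar>h t q\<bar>)) A" by (subst emeasure_density) auto
    finally show "emeasure (distr W borel (X t)) A = emeasure (density lborel (\<lambda>q. ennreal \<bar>h t q\<bar>)) A" .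
  qed simp
  have "emeasure (distr W borel (X t)) UNIV \<le> ennreal M"
    using emeasure_W_le by (subst emeasure_distr) (auto simp: W_def)
  moreover have "(\<integral>\<^sup>+ q. f q \<partial>density lborel (\<lambda>q. ennreal \<bar>h t q\<bar>)) \<le> ennreal B * (\<integral>\<^sup>+ q. f q \<partial>lborel)"
    if [measurable]: "f \<in> borel_measurable borel" for f
  proof -
    have "(\<integral>\<^sup>+ q. f q \<partial>density lborel (\<lambda>q. ennreal \<bar>h t q\<bar>)) = (\<integral>\<^sup>+ q. ennreal \<bar>h t q\<bar> * f q \<partial>lborel)"
      by (rule nn_integral_density) auto
    also have "\<dots> \<le> (\<integral>\<^sup>+ q. ennreal B * f q \<partial>lborel)"
      by (rule nn_integral_mono_AE) (use L1_Linf_leD(3)[OF B] in eventually_elim, auto intro!: mult_right_mono ennreal_leI)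
    finally show ?thesis by (simp add: nn_integral_cmult)
  qed
  ultimately show "tame (density lborel (\<lambda>q. ennreal \<bar>h t q\<bar>)) B M"
    using L1_Linf_leD(2)[OF B] M_pos unfolding eq by (auto simp: tame_def)
  then show "tame (distr W borel (X t)) B M" by (simp add: eq)
qed

lemma lagrangian_flow:
  assumes T: "0 \<le> T" shows "\<exists>B. lagrangian_flow W (\<lambda>q. sgn (snd q)) B M T X"
proof -
  obtain B where B: "\<And>t. t \<in> {0..T} \<Longrightarrow> L1_Linf_le B (\<omega> t)" using bounded[of T] by blast
  have "lagrangian_flow W (\<lambda>q. sgn (snd q)) B M T X"
    unfolding lagrangian_flow_def
  proof (intro ballI conjI)
    fix t assume t: "t \<in> {0..T}"
    then have t0: "0 \<le> t" by simp
    note [measurable] = X_facts(1)[OF t0] h_measurable[OF t0]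
    show "X t \<in> borel_measurable borel" by simp
    show "tame (distr W borel (X t)) B M" by (rule h_tame(2)[OF t0 B[OF t]])
    fix p assume p: "p \<in> open_halfplane"
    show Xp: "X t p \<in> open_halfplane" by (rule X_facts(2)[OF t0 p])
    interpret D: tame_density "h t" B M
      by unfold_locales (simp_all add: halfplane_part_out h_tame(1)[OF t0 B[OF t]])
    have vel: "lagrangian_velocity W (\<lambda>q. sgn (snd q)) N (X t) (X t p) = 1 / (2 * pi) * (\<integral>q. kern N (X t p) q * h t q \<partial>lborel)"
      if N: "admissible N" for N
      unfolding lagrangian_velocity_def
      by (subst integral_transport[OF t0 D.measurable_kern_snd[OF N]]) simp
    have "velocity (\<omega> t) (X t p) = (lagrangian_velocity W (\<lambda>q. sgn (snd q)) num_r (X t) (X t p), lagrangian_velocity W (\<lambda>q. sgn (snd q)) num_z (X t) (X t p))"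
      unfolding vel[OF admissible_num_r] vel[OF admissible_num_z]
      by (rule D.velocity_eq[OF _ Xp]) (simp add: halfplane_part_in)
    moreover have "((\<lambda>s. X s p) has_vector_derivative velocity (\<omega> t) (X t p)) (at t within {0..T})"
    proof (rule has_vector_derivative_within_subset)
      show "((\<lambda>s. X s p) has_vector_derivative velocity (\<omega> t) (X t p)) (at t within {0..})"
        using flow p t0 unfolding particle_flow_def by blast
    qed auto
    ultimately have d: "((\<lambda>s. X s p) has_vector_derivative (lagrangian_velocity W (\<lambda>q. sgn (snd q)) num_r (X t) (X t p), lagrangian_velocity W (\<lambda>q. sgn (snd q)) num_z (X t) (X t p))) (at t within {0..T})"
      by (simp only:)
    show "((\<lambda>u. fst (X u p)) has_real_derivative lagrangian_velocity W (\<lambda>q. sgn (snd q)) num_r (X t) (X t p)) (at t within {0..T})"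
      using bounded_linear.has_vector_derivative[OF bounded_linear_fst d]
      by (simp add: has_real_derivative_iff_has_vector_derivative)
    show "((\<lambda>u. snd (X u p)) has_real_derivative lagrangian_velocity W (\<lambda>q. sgn (snd q)) num_z (X t) (X t p)) (at t within {0..T})"
      using bounded_linear.has_vector_derivative[OF bounded_linear_snd d]
      by (simp add: has_real_derivative_iff_has_vector_derivative)
  qed
  then show ?thesis by blast
qed

sublocale odd_flow W X \<Lambda> M Z
proof (rule odd_flow.intro)
  show sW [measurable_cong]: "sets W = sets borel" by (simp add: W_def)
  show "AE q in W. q \<in> open_halfplane"
    unfolding W_def by (subst AE_density, measurable, intro AE_I2 impI, rule ccontr, simp add: halfplane_part_out)
  show "finite_measure W"
    using le_less_trans[OF emeasure_W_le ennreal_less_top] by (intro finite_measureI) (simp add: W_def)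
  show "distr W borel reflect = W"
  proof (rule measure_eqI)
    fix A assume "A \<in> sets (distr W borel reflect)"
    then have [measurable]: "A \<in> sets borel" by simp
    have "emeasure (distr W borel reflect) A = (\<integral>\<^sup>+ q. indicator A (reflect q) \<partial>W)"
      by (subst nn_integral_indicator[symmetric], simp, subst nn_integral_distr) auto
    also have "\<dots> = (\<integral>\<^sup>+ q. ennreal \<bar>h0 q\<bar> * indicator A (reflect q) \<partial>lborel)"
      unfolding W_def by (subst nn_integral_density) auto
    also have "\<dots> = (\<integral>\<^sup>+ q. ennreal \<bar>h0 (reflect q)\<bar> * indicator A (reflect q) \<partial>lborel)"
      by (rule nn_integral_cong_AE) (use h0_reflect in eventually_elim, simp)
    also have "\<dots> = (\<integral>\<^sup>+ q. ennreal \<bar>h0 q\<bar> * indicator A q \<partial>distr lborel borel reflect)"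
      by (rule nn_integral_distr[symmetric]) auto
    also have "\<dots> = emeasure W A"
      unfolding distr_reflect_lborel W_def by (subst emeasure_density) auto
    finally show "emeasure (distr W borel reflect) A = emeasure W A" .
  qed (simp add: W_def)
  show "X 0 p = p" if "p \<in> open_halfplane" for p using flow that by (simp add: particle_flow_def)
  show "inj_on (X t) open_halfplane" if "0 \<le> t" for t by (rule X_facts(3)[OF that])
  show "\<exists>B. lagrangian_flow W (\<lambda>q. sgn (snd q)) B M T X" if "0 \<le> T" for T by (rule lagrangian_flow[OF that])
  show "(\<integral>\<^sup>+ q. f (X t q) \<partial>W) \<le> (\<integral>\<^sup>+ q. ennreal (\<Lambda> * fst q) * indicator open_halfplane q * f q \<partial>lborel)"
    if t: "0 \<le> t" and [measurable]: "f \<in> borel_measurable borel" for t f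
  proof -
    note [measurable] = X_facts(1)[OF t]
    have "(\<integral>\<^sup>+ q. f (X t q) \<partial>W) = (\<integral>\<^sup>+ q. ennreal \<bar>h0 q\<bar> * f (X t q) \<partial>lborel)"
      unfolding W_def by (subst nn_integral_density) auto
    \<comment> \<open>The bound |\<omega>| \<le> \<Lambda> r at time 0 is rewritten as density at
      most \<Lambda> / (2 \<pi>) with respect to volume; in this form the flow preserves it.\<close>
    also have "\<dots> \<le> (\<integral>\<^sup>+ q. ennreal (2 * pi * fst q) * indicator open_halfplane q * (ennreal (\<Lambda> / (2 * pi)) * f (X t q)) \<partial>lborel)"
    proof (rule nn_integral_mono_AE)
      show "AE q in lborel. ennreal \<bar>h0 q\<bar> * f (X t q) \<le> ennreal (2 * pi * fst q) * indicator open_halfplane q * (ennreal (\<Lambda> / (2 * pi)) * f (X t q))"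
        using h0_le
      proof eventually_elim
        case (elim q)
        show ?case
        proof (cases "q \<in> open_halfplane")
          case True
          then have "\<bar>h0 q\<bar> \<le> 2 * pi * fst q * (\<Lambda> / (2 * pi))" using elim by (simp add: mult.commute)
          then have "ennreal \<bar>h0 q\<bar> \<le> ennreal (2 * pi * fst q) * ennreal (\<Lambda> / (2 * pi))"
            using True \<Lambda>_nonneg by (subst ennreal_mult[symmetric]) (auto simp: open_halfplane_iff intro!: ennreal_leI)
          then show ?thesis using True by (simp add: mult.assoc[symmetric] mult_right_mono)
        qed (simp add: halfplane_part_out)
      qed
    qed
    also have "\<dots> = (\<integral>\<^sup>+ q. ennreal (\<Lambda> / (2 * pi)) * f (X t q) \<partial>axi_volume)"
      by (rule nn_integral_axi_volume[symmetric]) measurable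
    also have "\<dots> = (\<integral>\<^sup>+ q. ennreal (\<Lambda> / (2 * pi)) * f q \<partial>distr axi_volume borel (X t))"
      by (rule nn_integral_distr[symmetric]) measurable
    also have "\<dots> = (\<integral>\<^sup>+ q. ennreal (2 * pi * fst q) * indicator open_halfplane q * (ennreal (\<Lambda> / (2 * pi)) * f q) \<partial>lborel)"
      unfolding X_facts(4)[OF t] by (rule nn_integral_axi_volume) measurable
    also have "\<dots> = (\<integral>\<^sup>+ q. ennreal (\<Lambda> * fst q) * indicator open_halfplane q * f q \<partial>lborel)"
    proof (intro nn_integral_cong)
      fix q :: "real \<times> real"
      have "ennreal (2 * pi * fst q) * ennreal (\<Lambda> / (2 * pi)) = ennreal (\<Lambda> * fst q)" if "q \<in> open_halfplane"
        using that \<Lambda>_nonneg by (subst ennreal_mult[symmetric]) (auto simp: open_halfplane_iff mult.commute)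
      then show "ennreal (2 * pi * fst q) * indicator open_halfplane q * (ennreal (\<Lambda> / (2 * pi)) * f q) = ennreal (\<Lambda> * fst q) * indicator open_halfplane q * f q"
        by (cases "q \<in> open_halfplane") (simp_all add: mult.assoc[symmetric])
    qed
    finally show ?thesis .
  qed
  show "(\<integral>\<^sup>+ q. ennreal (snd q) \<partial>W) \<le> ennreal Z"
  proof -
    have "(\<integral>\<^sup>+ q. ennreal (snd q) \<partial>W) = (\<integral>\<^sup>+ q. ennreal \<bar>h0 q\<bar> * ennreal (snd q) \<partial>lborel)"
      unfolding W_def by (subst nn_integral_density) auto
    \<comment> \<open>\<open>ennreal\<close> truncates negative heights to 0, so only labels with z
      > 0 matter here, where |\<omega>| and \<omega> agree.\<close>
    also have "\<dots> \<le> vertical_moment \<omega>\<^sub>0"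
      unfolding vertical_moment_def
    proof (rule nn_integral_mono_AE)
      show "AE q in lborel. ennreal \<bar>h0 q\<bar> * ennreal (snd q) \<le> ennreal (snd q * \<omega>\<^sub>0 q) * indicator halfplane q"
        using h0_sign
      proof eventually_elim
        case (elim q)
        show ?case
        proof (cases "q \<in> open_halfplane \<and> 0 < snd q")
          case True
          then have "\<bar>h0 q\<bar> = \<omega>\<^sub>0 q" "q \<in> halfplane"
            using elim by (auto simp: halfplane_part_in halfplane_def open_halfplane_def)
          then show ?thesis using True by (simp add: ennreal_mult[symmetric] mult.commute)
        next
          case False
          then show ?thesis by (auto simp: halfplane_part_out not_less ennreal_neg)
        qed
      qed
    qed
    finally show ?thesis using moment by (rule order_trans)
  qed
qed (use \<Lambda>_nonneg M_pos Z_pos in auto)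

text \<open>After transport to labels and folding, the mirror term disappears: the partner of an
  upper particle is its reflection and stays below the plane, outside the region of
  integration.\<close>

lemma partial_mass_eq:
  assumes t: "0 \<le> t" shows "partial_mass R (\<omega> t) = lower_mass R t"
proof -
  note [measurable] = X_facts(1)[OF t] h_measurable[OF t]
  let ?E = "{(r, z). 0 < r \<and> r \<le> R \<and> 0 < z} :: (real \<times> real) set"
  have E: "?E = {q. 0 < fst q \<and> fst q \<le> R \<and> 0 < snd q}" by auto
  have Em [measurable]: "?E \<in> sets borel" unfolding E by measurable
  have "partial_mass R (\<omega> t) = (\<integral>q. indicat_real ?E q * h t q \<partial>lborel)"
    unfolding partial_mass_def set_lebesgue_integral_def
    by (intro Bochner_Integration.integral_cong) (auto simp: indicator_def halfplane_part_def open_halfplane_iff)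
  also have "\<dots> = (\<integral>q. sgn (snd q) * indicat_real ?E (X t q) \<partial>W)"
    by (rule integral_transport[OF t, symmetric]) measurable
  also have "\<dots> = (\<integral>q. indicat_real ?E (X t q) - indicat_real ?E (X t (reflect q)) \<partial>Wp)"
  proof (rule integral_W_split(1))
    interpret finite_measure W by (rule finite_W)
    have "(\<lambda>q. sgn (snd q) * indicat_real ?E (X t q)) \<in> borel_measurable W"
      unfolding sgn_real_def by measurable
    then show "integrable W (\<lambda>q. sgn (snd q) * indicat_real ?E (X t q))"
      by (rule integrable_const_bound[of _ 1, rotated]) (auto simp: indicator_def sgn_real_def)
  qed measurable
  also have "\<dots> = (\<integral>q. indicat_real {q. fst q \<le> R} (X t q) \<partial>Wp)"
  proof (rule integral_cong_AE)
    show "AE q in Wp. indicat_real ?E (X t q) - indicat_real ?E (X t (reflect q)) = indicat_real {q. fst q \<le> R} (X t q)"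
      using AE_Wp_upper AE_Wp_pos[OF t]
    proof eventually_elim
      case (elim q)
      then have "X t (reflect q) = reflect (X t q)" using t by blast
      then show ?case using elim by (auto simp: indicator_def E open_halfplane_iff)
    qed
  qed measurable
  also have "\<dots> = (\<integral>q. indicat_real {q. fst q \<le> R} q \<partial>V t)"
    unfolding V_def by (rule integral_distr[symmetric]) measurable
  also have "\<dots> = lower_mass R t"
    unfolding lower_mass_def V_def by simp
  finally show ?thesis .
qed

lemma partial_mass_integral:
  assumes R: "1 \<le> R"
  shows "set_integrable lborel {0..} (\<lambda>t. partial_mass R (\<omega> t) ^ 4)"
    and "(LINT t:{0..}|lborel. partial_mass R (\<omega> t) ^ 4) \<le> 4 * pi * gap_constant \<Lambda> M Z * Z * R ^ 4"
proof -
  show "set_integrable lborel {0..} (\<lambda>t. partial_mass R (\<omega> t) ^ 4)"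
    using lower_mass_integral(1)[OF R M_pos]
    by (rule set_integrable_cong[THEN iffD1, rotated -1]) (auto simp: partial_mass_eq)
  have "(LINT t:{0..}|lborel. partial_mass R (\<omega> t) ^ 4) = (LINT t:{0..}|lborel. lower_mass R t ^ 4)"
    by (rule set_lebesgue_integral_cong) (auto simp: partial_mass_eq)
  then show "(LINT t:{0..}|lborel. partial_mass R (\<omega> t) ^ 4) \<le> 4 * pi * gap_constant \<Lambda> M Z * Z * R ^ 4"
    using lower_mass_integral(2)[OF R M_pos] by simp
qed

end

theorem theorem1p5:
  fixes u\<^sub>0 :: "real ^ 3 \<Rightarrow> real ^ 3" and ur\<^sub>0 uz\<^sub>0 \<omega>\<^sub>0 :: "real \<times> real \<Rightarrow> real"
  assumes "axisymmetric_no_swirl u\<^sub>0 ur\<^sub>0 uz\<^sub>0"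
    and "divergence_free u\<^sub>0"
    and "scalar_vorticity ur\<^sub>0 uz\<^sub>0 \<omega>\<^sub>0"
    and "square_integrable u\<^sub>0"
    and "L1_Linf \<omega>\<^sub>0"
    and "L1_Linf (\<lambda>p. \<omega>\<^sub>0 p / fst p)"
    and "AE (r, z) in lborel. 0 \<le> r \<longrightarrow> \<omega>\<^sub>0 (r, - z) = - \<omega>\<^sub>0 (r, z)"
    and "AE (r, z) in lborel. 0 \<le> r \<and> 0 \<le> z \<longrightarrow> 0 \<le> \<omega>\<^sub>0 (r, z)"
    and "vertical_moment \<omega>\<^sub>0 < \<infinity>"
  shows "\<exists>C>0. \<exists>R\<^sub>0\<ge>1. \<forall>\<omega>. euler_solution \<omega>\<^sub>0 \<omega> \<longrightarrow> (\<forall>R\<ge>R\<^sub>0.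
           set_integrable lborel {0..} (\<lambda>t. partial_mass R (\<omega> t) ^ 4) \<and>
           (LINT t:{0..}|lborel. partial_mass R (\<omega> t) ^ 4) \<le> C * R ^ 4)"
proof -
  obtain B where B: "L1_Linf_le B \<omega>\<^sub>0" using assms(5) by (auto simp: L1_Linf_def)
  obtain \<Lambda> where \<Lambda>: "L1_Linf_le \<Lambda> (\<lambda>p. \<omega>\<^sub>0 p / fst p)" using assms(6) by (auto simp: L1_Linf_def)
  note D = L1_Linf_leD[OF \<Lambda>]
  have part: "halfplane_part (\<lambda>p. \<omega>\<^sub>0 p / fst p) q = halfplane_part \<omega>\<^sub>0 q / fst q" for q
    by (simp add: halfplane_part_def)
  have hm [measurable]: "halfplane_part \<omega>\<^sub>0 \<in> borel_measurable borel" by (rule L1_Linf_leD(1)[OF B])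
  \<comment> \<open>The mass in dr dz is the L^1 norm of \<omega>/r in space divided by 2 \<pi>,
    because the volume element carries the factor r; dividing only helps. The added 1 makes
    \<open>M\<close> strictly positive, as it does for \<open>Z\<close>.\<close>
  define M where "M = \<Lambda> + 1"
  define Z where "Z = enn2real (vertical_moment \<omega>\<^sub>0) + 1"
  have M: "0 < M" using D(2) by (simp add: M_def)
  have Z: "0 < Z" unfolding Z_def by (rule add_nonneg_pos) auto
  have moment: "vertical_moment \<omega>\<^sub>0 \<le> ennreal Z"
  proof -
    have "vertical_moment \<omega>\<^sub>0 = ennreal (enn2real (vertical_moment \<omega>\<^sub>0))" using assms(9) by (simp add: less_top)
    also have "\<dots> \<le> ennreal Z" by (rule ennreal_leI) (simp add: Z_def)
    finally show ?thesis .
  qed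
  have le: "AE q in lborel. \<bar>halfplane_part \<omega>\<^sub>0 q\<bar> \<le> \<Lambda> * fst q \<or> q \<notin> open_halfplane"
    using D(3) by eventually_elim (auto simp: part open_halfplane_iff pos_divide_le_eq)
  have mass: "(\<integral>\<^sup>+ q. ennreal \<bar>halfplane_part \<omega>\<^sub>0 q\<bar> \<partial>lborel) \<le> ennreal M"
  proof -
    have "(\<integral>\<^sup>+ q. ennreal \<bar>halfplane_part \<omega>\<^sub>0 q\<bar> \<partial>lborel) \<le> (\<integral>\<^sup>+ q. ennreal (2 * pi * fst q) * ennreal \<bar>halfplane_part (\<lambda>p. \<omega>\<^sub>0 p / fst p) q\<bar> \<partial>lborel)"
    proof (rule nn_integral_mono)
      fix q :: "real \<times> real"
      show "ennreal \<bar>halfplane_part \<omega>\<^sub>0 q\<bar> \<le> ennreal (2 * pi * fst q) * ennreal \<bar>halfplane_part (\<lambda>p. \<omega>\<^sub>0 p / fst p) q\<bar>"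
      proof (cases "q \<in> open_halfplane")
        case True
        then have q: "0 < fst q" by (simp add: open_halfplane_iff)
        have "\<bar>halfplane_part \<omega>\<^sub>0 q\<bar> = 1 * (fst q * (\<bar>halfplane_part \<omega>\<^sub>0 q\<bar> / fst q))" using q by simp
        also have "\<dots> \<le> 2 * pi * (fst q * (\<bar>halfplane_part \<omega>\<^sub>0 q\<bar> / fst q))"
          using q pi_ge_two by (intro mult_right_mono) auto
        finally have "ennreal \<bar>halfplane_part \<omega>\<^sub>0 q\<bar> \<le> ennreal (2 * pi * fst q * (\<bar>halfplane_part \<omega>\<^sub>0 q\<bar> / fst q))"
          by (intro ennreal_leI) (simp only: mult.assoc)
        then show ?thesis using q by (simp add: part ennreal_mult[symmetric])
      qed (simp add: halfplane_part_out)
    qed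
    also have "\<dots> \<le> ennreal \<Lambda>" by (rule D(4))
    also have "\<dots> \<le> ennreal M" by (rule ennreal_leI) (simp add: M_def)
    finally show ?thesis .
  qed
  define C where "C = 4 * pi * gap_constant \<Lambda> M Z * Z"
  have C: "0 < C"
    unfolding C_def gap_constant_def using M Z D(2)
    by (intro mult_pos_pos add_nonneg_pos add_nonneg_nonneg) auto
  show ?thesis
  \<comment> \<open>\<open>C\<close> is fixed from \<Lambda>, M and Z before any solution is
    considered. The lower bound on the gap asks only for R \<ge> 1, so 1 serves as
    threshold.\<close>
  proof (rule exI[of _ C], intro conjI C, rule exI[of _ "1 :: real"], intro conjI allI impI)
    fix \<omega> R assume sol: "euler_solution \<omega>\<^sub>0 \<omega>" and R: "(1 :: real) \<le> R"
    obtain X where X: "particle_flow \<omega> X"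
      and tr: "\<And>t. 0 \<le> t \<Longrightarrow> AE p in lborel. p \<in> open_halfplane \<longrightarrow> \<omega> t (X t p) / fst (X t p) = \<omega>\<^sub>0 p / fst p"
      using sol unfolding euler_solution_def by blast
    interpret vorticity_transport \<omega>\<^sub>0 \<omega> X \<Lambda> M Z
      by (rule vorticity_transport.intro[OF hm le mass D(2) M Z assms(7,8) moment _ X tr])
        (use sol in \<open>auto simp: euler_solution_def\<close>)
    show "set_integrable lborel {0..} (\<lambda>t. partial_mass R (\<omega> t) ^ 4)"
      by (rule partial_mass_integral(1)[OF R])
    show "(LINT t:{0..}|lborel. partial_mass R (\<omega> t) ^ 4) \<le> C * R ^ 4"
      using partial_mass_integral(2)[OF R] by (simp add: C_def)
  qed simp
qed

end
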